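(* The Lawrence-Sullivan interval $\mathfrak{L}_{\Delta^1}$ is isomorphic, as a complete differential graded Lie algebra, to the cylinder $\mathrm{Cyl}(\mathfrak{L}_{\Delta^0})$.
   Context: All algebraic objects are $\mathbb{Z}$-graded and over $\mathbb{Q}$. A dgl is a graded Lie algebra with a linear derivation $d$ of degree $-1$, $d^2=0$. $\widehat{\mathbb{L}}(V)=\varprojlim_n\mathbb{L}(V)/\mathbb{L}(V)^n$ is the complete free graded Lie algebra on $V$ ($L^1=L$, $L^n=[L,L^{n-1}]$). Morphisms of complete dgl's (cdgl's) are continuous dgl morphisms. A Maurer-Cartan (MC) element is $a$ of degree $-1$ with $da=-\frac12[a,a]$. $\mathfrak{L}_{\Delta^0}=(\mathbb{L}(a),d)$ with $a$ an MC element (for $a$ of degree $-1$, $\mathbb{L}(a)=\widehat{\mathbb{L}}(a)$). The Lawrence-Sullivan interval is $\mathfrak{L}_{\Delta^1}=(\widehat{\mathbb{L}}(a,b,x),d)$ in which $a,b$ are MC elements, $|x|=0$ and $dx=\mathrm{ad}_xb+\sum_{n=0}^\infty\frac{B_n}{n!}\mathrm{ad}_x^n(b-a)=\mathrm{ad}_xb+\frac{\mathrm{ad}_x}{e^{\mathrm{ad}_x}-1}(b-a)$, where $B_n$ is the $n$th Bernoulli number. Cylinder construction: let $L=(\widehat{\mathbb{L}}(V),d)$ be a cdgl. Let $U$ be a copy of $V$ with isomorphism $v\mapsto u$, and $sU$ its suspension ($|su|=|u|+1$). Form $(\widehat{\mathbb{L}}(V\oplus U\oplus sU),d)$ with $d|_V$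 the differential of $L$, $du=0$, $d(su)=u$. Let $i$ be the derivation of degree $+1$ with $i(v)=su$, $i(u)=i(su)=0$, and $\theta=i\circ d+d\circ i$. Let $V'\cong V$ (via $v\mapsto v'$) and $\overline{V}\cong sV$ (via $v\mapsto\overline{v}$, $|\overline v|=|v|+1$). The map $\psi\colon\widehat{\mathbb{L}}(V\oplus V'\oplus\overline{V})\to\widehat{\mathbb{L}}(V\oplus U\oplus sU)$, $\psi(v)=v$, $\psi(v')=e^{\theta}(v)$, $\psi(\overline{v})=su$, is an isomorphism of graded Lie algebras, and $\mathrm{Cyl}(L)=(\widehat{\mathbb{L}}(V\oplus V'\oplus\overline{V}),D)$ with $D=\psi^{-1}\circ d\circ\psi$. *)

theory Defs
  imports "HOL-Computational_Algebra.Formal_Power_Series"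
begin

section \<open>Graded algebras over the rationals\<close>

text \<open>
  A graded algebra is given by its homogeneous components \<open>hcomp L p\<close> (\<open>p\<close> an integer) inside one
  ambient type, with a single zero and with operations defined on sums of homogeneous elements. The
  underlying vector space \<open>gtotal L\<close> is the span of the components. Nothing is asserted about
  the operations outside of it.
\<close>

record 'a galg =
  hcomp :: "int \<Rightarrow> 'a set"
  gzero :: 'a
  gadd :: "'a \<Rightarrow> 'a \<Rightarrow> 'a"  (infixl \<open>\<boxplus>\<index>\<close> 65)
  gscale :: "rat \<Rightarrow> 'a \<Rightarrow> 'a"  (infixr \<open>\<odot>\<index>\<close> 75)
  gbr :: "'a \<Rightarrow> 'a \<Rightarrow> 'a"

definition gsub :: "('a, 'm) galg_scheme \<Rightarrow> 'a \<Rightarrow> 'a \<Rightarrow> 'a"  (infixl \<open>\<boxminus>\<index>\<close> 65)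
  where "x \<boxminus>\<^bsub>L\<^esub> y = x \<boxplus>\<^bsub>L\<^esub> (- 1) \<odot>\<^bsub>L\<^esub> y"

definition gsum_list :: "('a, 'm) galg_scheme \<Rightarrow> 'a list \<Rightarrow> 'a"
  where "gsum_list L xs = foldr (gadd L) xs (gzero L)"

inductive_set gspan :: "('a, 'm) galg_scheme \<Rightarrow> 'a set \<Rightarrow> 'a set"
  for L :: "('a, 'm) galg_scheme" and S :: "'a set" where
  zero: "gzero L \<in> gspan L S"
| base: "x \<in> S \<Longrightarrow> x \<in> gspan L S"
| add: "x \<in> gspan L S \<Longrightarrow> y \<in> gspan L S \<Longrightarrow> x \<boxplus>\<^bsub>L\<^esub> y \<in> gspan L S"
| scale: "x \<in> gspan L S \<Longrightarrow> c \<odot>\<^bsub>L\<^esub> x \<in> gspan L S"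

definition gtotal :: "('a, 'm) galg_scheme \<Rightarrow> 'a set"
  where "gtotal L = gspan L (\<Union>p. hcomp L p)"

text \<open>Two-sided ideal generated by a subset.\<close>

inductive_set gideal :: "('a, 'm) galg_scheme \<Rightarrow> 'a set \<Rightarrow> 'a set"
  for L :: "('a, 'm) galg_scheme" and S :: "'a set" where
  zero: "gzero L \<in> gideal L S"
| base: "x \<in> S \<Longrightarrow> x \<in> gideal L S"
| add: "x \<in> gideal L S \<Longrightarrow> y \<in> gideal L S \<Longrightarrow> x \<boxplus>\<^bsub>L\<^esub> y \<in> gideal L S"
| scale: "x \<in> gideal L S \<Longrightarrow> c \<odot>\<^bsub>L\<^esub> x \<in> gideal L S"
| left: "x \<in> gtotal L \<Longrightarrow> y \<in> gideal L S \<Longrightarrow> gbr L x y \<in> gideal L S"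
| right: "x \<in> gideal L S \<Longrightarrow> y \<in> gtotal L \<Longrightarrow> gbr L x y \<in> gideal L S"

definition graded_vector_space :: "('a, 'm) galg_scheme \<Rightarrow> bool" where
  "graded_vector_space L \<longleftrightarrow>
     (\<forall>x\<in>gtotal L. \<forall>y\<in>gtotal L. \<forall>z\<in>gtotal L.
        (x \<boxplus>\<^bsub>L\<^esub> y) \<boxplus>\<^bsub>L\<^esub> z = x \<boxplus>\<^bsub>L\<^esub> (y \<boxplus>\<^bsub>L\<^esub> z)) \<and>
     (\<forall>x\<in>gtotal L. \<forall>y\<in>gtotal L. x \<boxplus>\<^bsub>L\<^esub> y = y \<boxplus>\<^bsub>L\<^esub> x) \<and>
     (\<forall>x\<in>gtotal L. gzero L \<boxplus>\<^bsub>L\<^esub> x = x \<and> x \<boxminus>\<^bsub>L\<^esub> x = gzero L \<and> 1 \<odot>\<^bsub>L\<^esub> x = x) \<and>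
     (\<forall>r s. \<forall>x\<in>gtotal L. (r * s) \<odot>\<^bsub>L\<^esub> x = r \<odot>\<^bsub>L\<^esub> s \<odot>\<^bsub>L\<^esub> x \<and>
        (r + s) \<odot>\<^bsub>L\<^esub> x = r \<odot>\<^bsub>L\<^esub> x \<boxplus>\<^bsub>L\<^esub> s \<odot>\<^bsub>L\<^esub> x) \<and>
     (\<forall>r. \<forall>x\<in>gtotal L. \<forall>y\<in>gtotal L. r \<odot>\<^bsub>L\<^esub> (x \<boxplus>\<^bsub>L\<^esub> y) = r \<odot>\<^bsub>L\<^esub> x \<boxplus>\<^bsub>L\<^esub> r \<odot>\<^bsub>L\<^esub> y) \<and>
     (\<forall>p. gspan L (hcomp L p) \<subseteq> hcomp L p) \<and>
     \<comment> \<open>the sum of the components is direct\<close>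
     (\<forall>ps x. distinct ps \<and> (\<forall>p\<in>set ps. x p \<in> hcomp L p) \<and> gsum_list L (map x ps) = gzero L
        \<longrightarrow> (\<forall>p\<in>set ps. x p = gzero L))"

definition graded_lie_algebra :: "('a, 'm) galg_scheme \<Rightarrow> bool" where
  "graded_lie_algebra L \<longleftrightarrow> graded_vector_space L \<and>
     (\<forall>x\<in>gtotal L. \<forall>y\<in>gtotal L. \<forall>z\<in>gtotal L.
        gbr L (x \<boxplus>\<^bsub>L\<^esub> y) z = gbr L x z \<boxplus>\<^bsub>L\<^esub> gbr L y z \<and>
        gbr L z (x \<boxplus>\<^bsub>L\<^esub> y) = gbr L z x \<boxplus>\<^bsub>L\<^esub> gbr L z y) \<and>
     (\<forall>r. \<forall>x\<in>gtotal L. \<forall>y\<in>gtotal L.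
        gbr L (r \<odot>\<^bsub>L\<^esub> x) y = r \<odot>\<^bsub>L\<^esub> gbr L x y \<and> gbr L x (r \<odot>\<^bsub>L\<^esub> y) = r \<odot>\<^bsub>L\<^esub> gbr L x y) \<and>
     (\<forall>p q. \<forall>x\<in>hcomp L p. \<forall>y\<in>hcomp L q. gbr L x y \<in> hcomp L (p + q)) \<and>
     (\<forall>p q. \<forall>x\<in>hcomp L p. \<forall>y\<in>hcomp L q.
        gbr L x y = (- ((- 1) powi (p * q))) \<odot>\<^bsub>L\<^esub> gbr L y x) \<and>
     (\<forall>p q r. \<forall>x\<in>hcomp L p. \<forall>y\<in>hcomp L q. \<forall>z\<in>hcomp L r.
        gbr L x (gbr L y z) =
          gbr L (gbr L x y) z \<boxplus>\<^bsub>L\<^esub> ((- 1) powi (p * q)) \<odot>\<^bsub>L\<^esub> gbr L y (gbr L x z))"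

section \<open>Quotients and inverse limits\<close>

definition coset :: "('a, 'm) galg_scheme \<Rightarrow> 'a set \<Rightarrow> 'a \<Rightarrow> 'a set"
  where "coset L I x = {x \<boxplus>\<^bsub>L\<^esub> y | y. y \<in> I}"

definition quotient_galg :: "('a, 'm) galg_scheme \<Rightarrow> 'a set \<Rightarrow> 'a set galg" where
  "quotient_galg L I =
     \<lparr> hcomp = (\<lambda>p. coset L I ` hcomp L p),
       gzero = coset L I (gzero L),
       gadd = (\<lambda>A B. \<Union>x\<in>A. \<Union>y\<in>B. coset L I (x \<boxplus>\<^bsub>L\<^esub> y)),
       gscale = (\<lambda>c A. \<Union>x\<in>A. coset L I (c \<odot>\<^bsub>L\<^esub> x)),
       gbr = (\<lambda>A B. \<Union>x\<in>A. \<Union>y\<in>B. coset L I (gbr L x y)) \<rparr>"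

text \<open>
  The inverse limit of the quotients \<open>L / F n\<close> in the category of graded algebras, so it is
  formed degree by degree; the transition map \<open>L / F (n + 1) \<rightarrow> L / F n\<close> sends a coset \<open>C\<close> to
  \<open>C + F n\<close>.
\<close>

definition lim_galg :: "('a, 'm) galg_scheme \<Rightarrow> (nat \<Rightarrow> 'a set) \<Rightarrow> (nat \<Rightarrow> 'a set) galg" where
  "lim_galg L F =
     \<lparr> hcomp = (\<lambda>p. {s. (\<forall>n. s n \<in> hcomp (quotient_galg L (F n)) p) \<and>
                        (\<forall>n. s n = (\<Union>x\<in>s (Suc n). coset L (F n) x))}),
       gzero = (\<lambda>n. gzero (quotient_galg L (F n))),
       gadd = (\<lambda>s t n. gadd (quotient_galg L (F n)) (s n) (t n)),
       gscale = (\<lambda>c s n. gscale (quotient_galg L (F n)) c (s n)),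
       gbr = (\<lambda>s t n. gbr (quotient_galg L (F n)) (s n) (t n)) \<rparr>"

text \<open>
  The lower central series \<open>L\<^sup>1 = L\<close>, \<open>L\<^sup>n = [L, L\<^sup>n\<^sup>-\<^sup>1]\<close>. The value at \<open>0\<close> is a dummy, which
  adds only the zero quotient \<open>L / L\<close> to the inverse system.
\<close>

fun lower_central :: "('a, 'm) galg_scheme \<Rightarrow> nat \<Rightarrow> 'a set" where
  "lower_central L 0 = gtotal L"
| "lower_central L (Suc 0) = gtotal L"
| "lower_central L (Suc (Suc n)) =
     gspan L {gbr L x y | x y. x \<in> gtotal L \<and> y \<in> lower_central L (Suc n)}"

section \<open>Complete differential graded Lie algebras\<close>

text \<open>The topology is carried as a filtration, whose members are the neighbourhoods of zero.\<close>

record 'a fgalg = "'a galg" +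
  filt :: "nat \<Rightarrow> 'a set"

record 'a dgl = "'a fgalg" +
  diff :: "'a \<Rightarrow> 'a"

definition graded_linear ::
    "('a, 'm) galg_scheme \<Rightarrow> ('b, 'n) galg_scheme \<Rightarrow> int \<Rightarrow> ('a \<Rightarrow> 'b) \<Rightarrow> bool" where
  "graded_linear L M k f \<longleftrightarrow>
     (\<forall>x\<in>gtotal L. \<forall>y\<in>gtotal L. f (x \<boxplus>\<^bsub>L\<^esub> y) = f x \<boxplus>\<^bsub>M\<^esub> f y) \<and>
     (\<forall>c. \<forall>x\<in>gtotal L. f (c \<odot>\<^bsub>L\<^esub> x) = c \<odot>\<^bsub>M\<^esub> f x) \<and>
     (\<forall>p. \<forall>x\<in>hcomp L p. f x \<in> hcomp M (p + k))"

text \<open>As usual for graded objects, continuity means continuity on each homogeneous component.\<close>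

definition continuous_linear ::
    "('a, 'm) fgalg_scheme \<Rightarrow> ('b, 'n) fgalg_scheme \<Rightarrow> ('a \<Rightarrow> 'b) \<Rightarrow> bool" where
  "continuous_linear L M f \<longleftrightarrow> (\<forall>p n. \<exists>m. f ` (filt L m \<inter> hcomp L p) \<subseteq> filt M n)"

definition lie_morphism ::
    "('a, 'm) galg_scheme \<Rightarrow> ('b, 'n) galg_scheme \<Rightarrow> ('a \<Rightarrow> 'b) \<Rightarrow> bool" where
  "lie_morphism L M f \<longleftrightarrow> graded_linear L M 0 f \<and>
     (\<forall>x\<in>gtotal L. \<forall>y\<in>gtotal L. f (gbr L x y) = gbr M (f x) (f y))"

definition derivation :: "('a, 'm) galg_scheme \<Rightarrow> int \<Rightarrow> ('a \<Rightarrow> 'a) \<Rightarrow> bool" where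
  "derivation L k D \<longleftrightarrow> graded_linear L L k D \<and>
     (\<forall>p. \<forall>x\<in>hcomp L p. \<forall>y\<in>gtotal L.
        D (gbr L x y) = gbr L (D x) y \<boxplus>\<^bsub>L\<^esub> ((- 1) powi (k * p)) \<odot>\<^bsub>L\<^esub> gbr L x (D y))"

text \<open>
  Complete: the filtration consists of graded differential ideals, is compatible with the bracket,
  starts with \<open>F\<^sup>1 = L\<close>, and the canonical map \<open>L \<rightarrow> lim L / F\<^sup>n\<close> is bijective in each degree. As for
  the lower central series, the index \<open>0\<close> is a dummy.
\<close>

definition cdgl :: "('a, 'm) dgl_scheme \<Rightarrow> bool" where
  "cdgl L \<longleftrightarrow> graded_lie_algebra L \<and>
     derivation L (- 1) (diff L) \<and> (\<forall>x\<in>gtotal L. diff L (diff L x) = gzero L) \<and>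
     filt L 0 = gtotal L \<and> filt L 1 = gtotal L \<and>
     (\<forall>n. filt L (Suc n) \<subseteq> filt L n) \<and>
     (\<forall>n. filt L n = gspan L (\<Union>p. filt L n \<inter> hcomp L p)) \<and>
     (\<forall>m n. \<forall>x\<in>filt L m. \<forall>y\<in>filt L n. gbr L x y \<in> filt L (m + n)) \<and>
     (\<forall>n. diff L ` filt L n \<subseteq> filt L n) \<and>
     (\<forall>p. bij_betw (\<lambda>x n. coset L (filt L n) x) (hcomp L p) (hcomp (lim_galg L (filt L)) p))"

definition cdgl_morphism ::
    "('a, 'm) dgl_scheme \<Rightarrow> ('b, 'n) dgl_scheme \<Rightarrow> ('a \<Rightarrow> 'b) \<Rightarrow> bool" where
  "cdgl_morphism L M f \<longleftrightarrow> lie_morphism L M f \<and> continuous_linear L M f \<and>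
     (\<forall>x\<in>gtotal L. f (diff L x) = diff M (f x))"

definition cdgl_isomorphic :: "('a, 'm) dgl_scheme \<Rightarrow> ('b, 'n) dgl_scheme \<Rightarrow> bool" where
  "cdgl_isomorphic L M \<longleftrightarrow> cdgl L \<and> cdgl M \<and>
     (\<exists>f g. cdgl_morphism L M f \<and> cdgl_morphism M L g \<and>
        (\<forall>x\<in>gtotal L. g (f x) = x) \<and> (\<forall>y\<in>gtotal M. f (g y) = y))"

definition flim :: "('a, 'm) fgalg_scheme \<Rightarrow> (nat \<Rightarrow> 'a) \<Rightarrow> 'a" where
  "flim L s = (THE l. l \<in> gtotal L \<and> (\<forall>n. \<exists>N. \<forall>k\<ge>N. s k \<boxminus>\<^bsub>L\<^esub> l \<in> filt L n))"

definition fsuminf :: "('a, 'm) fgalg_scheme \<Rightarrow> (nat \<Rightarrow> 'a) \<Rightarrow> 'a" where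
  "fsuminf L f = flim L (\<lambda>k. gsum_list L (map f [0..<k]))"

section \<open>The complete free graded Lie algebra\<close>

text \<open>
  A graded vector space \<open>V\<close> is given by a homogeneous basis: the elements of the type \<open>'g\<close>, with
  degrees \<open>deg\<close>. The free graded Lie algebra on \<open>V\<close> is the quotient of the free non-associative
  graded algebra (finitely supported functions on bracketed words) by the ideal generated by graded
  antisymmetry and the graded Jacobi identity.
\<close>

datatype 'g brword = Gen 'g | Br "'g brword" "'g brword"

primrec brdeg :: "('g \<Rightarrow> int) \<Rightarrow> 'g brword \<Rightarrow> int" where
  "brdeg deg (Gen v) = deg v"
| "brdeg deg (Br l r) = brdeg deg l + brdeg deg r"

definition free_nonassoc :: "('g \<Rightarrow> int) \<Rightarrow> ('g brword \<Rightarrow> rat) galg" where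
  "free_nonassoc deg =
     \<lparr> hcomp = (\<lambda>p. {f. finite {t. f t \<noteq> 0} \<and> (\<forall>t. f t \<noteq> 0 \<longrightarrow> brdeg deg t = p)}),
       gzero = (\<lambda>t. 0),
       gadd = (\<lambda>f g t. f t + g t),
       gscale = (\<lambda>c f t. c * f t),
       gbr = (\<lambda>f g t. case t of Gen v \<Rightarrow> 0 | Br l r \<Rightarrow> f l * g r) \<rparr>"

definition lie_relations :: "('a, 'm) galg_scheme \<Rightarrow> 'a set" where
  "lie_relations A =
     {gbr A x y \<boxplus>\<^bsub>A\<^esub> ((- 1) powi (p * q)) \<odot>\<^bsub>A\<^esub> gbr A y x | p q x y.
        x \<in> hcomp A p \<and> y \<in> hcomp A q} \<union>
     {gbr A x (gbr A y z) \<boxminus>\<^bsub>A\<^esub>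
        (gbr A (gbr A x y) z \<boxplus>\<^bsub>A\<^esub> ((- 1) powi (p * q)) \<odot>\<^bsub>A\<^esub> gbr A y (gbr A x z)) | p q r x y z.
        x \<in> hcomp A p \<and> y \<in> hcomp A q \<and> z \<in> hcomp A r}"

definition free_ideal :: "('g \<Rightarrow> int) \<Rightarrow> ('g brword \<Rightarrow> rat) set" where
  "free_ideal deg = gideal (free_nonassoc deg) (lie_relations (free_nonassoc deg))"

definition free_lie :: "('g \<Rightarrow> int) \<Rightarrow> ('g brword \<Rightarrow> rat) set galg" where
  "free_lie deg = quotient_galg (free_nonassoc deg) (free_ideal deg)"

definition free_gen :: "('g \<Rightarrow> int) \<Rightarrow> 'g \<Rightarrow> ('g brword \<Rightarrow> rat) set" where
  "free_gen deg v = coset (free_nonassoc deg) (free_ideal deg) (\<lambda>t. if t = Gen v then 1 else 0)"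

type_synonym 'g cfl = "nat \<Rightarrow> ('g brword \<Rightarrow> rat) set set"

text \<open>
  The filtration consists of the kernels of the projections onto the quotients
  \<open>L(V) / L(V)\<^sup>n\<close>, i.e. it defines the inverse limit topology.
\<close>

definition cfree_lie :: "('g \<Rightarrow> int) \<Rightarrow> 'g cfl fgalg" where
  "cfree_lie deg =
     (let L = free_lie deg; C = lim_galg L (lower_central L)
      in galg.extend C
           (fgalg.fields
             (\<lambda>n. {s \<in> gtotal C. s n = gzero (quotient_galg L (lower_central L n))})))"

definition cgen :: "('g \<Rightarrow> int) \<Rightarrow> 'g \<Rightarrow> 'g cfl" where
  "cgen deg v = (\<lambda>n. coset (free_lie deg) (lower_central (free_lie deg) n) (free_gen deg v))"

text \<open>
  Continuous morphisms and continuous derivations are determined on \<open>gtotal\<close> by their values on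
  the generators; the choice only concerns arguments outside of \<open>gtotal\<close>.
\<close>

definition extend_morphism ::
    "('g \<Rightarrow> int) \<Rightarrow> ('b, 'n) fgalg_scheme \<Rightarrow> ('g \<Rightarrow> 'b) \<Rightarrow> 'g cfl \<Rightarrow> 'b" where
  "extend_morphism deg M g =
     (SOME f. lie_morphism (cfree_lie deg) M f \<and> continuous_linear (cfree_lie deg) M f \<and>
        (\<forall>v. f (cgen deg v) = g v))"

definition extend_derivation ::
    "('g \<Rightarrow> int) \<Rightarrow> int \<Rightarrow> ('g \<Rightarrow> 'g cfl) \<Rightarrow> 'g cfl \<Rightarrow> 'g cfl" where
  "extend_derivation deg k g =
     (SOME D. derivation (cfree_lie deg) k D \<and>
        continuous_linear (cfree_lie deg) (cfree_lie deg) D \<and>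
        (\<forall>v. D (cgen deg v) = g v))"

definition cfree_dgl :: "('g \<Rightarrow> int) \<Rightarrow> ('g cfl \<Rightarrow> 'g cfl) \<Rightarrow> 'g cfl dgl" where
  "cfree_dgl deg d = fgalg.extend (cfree_lie deg) (dgl.fields d)"

section \<open>The point and the Lawrence-Sullivan interval\<close>

text \<open>The value of \<open>d\<close> on a Maurer-Cartan element \<open>a\<close>.\<close>

definition mc_diff :: "('a, 'm) galg_scheme \<Rightarrow> 'a \<Rightarrow> 'a" where
  "mc_diff L a = (- 1 / 2) \<odot>\<^bsub>L\<^esub> gbr L a a"

definition point_deg :: "unit \<Rightarrow> int" where
  "point_deg _ = - 1"

text \<open>
  For a single generator of degree \<open>- 1\<close> the lower central series vanishes from the third term on,
  so the free graded Lie algebra coincides with its completion.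
\<close>

definition LS_point :: "unit cfl dgl" where
  "LS_point = cfree_dgl point_deg
     (extend_derivation point_deg (- 1) (\<lambda>v. mc_diff (cfree_lie point_deg) (cgen point_deg v)))"

text \<open>\<open>B\<^sub>n\<close> with \<open>B\<^sub>1 = - 1 / 2\<close>, by the generating function \<open>X / (e\<^sup>X - 1) = \<Sum> B\<^sub>n X\<^sup>n / n!\<close>.\<close>

definition bernoulli :: "nat \<Rightarrow> rat" where
  "bernoulli n = fact n * fps_nth (fps_X / (fps_exp 1 - 1)) n"

datatype interval_gen = IA | IB | IX

primrec interval_deg :: "interval_gen \<Rightarrow> int" where
  "interval_deg IA = - 1"
| "interval_deg IB = - 1"
| "interval_deg IX = 0"

definition interval_diff :: "interval_gen \<Rightarrow> interval_gen cfl" where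
  "interval_diff v =
     (let L = cfree_lie interval_deg;
          a = cgen interval_deg IA; b = cgen interval_deg IB; x = cgen interval_deg IX
      in case v of
           IA \<Rightarrow> mc_diff L a
         | IB \<Rightarrow> mc_diff L b
         | IX \<Rightarrow> gbr L x b \<boxplus>\<^bsub>L\<^esub>
             fsuminf L (\<lambda>n. (bernoulli n / fact n) \<odot>\<^bsub>L\<^esub> ((gbr L x) ^^ n) (b \<boxminus>\<^bsub>L\<^esub> a)))"

definition LS_interval :: "interval_gen cfl dgl" where
  "LS_interval = cfree_dgl interval_deg (extend_derivation interval_deg (- 1) interval_diff)"

section \<open>The cylinder of a complete free dgl\<close>

text \<open>
  Two presentations of the same cylinder: a basis of \<open>V \<oplus> U \<oplus> sU\<close>, where \<open>U\<close> is a copy of \<open>V\<close>,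
  and a basis of \<open>V \<oplus> V' \<oplus> sV\<close>, where \<open>V'\<close> is a copy of \<open>V\<close>.
\<close>

datatype 'g vus_gen = InV 'g | InU 'g | InSU 'g

primrec vus_deg :: "('g \<Rightarrow> int) \<Rightarrow> 'g vus_gen \<Rightarrow> int" where
  "vus_deg deg (InV v) = deg v"
| "vus_deg deg (InU v) = deg v"
| "vus_deg deg (InSU v) = deg v + 1"

datatype 'g cyl_gen = Bot 'g | Top 'g | Bar 'g

primrec cyl_deg :: "('g \<Rightarrow> int) \<Rightarrow> 'g cyl_gen \<Rightarrow> int" where
  "cyl_deg deg (Bot v) = deg v"
| "cyl_deg deg (Top v) = deg v"
| "cyl_deg deg (Bar v) = deg v + 1"

definition vus_incl :: "('g \<Rightarrow> int) \<Rightarrow> 'g cfl \<Rightarrow> 'g vus_gen cfl" where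
  "vus_incl deg =
     extend_morphism deg (cfree_lie (vus_deg deg)) (\<lambda>v. cgen (vus_deg deg) (InV v))"

definition vus_diff :: "('g \<Rightarrow> int) \<Rightarrow> ('g cfl \<Rightarrow> 'g cfl) \<Rightarrow> 'g vus_gen cfl \<Rightarrow> 'g vus_gen cfl" where
  "vus_diff deg d = extend_derivation (vus_deg deg) (- 1)
     (\<lambda>w. case w of
            InV v \<Rightarrow> vus_incl deg (d (cgen deg v))
          | InU v \<Rightarrow> gzero (cfree_lie (vus_deg deg))
          | InSU v \<Rightarrow> cgen (vus_deg deg) (InU v))"

definition vus_i :: "('g \<Rightarrow> int) \<Rightarrow> 'g vus_gen cfl \<Rightarrow> 'g vus_gen cfl" where
  "vus_i deg = extend_derivation (vus_deg deg) 1
     (\<lambda>w. case w of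
            InV v \<Rightarrow> cgen (vus_deg deg) (InSU v)
          | InU v \<Rightarrow> gzero (cfree_lie (vus_deg deg))
          | InSU v \<Rightarrow> gzero (cfree_lie (vus_deg deg)))"

definition vus_theta :: "('g \<Rightarrow> int) \<Rightarrow> ('g cfl \<Rightarrow> 'g cfl) \<Rightarrow> 'g vus_gen cfl \<Rightarrow> 'g vus_gen cfl" where
  "vus_theta deg d x =
     gadd (cfree_lie (vus_deg deg)) (vus_i deg (vus_diff deg d x)) (vus_diff deg d (vus_i deg x))"

definition gexp :: "('a, 'm) fgalg_scheme \<Rightarrow> ('a \<Rightarrow> 'a) \<Rightarrow> 'a \<Rightarrow> 'a" where
  "gexp L h x = fsuminf L (\<lambda>n. (1 / fact n) \<odot>\<^bsub>L\<^esub> (h ^^ n) x)"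

definition cyl_psi :: "('g \<Rightarrow> int) \<Rightarrow> ('g cfl \<Rightarrow> 'g cfl) \<Rightarrow> 'g cyl_gen cfl \<Rightarrow> 'g vus_gen cfl" where
  "cyl_psi deg d = extend_morphism (cyl_deg deg) (cfree_lie (vus_deg deg))
     (\<lambda>w. case w of
            Bot v \<Rightarrow> cgen (vus_deg deg) (InV v)
          | Top v \<Rightarrow> gexp (cfree_lie (vus_deg deg)) (vus_theta deg d) (cgen (vus_deg deg) (InV v))
          | Bar v \<Rightarrow> cgen (vus_deg deg) (InSU v))"

text \<open>The cylinder of a dgl \<open>L\<close> whose underlying graded Lie algebra is \<open>cfree_lie deg\<close>.\<close>

definition cylinder :: "('g \<Rightarrow> int) \<Rightarrow> 'g cfl dgl \<Rightarrow> 'g cyl_gen cfl dgl" where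
  "cylinder deg L = cfree_dgl (cyl_deg deg)
     (\<lambda>y. inv_into (gtotal (cfree_lie (cyl_deg deg))) (cyl_psi deg (diff L))
            (vus_diff deg (diff L) (cyl_psi deg (diff L) y)))"

end

theory Submission
  imports Defs "HOL-Library.Function_Algebras"
begin

text \<open>
  The differential of the cylinder is \<open>\<psi>\<^sup>-\<^sup>1 \<circ> d \<circ> \<psi>\<close>, so it can be computed on generators. For the
  point, \<open>V\<close> has one generator \<open>a\<close> of degree \<open>- 1\<close> with \<open>d a = - [a, a] / 2\<close>. Write \<open>u\<close> for its copy in
  \<open>U\<close> and \<open>x = su\<close>. The Leibniz rule gives \<open>\<theta> a = u - [x, a]\<close> and \<open>\<theta> u = \<theta> x = 0\<close>, hence
  \<open>\<theta>\<^sup>n\<^sup>+\<^sup>1 a = (- ad\<^sub>x)\<^sup>n (u - [x, a])\<close>. With \<open>X = ad\<^sub>x\<close> and the power series \<open>\<phi> = (1 - e\<^sup>-\<^sup>X) / X\<close>, the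
  exponential \<open>b = e\<^sup>\<theta> a\<close> is

    \<open>b = e\<^sup>-\<^sup>X a + \<phi>(X) u\<close>.

  Solving for \<open>u\<close>, with the Bernoulli series \<open>\<beta> = X / (e\<^sup>X - 1)\<close> and \<open>\<beta> e\<^sup>X \<phi> = 1\<close>, gives

    \<open>u = \<beta>(X) e\<^sup>X b - \<beta>(X) a = [x, b] + \<beta>(X) (b - a)\<close>,

  which is the formula of Lawrence and Sullivan (\<open>LS_formula_endpoint\<close>). As \<open>d x = u\<close>, the generator
  \<open>Bar\<close> has the differential of \<open>IX\<close>. Read backwards (\<open>endpoint_LS_formula\<close>), the same computation says
  that \<open>\<psi>\<close> is invertible. The differential of \<open>Bot\<close> is that of \<open>a\<close>. Finally \<open>\<theta>\<close> is a derivation of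
  degree \<open>0\<close> which commutes with \<open>d\<close>, so its exponential respects brackets and \<open>d\<close>; therefore \<open>b\<close> is
  a Maurer-Cartan element like \<open>a\<close> (\<open>cexp_mc\<close>). So the renaming \<open>IA \<mapsto> Bot\<close>, \<open>IB \<mapsto> Top\<close>,
  \<open>IX \<mapsto> Bar\<close> of generators is an isomorphism. The equation \<open>d\<^sup>2 = 0\<close> for the interval is inherited
  from the cylinder, where it follows from the Jacobi identity \<open>[a, [a, a]] = 0\<close>.

  The other half of the work is to make the completed free Lie algebra usable. For finitely many
  generators it is a quotient of the space of all rational-valued functions on bracketed words: a function is
  null if all its truncations by word length lie in the ideal of Lie relations. The relations are
  homogeneous for the word length, and by the Jacobi identity the words of length at least \<open>n\<close> span the
  \<open>n\<close>-th term of the lower central series (\<open>lower_central_free_lie\<close>). Therefore the quotient is, in each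
  degree, the inverse limit (\<open>models_lim\<close>). It becomes a type \<open>'g cl\<close>, with the degrees of the generators supplied by a type class.
  On this type all operations are total, and algebra and limits are computed there. Continuous
  morphisms and derivations are constructed by evaluating words (\<open>cl_morphism_exists\<close>,
  \<open>cl_derivation_exists\<close>) and are unique because the combinations of words are dense. The map \<open>emb\<close>
  then identifies the type with the records (\<open>extend_morphism_eq\<close>, \<open>extend_derivation_eq\<close>,
  \<open>cdgl_of_cl\<close>).
\<close>

text \<open>
  Functions on words are manipulated as vectors; pointwise evaluation is unfolded on demand.
\<close>

declare plus_fun_apply [simp del] zero_fun_apply [simp del] minus_apply [simp del] uminus_apply [simp del]

lemmas pointwise = plus_fun_apply zero_fun_apply minus_apply uminus_apply

section \<open>Bracketed words and functions on them\<close>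

definition finsupp :: "('g brword \<Rightarrow> rat) set"
  where "finsupp = {f. finite {t. f t \<noteq> 0}}"

definition fscale :: "rat \<Rightarrow> ('g brword \<Rightarrow> rat) \<Rightarrow> 'g brword \<Rightarrow> rat"
  where "fscale c f = (\<lambda>t. c * f t)"

definition fbr :: "('g brword \<Rightarrow> rat) \<Rightarrow> ('g brword \<Rightarrow> rat) \<Rightarrow> 'g brword \<Rightarrow> rat"
  where "fbr f g = (\<lambda>t. case t of Gen v \<Rightarrow> 0 | Br l r \<Rightarrow> f l * g r)"

definition delta :: "'g brword \<Rightarrow> 'g brword \<Rightarrow> rat"
  where "delta w = (\<lambda>t. if t = w then 1 else 0)"

definition restr :: "('g brword \<Rightarrow> bool) \<Rightarrow> ('g brword \<Rightarrow> rat) \<Rightarrow> 'g brword \<Rightarrow> rat"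
  where "restr P f = (\<lambda>t. if P t then f t else 0)"

primrec brlen :: "'g brword \<Rightarrow> nat" where
  "brlen (Gen v) = 1"
| "brlen (Br l r) = brlen l + brlen r"

abbreviation trunc :: "nat \<Rightarrow> ('g brword \<Rightarrow> rat) \<Rightarrow> 'g brword \<Rightarrow> rat"
  where "trunc n \<equiv> restr (\<lambda>t. brlen t < n)"

abbreviation parity_sign :: "int \<Rightarrow> rat"
  where "parity_sign k \<equiv> (- 1) powi k"

lemma brlen_pos: "0 < brlen w"
  by (induction w) auto

lemma brlen_neq_0 [simp]: "brlen w \<noteq> 0"
  using brlen_pos[of w] by simp

lemma fbr_apply [simp]: "fbr f g (Gen v) = 0" "fbr f g (Br l r) = f l * g r"
  by (simp_all add: fbr_def)

lemma fun_brword_eqI: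
  assumes "\<And>v. f (Gen v) = g (Gen v)" "\<And>l r. f (Br l r) = g (Br l r)"
  shows "f = g"
proof
  show "f t = g t" for t by (cases t) (simp_all add: assms)
qed

lemma fbr_linear:
  "fbr (f + g) h = fbr f h + fbr g h" "fbr h (f + g) = fbr h f + fbr h g"
  "fbr (f - g) h = fbr f h - fbr g h" "fbr h (f - g) = fbr h f - fbr h g"
  "fbr (fscale c f) h = fscale c (fbr f h)" "fbr h (fscale c f) = fscale c (fbr h f)"
  "fbr 0 h = 0" "fbr h 0 = 0"
  by (rule fun_brword_eqI; simp add: fscale_def pointwise algebra_simps)+

lemma fbr_delta [simp]: "fbr (delta a) (delta b) = delta (Br a b)"
  by (rule fun_brword_eqI) (auto simp: delta_def)

lemma fscale_linear:
  "fscale c (f + g) = fscale c f + fscale c g" "fscale c (f - g) = fscale c f - fscale c g"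
  "fscale (a + b) f = fscale a f + fscale b f" "fscale a (fscale b f) = fscale (a * b) f"
  "fscale 1 f = f" "fscale 0 f = 0" "fscale c 0 = 0" "fscale (- 1) f = - f" "fscale (- c) f = - fscale c f"
  by (rule ext; simp add: fscale_def pointwise algebra_simps)+

lemma restr_linear:
  "restr P (f + g) = restr P f + restr P g" "restr P (f - g) = restr P f - restr P g"
  "restr P (fscale c f) = fscale c (restr P f)" "restr P 0 = 0" "restr P (- f) = - restr P f"
  by (rule ext; simp add: restr_def fscale_def pointwise)+

lemma restr_delta: "restr P (delta w) = (if P w then delta w else 0)"
  by (rule ext) (auto simp: restr_def delta_def pointwise)

lemma restr_False [simp]: "restr (\<lambda>t. False) f = 0"
  by (rule ext) (simp add: restr_def pointwise)

lemma trunc_trunc: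
  "m \<le> n \<Longrightarrow> trunc m (trunc n f) = trunc m f" "n \<le> m \<Longrightarrow> trunc m (trunc n f) = trunc n f"
  by (auto simp: restr_def)

text \<open>
  The length of a bracket exceeds the lengths of both factors, so a truncated product depends only on
  truncated factors.
\<close>

lemma trunc_fbr_left: "trunc n (fbr (trunc n f) g) = trunc n (fbr f g)"
  by (rule fun_brword_eqI) (auto simp: restr_def)

lemma trunc_fbr_right: "trunc (Suc n) (fbr f (trunc n g)) = trunc (Suc n) (fbr f g)"
proof (rule fun_brword_eqI)
  show "trunc (Suc n) (fbr f (trunc n g)) (Br l r) = trunc (Suc n) (fbr f g) (Br l r)" for l r
    using brlen_pos[of l] by (auto simp: restr_def)
qed (simp add: restr_def)

lemma trunc_fbr_right': "trunc n (fbr f (trunc n g)) = trunc n (fbr f g)"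
  by (rule fun_brword_eqI) (auto simp: restr_def)

lemma finite_brlen_less: "finite {t :: 'g::finite brword. brlen t < n}"
proof (induction n)
  case (Suc n)
  have "t \<in> range Gen \<union> (\<lambda>(l, r). Br l r) ` ({t. brlen t < n} \<times> {t. brlen t < n})"
    if "brlen t < Suc n" for t :: "'g brword"
  proof (cases t)
    case (Br l r)
    then have "brlen l < n" "brlen r < n"
      using that Br brlen_pos[of l] brlen_pos[of r] by simp_all
    then show ?thesis using Br by auto
  qed simp
  then have "{t :: 'g brword. brlen t < Suc n} \<subseteq>
      range Gen \<union> (\<lambda>(l, r). Br l r) ` ({t. brlen t < n} \<times> {t. brlen t < n})"
    by blast
  then show ?case
    by (rule finite_subset) (use Suc in simp)
qed simp

lemma finsupp_linear [intro, simp]: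
  "0 \<in> finsupp" "f \<in> finsupp \<Longrightarrow> g \<in> finsupp \<Longrightarrow> f + g \<in> finsupp"
  "f \<in> finsupp \<Longrightarrow> g \<in> finsupp \<Longrightarrow> f - g \<in> finsupp"
  "f \<in> finsupp \<Longrightarrow> fscale c f \<in> finsupp" "f \<in> finsupp \<Longrightarrow> restr P f \<in> finsupp"
  "delta w \<in> finsupp"
proof -
  have sub: "h \<in> finsupp" if "f \<in> finsupp" "g \<in> finsupp" "\<And>t. h t \<noteq> 0 \<Longrightarrow> f t \<noteq> 0 \<or> g t \<noteq> 0"
    for f g h :: "'g brword \<Rightarrow> rat"
    using that unfolding finsupp_def
    by (auto intro: finite_subset[of "{t. h t \<noteq> 0}" "{t. f t \<noteq> 0} \<union> {t. g t \<noteq> 0}"])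
  show "0 \<in> finsupp" "delta w \<in> finsupp" by (simp_all add: finsupp_def delta_def pointwise)
  show "f \<in> finsupp \<Longrightarrow> g \<in> finsupp \<Longrightarrow> f + g \<in> finsupp"
    "f \<in> finsupp \<Longrightarrow> g \<in> finsupp \<Longrightarrow> f - g \<in> finsupp" by (erule (1) sub; auto simp: pointwise)+
  show "f \<in> finsupp \<Longrightarrow> fscale c f \<in> finsupp" "f \<in> finsupp \<Longrightarrow> restr P f \<in> finsupp"
    by (rule sub[of f f]; simp add: fscale_def restr_def split: if_splits)+
qed

lemma finsupp_fbr [intro, simp]:
  assumes "f \<in> finsupp" "g \<in> finsupp"
  shows "fbr f g \<in> finsupp"
proof -
  have "t \<in> (\<lambda>(l, r). Br l r) ` ({t. f t \<noteq> 0} \<times> {t. g t \<noteq> 0})" if "fbr f g t \<noteq> 0" for t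
    using that by (cases t) auto
  then have "{t. fbr f g t \<noteq> 0} \<subseteq> (\<lambda>(l, r). Br l r) ` ({t. f t \<noteq> 0} \<times> {t. g t \<noteq> 0})"
    by blast
  then show ?thesis
    using assms unfolding finsupp_def by (auto intro: finite_subset)
qed

lemma finsupp_trunc [intro, simp]: "trunc n f \<in> finsupp" for f :: "'g::finite brword \<Rightarrow> rat"
  unfolding finsupp_def
  by (auto simp: restr_def intro: finite_subset[OF _ finite_brlen_less[of n]])

lemma finsupp_induct [consumes 1, case_names zero word add]:
  assumes f: "f \<in> finsupp" and z: "P 0"
    and w: "\<And>c w. f w \<noteq> 0 \<Longrightarrow> P (fscale c (delta w))"
    and add: "\<And>g h. g \<in> finsupp \<Longrightarrow> h \<in> finsupp \<Longrightarrow> P g \<Longrightarrow> P h \<Longrightarrow> P (g + h)"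
  shows "P f"
proof -
  have "P (restr (\<lambda>t. t \<in> A) f)" if "finite A" "A \<subseteq> {t. f t \<noteq> 0}" for A
    using that
  proof (induction A)
    case empty
    have "restr (\<lambda>t. t \<in> {}) f = 0" by (rule ext) (simp add: restr_def pointwise)
    then show ?case using z by simp
  next
    case (insert x A)
    have "restr (\<lambda>t. t \<in> insert x A) f = fscale (f x) (delta x) + restr (\<lambda>t. t \<in> A) f"
      using insert.hyps(2) by (intro ext) (auto simp: restr_def fscale_def delta_def pointwise)
    then show ?case
      using insert f by (auto intro!: add w)
  qed
  from this[of "{t. f t \<noteq> 0}"] have "P (restr (\<lambda>t. t \<in> {t. f t \<noteq> 0}) f)"
    using f by (simp add: finsupp_def)
  moreover have "restr (\<lambda>t. t \<in> {t. f t \<noteq> 0}) f = f" by (rule ext) (simp add: restr_def)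
  ultimately show ?thesis by simp
qed

section \<open>The ideal of Lie relations\<close>

abbreviation homog :: "('g \<Rightarrow> int) \<Rightarrow> int \<Rightarrow> ('g brword \<Rightarrow> rat) set"
  where "homog deg p \<equiv> {f \<in> finsupp. \<forall>t. f t \<noteq> 0 \<longrightarrow> brdeg deg t = p}"

lemma free_nonassoc_simps [simp]:
  "hcomp (free_nonassoc deg) p = homog deg p"
  "gzero (free_nonassoc deg) = 0"
  "gadd (free_nonassoc deg) f g = f + g"
  "gscale (free_nonassoc deg) c f = fscale c f"
  "gbr (free_nonassoc deg) f g = fbr f g"
  by (auto simp: free_nonassoc_def finsupp_def fscale_def fbr_def fun_eq_iff pointwise)

lemma delta_homog [simp]: "delta w \<in> homog deg (brdeg deg w)"
  using finsupp_linear(6) by (auto simp: delta_def)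

lemma gtotal_free_nonassoc [simp]: "gtotal (free_nonassoc deg) = finsupp"
proof
  show "gtotal (free_nonassoc deg) \<subseteq> finsupp"
  proof
    fix f assume "f \<in> gtotal (free_nonassoc deg)"
    then show "f \<in> finsupp"
      unfolding gtotal_def by induction auto
  qed
  show "finsupp \<subseteq> gtotal (free_nonassoc deg)"
  proof
    fix f assume "f \<in> (finsupp :: ('a brword \<Rightarrow> rat) set)"
    then show "f \<in> gtotal (free_nonassoc deg)"
    proof (induction rule: finsupp_induct)
      case zero
      then show ?case unfolding gtotal_def by (metis gspan.zero free_nonassoc_simps(2))
    next
      case (word c w)
      have "delta w \<in> gspan (free_nonassoc deg) (\<Union>p. hcomp (free_nonassoc deg) p)"
        by (rule gspan.base) (use delta_homog in auto)
      from gspan.scale[OF this, of c] show ?case unfolding gtotal_def by simp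
    next
      case (add g h)
      from gspan.add[OF add(3,4)[unfolded gtotal_def]] show ?case unfolding gtotal_def by simp
    qed
  qed
qed

lemma free_ideal_zero: "0 \<in> free_ideal deg"
  using gideal.zero[of "free_nonassoc deg"] by (simp add: free_ideal_def)

lemma free_ideal_add: "f \<in> free_ideal deg \<Longrightarrow> g \<in> free_ideal deg \<Longrightarrow> f + g \<in> free_ideal deg"
  using gideal.add[of f "free_nonassoc deg" _ g] by (simp add: free_ideal_def)

lemma free_ideal_scale: "f \<in> free_ideal deg \<Longrightarrow> fscale c f \<in> free_ideal deg"
  using gideal.scale[of f "free_nonassoc deg" _ c] by (simp add: free_ideal_def)

lemma free_ideal_left: "f \<in> finsupp \<Longrightarrow> g \<in> free_ideal deg \<Longrightarrow> fbr f g \<in> free_ideal deg"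
  using gideal.left[of f "free_nonassoc deg" g] by (simp add: free_ideal_def)

lemma free_ideal_right: "f \<in> free_ideal deg \<Longrightarrow> g \<in> finsupp \<Longrightarrow> fbr f g \<in> free_ideal deg"
  using gideal.right[of f "free_nonassoc deg" _ g] by (simp add: free_ideal_def)

definition antisym_rel ::
    "rat \<Rightarrow> ('g brword \<Rightarrow> rat) \<Rightarrow> ('g brword \<Rightarrow> rat) \<Rightarrow> 'g brword \<Rightarrow> rat"
  where "antisym_rel s x y = fbr x y + fscale s (fbr y x)"

definition jacobi_rel ::
    "rat \<Rightarrow> ('g brword \<Rightarrow> rat) \<Rightarrow> ('g brword \<Rightarrow> rat) \<Rightarrow> ('g brword \<Rightarrow> rat) \<Rightarrow> 'g brword \<Rightarrow> rat"
  where "jacobi_rel s x y z = fbr x (fbr y z) - (fbr (fbr x y) z + fscale s (fbr y (fbr x z)))"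

lemma lie_relations_intros:
  "x \<in> hcomp A p \<Longrightarrow> y \<in> hcomp A q \<Longrightarrow>
    gbr A x y \<boxplus>\<^bsub>A\<^esub> (parity_sign (p * q)) \<odot>\<^bsub>A\<^esub> gbr A y x \<in> lie_relations A"
  "x \<in> hcomp A p \<Longrightarrow> y \<in> hcomp A q \<Longrightarrow> z \<in> hcomp A r \<Longrightarrow>
    gbr A x (gbr A y z) \<boxminus>\<^bsub>A\<^esub>
      (gbr A (gbr A x y) z \<boxplus>\<^bsub>A\<^esub> (parity_sign (p * q)) \<odot>\<^bsub>A\<^esub> gbr A y (gbr A x z)) \<in> lie_relations A"
  unfolding lie_relations_def by blast+

lemma lie_relations_cases:
  assumes "t \<in> lie_relations A"
  obtains (antisym) p q x y where "x \<in> hcomp A p" "y \<in> hcomp A q"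
      "t = gbr A x y \<boxplus>\<^bsub>A\<^esub> (parity_sign (p * q)) \<odot>\<^bsub>A\<^esub> gbr A y x"
  | (jacobi) p q r x y z where "x \<in> hcomp A p" "y \<in> hcomp A q" "z \<in> hcomp A r"
      "t = gbr A x (gbr A y z) \<boxminus>\<^bsub>A\<^esub>
        (gbr A (gbr A x y) z \<boxplus>\<^bsub>A\<^esub> (parity_sign (p * q)) \<odot>\<^bsub>A\<^esub> gbr A y (gbr A x z))"
  using assms unfolding lie_relations_def
  by (elim UnE CollectE exE conjE) (rule that, assumption+)+

lemma gsub_free_nonassoc [simp]: "f \<boxminus>\<^bsub>free_nonassoc deg\<^esub> g = f - g"
  by (simp add: gsub_def fscale_linear)

lemma free_ideal_antisym:
  "x \<in> homog deg p \<Longrightarrow> y \<in> homog deg q \<Longrightarrow> antisym_rel (parity_sign (p * q)) x y \<in> free_ideal deg"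
  using gideal.base[OF lie_relations_intros(1)[of x "free_nonassoc deg" p y q]]
  unfolding free_ideal_def antisym_rel_def free_nonassoc_simps .

lemma free_ideal_jacobi:
  "x \<in> homog deg p \<Longrightarrow> y \<in> homog deg q \<Longrightarrow> z \<in> homog deg r \<Longrightarrow>
    jacobi_rel (parity_sign (p * q)) x y z \<in> free_ideal deg"
  using gideal.base[OF lie_relations_intros(2)[of x "free_nonassoc deg" p y q z r]]
  unfolding free_ideal_def jacobi_rel_def gsub_free_nonassoc free_nonassoc_simps .

lemma free_ideal_induct [consumes 1, case_names antisym jacobi zero add scale left right]:
  assumes f: "f \<in> free_ideal deg"
    and anti: "\<And>p q x y. x \<in> homog deg p \<Longrightarrow> y \<in> homog deg q \<Longrightarrow> P (antisym_rel (parity_sign (p * q)) x y)"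
    and jac: "\<And>p q r x y z. x \<in> homog deg p \<Longrightarrow> y \<in> homog deg q \<Longrightarrow> z \<in> homog deg r \<Longrightarrow>
      P (jacobi_rel (parity_sign (p * q)) x y z)"
    and zero: "P 0"
    and add: "\<And>f g. f \<in> free_ideal deg \<Longrightarrow> g \<in> free_ideal deg \<Longrightarrow> P f \<Longrightarrow> P g \<Longrightarrow> P (f + g)"
    and scale: "\<And>f c. f \<in> free_ideal deg \<Longrightarrow> P f \<Longrightarrow> P (fscale c f)"
    and left: "\<And>f g. f \<in> finsupp \<Longrightarrow> g \<in> free_ideal deg \<Longrightarrow> P g \<Longrightarrow> P (fbr f g)"
    and right: "\<And>f g. f \<in> free_ideal deg \<Longrightarrow> g \<in> finsupp \<Longrightarrow> P f \<Longrightarrow> P (fbr f g)"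
  shows "P f"
  using f unfolding free_ideal_def
proof (induction rule: gideal.induct)
  case (base x)
  then show ?case
  proof (cases rule: lie_relations_cases)
    case (antisym p q x y)
    from anti[OF antisym(1,2)[unfolded free_nonassoc_simps]] show ?thesis
      unfolding antisym(3) antisym_rel_def free_nonassoc_simps .
  next
    case (jacobi p q r x y z)
    from jac[OF jacobi(1-3)[unfolded free_nonassoc_simps]] show ?thesis
      unfolding jacobi(4) jacobi_rel_def gsub_free_nonassoc free_nonassoc_simps .
  qed
next
  case (add x y) then show ?case using assms(5)[unfolded free_ideal_def] by simp
next
  case (scale x c) then show ?case using assms(6)[unfolded free_ideal_def] by simp
next
  case (left x y) then show ?case using assms(7)[unfolded free_ideal_def] by simp
next
  case (right x y) then show ?case using assms(8)[unfolded free_ideal_def] by simp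
qed (use zero in simp)

lemma free_ideal_finsupp: "f \<in> free_ideal deg \<Longrightarrow> f \<in> finsupp"
  by (induction rule: free_ideal_induct) (auto simp: antisym_rel_def jacobi_rel_def)

lemma free_ideal_diff: "f \<in> free_ideal deg \<Longrightarrow> g \<in> free_ideal deg \<Longrightarrow> f - g \<in> free_ideal deg"
  using free_ideal_add[of f deg "fscale (-1) g"] free_ideal_scale[of g deg "-1"]
  by (simp add: fscale_linear)

lemma homog_induct [consumes 1, case_names zero word add]:
  assumes f: "f \<in> homog deg p" and z: "P 0"
    and w: "\<And>c w. brdeg deg w = p \<Longrightarrow> P (fscale c (delta w))"
    and add: "\<And>g h. P g \<Longrightarrow> P h \<Longrightarrow> P (g + h)"
  shows "P f"
proof -
  from f have "f \<in> finsupp" by simp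
  then show ?thesis
    by (induction rule: finsupp_induct) (use assms in auto)
qed

text \<open>
  Each relation is multilinear, and its instances at single words are homogeneous for any additive
  weight; so the ideal contains the homogeneous parts of its elements. Both the degree and the word
  length are such weights: the first makes the quotient graded, the second is what allows one to pass
  to infinite sums.
\<close>

lemma free_ideal_restr_weight:
  fixes wt :: "'g brword \<Rightarrow> int"
  assumes wt: "\<And>l r. wt (Br l r) = wt l + wt r" and f: "f \<in> free_ideal deg"
  shows "restr (\<lambda>t. wt t = m) f \<in> free_ideal deg"
  using f
proof (induction arbitrary: m rule: free_ideal_induct)
  case (antisym p q x y)
  define R where "R = (\<lambda>x y :: 'g brword \<Rightarrow> rat. restr (\<lambda>t. wt t = m) (antisym_rel (parity_sign (p * q)) x y))"
  have R_linear: "R (a + b) y = R a y + R b y" "R x (a + b) = R x a + R x b" "R 0 y = 0" "R x 0 = 0"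
    "R (fscale c x) y = fscale c (R x y)" "R x (fscale c y) = fscale c (R x y)" for a b x y c
    by (simp_all add: R_def antisym_rel_def fbr_linear fscale_linear restr_linear mult.commute)
  have R_words: "R (delta v) (delta w) \<in> free_ideal deg" if "brdeg deg v = p" "brdeg deg w = q" for v w
  proof -
    have "R (delta v) (delta w) =
      (if wt v + wt w = m then antisym_rel (parity_sign (p * q)) (delta v) (delta w) else 0)"
      by (simp add: R_def antisym_rel_def restr_linear restr_delta wt add.commute fscale_linear)
    then show ?thesis
      using free_ideal_antisym[OF delta_homog delta_homog, of deg v w] that by (simp add: free_ideal_zero)
  qed
  note clo = R_linear free_ideal_add free_ideal_zero free_ideal_scale
  have 1: "R (delta v) y \<in> free_ideal deg" if "brdeg deg v = p" for v
    using antisym(2) by (induction rule: homog_induct) (use that in \<open>simp_all add: clo R_words\<close>)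
  have "R x y \<in> free_ideal deg"
    using antisym(1) by (induction rule: homog_induct) (simp_all add: clo 1)
  then show ?case by (simp add: R_def)
next
  case (jacobi p q r x y z)
  define R where "R = (\<lambda>x y z :: 'g brword \<Rightarrow> rat. restr (\<lambda>t. wt t = m) (jacobi_rel (parity_sign (p * q)) x y z))"
  have R_add: "R (a + b) y z = R a y z + R b y z" "R x (a + b) z = R x a z + R x b z"
    "R x y (a + b) = R x y a + R x y b" for a b x y z
    by (simp_all add: R_def jacobi_rel_def fbr_linear fscale_linear restr_linear)
  have R_0: "R 0 y z = 0" "R x 0 z = 0" "R x y 0 = 0" for x y z
    by (simp_all add: R_def jacobi_rel_def fbr_linear fscale_linear restr_linear)
  have R_scale: "R (fscale c x) y z = fscale c (R x y z)" "R x (fscale c y) z = fscale c (R x y z)"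
    "R x y (fscale c z) = fscale c (R x y z)" for c x y z
    by (simp_all add: R_def jacobi_rel_def fbr_linear fscale_linear restr_linear mult.commute)
  have R_words: "R (delta u) (delta v) (delta w) \<in> free_ideal deg"
    if "brdeg deg u = p" "brdeg deg v = q" "brdeg deg w = r" for u v w
  proof -
    have "R (delta u) (delta v) (delta w) =
      (if wt u + wt v + wt w = m then jacobi_rel (parity_sign (p * q)) (delta u) (delta v) (delta w) else 0)"
      by (simp add: R_def jacobi_rel_def restr_linear restr_delta wt add.commute add.left_commute fscale_linear)
    moreover have "jacobi_rel (parity_sign (p * q)) (delta u) (delta v) (delta w) \<in> free_ideal deg"
      using that by (intro free_ideal_jacobi[where r = r]) (auto simp: delta_def finsupp_def)
    ultimately show ?thesis by (simp add: free_ideal_zero)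
  qed
  note clo = R_add R_0 R_scale free_ideal_add free_ideal_zero free_ideal_scale
  have 1: "R (delta u) (delta v) z \<in> free_ideal deg" if "brdeg deg u = p" "brdeg deg v = q" for u v
    using jacobi(3) by (induction rule: homog_induct) (use that in \<open>simp_all add: clo R_words\<close>)
  have 2: "R (delta u) y z \<in> free_ideal deg" if "brdeg deg u = p" for u
    using jacobi(2) by (induction rule: homog_induct) (use that in \<open>simp_all add: clo 1\<close>)
  have "R x y z \<in> free_ideal deg"
    using jacobi(1) by (induction rule: homog_induct) (simp_all add: clo 2)
  then show ?case by (simp add: R_def)
next
  case zero then show ?case by (simp add: restr_linear free_ideal_zero)
next
  case (add f g) then show ?case by (simp add: restr_linear free_ideal_add)
next
  case (scale f c) then show ?case by (simp add: restr_linear free_ideal_scale)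
next
  case (left f g)
  show ?case
    using left(1)
  proof (induction rule: finsupp_induct)
    case zero then show ?case by (simp add: fbr_linear restr_linear free_ideal_zero)
  next
    case (add g h) then show ?case by (simp add: fbr_linear restr_linear free_ideal_add)
  next
    case (word c w)
    have "restr (\<lambda>t. wt t = m) (fbr (delta w) g) = fbr (delta w) (restr (\<lambda>t. wt t = m - wt w) g)"
      by (rule fun_brword_eqI) (auto simp: restr_def delta_def wt)
    then show ?case
      using left(3) by (simp add: fbr_linear restr_linear free_ideal_scale free_ideal_left)
  qed
next
  case (right f g)
  show ?case
    using right(2)
  proof (induction rule: finsupp_induct)
    case zero then show ?case by (simp add: fbr_linear restr_linear free_ideal_zero)
  next
    case (add g h) then show ?case by (simp add: fbr_linear restr_linear free_ideal_add)
  next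
    case (word c w)
    have "restr (\<lambda>t. wt t = m) (fbr f (delta w)) = fbr (restr (\<lambda>t. wt t = m - wt w) f) (delta w)"
      by (rule fun_brword_eqI) (auto simp: restr_def delta_def wt)
    then show ?case
      using right(3) by (simp add: fbr_linear restr_linear free_ideal_scale free_ideal_right)
  qed
qed

lemma free_ideal_trunc: "f \<in> free_ideal deg \<Longrightarrow> trunc n f \<in> free_ideal deg"
proof (induction n)
  case (Suc n)
  have "trunc (Suc n) f = trunc n f + restr (\<lambda>t. int (brlen t) = int n) f"
    by (rule ext) (auto simp: restr_def pointwise)
  moreover have "restr (\<lambda>t. int (brlen t) = int n) f \<in> free_ideal deg"
    by (rule free_ideal_restr_weight) (use Suc in auto)
  ultimately show ?case using Suc by (simp add: free_ideal_add)
qed (simp add: free_ideal_zero)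

section \<open>Quotients presented by functions on words\<close>

definition word_ideal :: "('g brword \<Rightarrow> rat) set \<Rightarrow> bool" where
  "word_ideal I \<longleftrightarrow> I \<subseteq> finsupp \<and> 0 \<in> I \<and> (\<forall>f\<in>I. \<forall>g\<in>I. f + g \<in> I) \<and> (\<forall>c. \<forall>f\<in>I. fscale c f \<in> I) \<and>
     (\<forall>f\<in>finsupp. \<forall>g\<in>I. fbr f g \<in> I) \<and> (\<forall>f\<in>I. \<forall>g\<in>finsupp. fbr f g \<in> I)"

lemma word_ideal_free_ideal: "word_ideal (free_ideal deg)"
  by (auto simp: word_ideal_def free_ideal_finsupp free_ideal_zero free_ideal_add free_ideal_scale
      free_ideal_left free_ideal_right)

lemma word_idealD:
  assumes "word_ideal I"
  shows "f \<in> I \<Longrightarrow> f \<in> finsupp" "0 \<in> I" "f \<in> I \<Longrightarrow> g \<in> I \<Longrightarrow> f + g \<in> I" "f \<in> I \<Longrightarrow> fscale c f \<in> I"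
    "f \<in> finsupp \<Longrightarrow> g \<in> I \<Longrightarrow> fbr f g \<in> I" "f \<in> I \<Longrightarrow> g \<in> finsupp \<Longrightarrow> fbr f g \<in> I"
  using assms unfolding word_ideal_def by auto

text \<open>
  A record is presented if it is the image of the finitely supported functions on words under a map
  \<open>q\<close> with kernel \<open>I\<close> that carries all operations. The free non-associative algebra, the free Lie
  algebra and its nilpotent quotients are all of this form, so that calculations with cosets of cosets
  become calculations with functions.
\<close>

definition presents ::
    "('g \<Rightarrow> int) \<Rightarrow> ('a, 'm) galg_scheme \<Rightarrow> (('g brword \<Rightarrow> rat) \<Rightarrow> 'a) \<Rightarrow> ('g brword \<Rightarrow> rat) set \<Rightarrow> bool"
  where "presents deg L q I \<longleftrightarrow> word_ideal I \<and>
    (\<forall>f\<in>finsupp. \<forall>g\<in>finsupp. (q f = q g \<longleftrightarrow> f - g \<in> I) \<and>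
       gadd L (q f) (q g) = q (f + g) \<and> gbr L (q f) (q g) = q (fbr f g)) \<and>
    (\<forall>c. \<forall>f\<in>finsupp. gscale L c (q f) = q (fscale c f)) \<and>
    gzero L = q 0 \<and> (\<forall>p. hcomp L p = q ` homog deg p)"

lemma presentsD:
  fixes q :: "('g brword \<Rightarrow> rat) \<Rightarrow> 'a" and f g :: "'g brword \<Rightarrow> rat"
  assumes "presents deg L q I"
  shows "word_ideal I" "f \<in> finsupp \<Longrightarrow> g \<in> finsupp \<Longrightarrow> q f = q g \<longleftrightarrow> f - g \<in> I"
    "f \<in> finsupp \<Longrightarrow> g \<in> finsupp \<Longrightarrow> gadd L (q f) (q g) = q (f + g)"
    "f \<in> finsupp \<Longrightarrow> g \<in> finsupp \<Longrightarrow> gbr L (q f) (q g) = q (fbr f g)"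
    "f \<in> finsupp \<Longrightarrow> gscale L c (q f) = q (fscale c f)"
    "gzero L = q 0" "hcomp L p = q ` homog deg p"
proof -
  note a = assms[unfolded presents_def]
  note b = a[THEN conjunct2, THEN conjunct1, THEN bspec, THEN bspec]
  note c = a[THEN conjunct2, THEN conjunct2]
  show "word_ideal I" by (rule a[THEN conjunct1])
  show "f \<in> finsupp \<Longrightarrow> g \<in> finsupp \<Longrightarrow> q f = q g \<longleftrightarrow> f - g \<in> I"
    by (rule b[THEN conjunct1])
  show "f \<in> finsupp \<Longrightarrow> g \<in> finsupp \<Longrightarrow> gadd L (q f) (q g) = q (f + g)"
    by (rule b[THEN conjunct2, THEN conjunct1])
  show "f \<in> finsupp \<Longrightarrow> g \<in> finsupp \<Longrightarrow> gbr L (q f) (q g) = q (fbr f g)"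
    by (rule b[THEN conjunct2, THEN conjunct2])
  show "f \<in> finsupp \<Longrightarrow> gscale L c (q f) = q (fscale c f)"
    by (rule c[THEN conjunct1, THEN spec, THEN bspec])
  show "gzero L = q 0" by (rule c[THEN conjunct2, THEN conjunct1])
  show "hcomp L p = q ` homog deg p" by (rule c[THEN conjunct2, THEN conjunct2, THEN spec])
qed

lemma presents_free_nonassoc: "presents deg (free_nonassoc deg) (\<lambda>f. f) {0}"
  by (auto simp: presents_def word_ideal_def fscale_linear fbr_linear)

lemma presents_gtotal:
  assumes L: "presents deg L q I"
  shows "gtotal L = q ` finsupp"
proof
  note p = presentsD[OF L]
  show "gtotal L \<subseteq> q ` finsupp"
  proof
    fix x assume "x \<in> gtotal L"
    then show "x \<in> q ` finsupp"
      unfolding gtotal_def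
    proof induction
      case zero
      then show ?case unfolding p(6) by (intro imageI finsupp_linear)
    next
      case (base x)
      then show ?case unfolding p(7) by blast
    next
      case (add x y)
      then obtain f g where fg: "x = q f" "y = q g" "f \<in> finsupp" "g \<in> finsupp" by blast
      show ?case unfolding fg(1,2) p(3)[OF fg(3,4)] by (intro imageI finsupp_linear fg)
    next
      case (scale x c)
      then obtain f where f: "x = q f" "f \<in> finsupp" by blast
      show ?case unfolding f(1) p(5)[OF f(2)] by (intro imageI finsupp_linear f)
    qed
  qed
  have "q f \<in> gtotal L" if "f \<in> finsupp" for f
    using that
  proof (induction rule: finsupp_induct)
    case zero
    then show ?case unfolding gtotal_def using gspan.zero[of L] p(6) by simp
  next
    case (word c w)
    have "q (delta w) \<in> hcomp L (brdeg deg w)"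
      using delta_homog p(7) by blast
    then have "c \<odot>\<^bsub>L\<^esub> q (delta w) \<in> gtotal L"
      unfolding gtotal_def by (auto intro: gspan.scale gspan.base)
    then show ?case using p(5) by simp
  next
    case (add g h)
    then show ?case unfolding gtotal_def using p(3) gspan.add by metis
  qed
  then show "q ` finsupp \<subseteq> gtotal L" by auto
qed

lemma presents_coset:
  assumes L: "presents deg L q I" and K: "K \<subseteq> finsupp" and f: "f \<in> finsupp"
  shows "coset L (q ` K) (q f) = {q (f + k) | k. k \<in> K}"
proof -
  have "q f \<boxplus>\<^bsub>L\<^esub> q k = q (f + k)" if "k \<in> K" for k
    using presentsD(3)[OF L f] K that by blast
  then show ?thesis
    by (simp add: coset_def Setcompr_eq_image image_image cong: image_cong)
qed

lemma presents_coset_eq_iff: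
  assumes L: "presents deg L q I" and K: "word_ideal K" "I \<subseteq> K" and f: "f \<in> finsupp" "g \<in> finsupp"
  shows "coset L (q ` K) (q f) = coset L (q ` K) (q g) \<longleftrightarrow> f - g \<in> K"
proof -
  note k = word_idealD[OF K(1)] and p = presentsD[OF L]
  have *: "coset L (q ` K) (q h) = {q (h + k) | k. k \<in> K}" if "h \<in> finsupp" for h
    by (rule presents_coset[OF L _ that]) (use k in auto)
  show ?thesis
  proof
    assume "coset L (q ` K) (q f) = coset L (q ` K) (q g)"
    moreover have "q f \<in> coset L (q ` K) (q f)"
      using *[OF f(1)] k(2) by force
    ultimately obtain k where k': "k \<in> K" "q f = q (g + k)"
      using *[OF f(2)] by auto
    then have "f - (g + k) \<in> I" using p(2) f k(1) by simp
    then have "(f - (g + k)) + k \<in> K" using K(2) k' k(3) by blast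
    then show "f - g \<in> K" by simp
  next
    assume d: "f - g \<in> K"
    then have d': "g - f \<in> K" using k(4)[OF d, of "-1"] by (simp add: fscale_linear)
    have "\<exists>k'\<in>K. f + k = g + k'" if "k \<in> K" for k
      by (rule bexI[of _ "(f - g) + k"]) (use that d k in auto)
    moreover have "\<exists>k'\<in>K. g + k = f + k'" if "k \<in> K" for k
      by (rule bexI[of _ "(g - f) + k"]) (use that d' k in auto)
    ultimately show "coset L (q ` K) (q f) = coset L (q ` K) (q g)"
      unfolding *[OF f(1)] *[OF f(2)] by (smt (verit) Collect_cong)
  qed
qed

text \<open>
  This is applied twice: from the free non-associative algebra to the free Lie algebra, and from there
  to the quotients by the lower central series. The operations of a quotient are unions over
  representatives; since \<open>K\<close> is an ideal, all members of such a union coincide.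
\<close>

lemma presents_quotient:
  assumes L: "presents deg L q I" and K: "word_ideal K" "I \<subseteq> K"
  shows "presents deg (quotient_galg L (q ` K)) (\<lambda>f. coset L (q ` K) (q f)) K"
proof -
  note k = word_idealD[OF K(1)] and p = presentsD[OF L]
  define Q where "Q f = coset L (q ` K) (q f)" for f
  have Q: "Q h = {q (h + k) | k. k \<in> K}" if "h \<in> finsupp" for h
    unfolding Q_def by (rule presents_coset[OF L _ that]) (use k in auto)
  have Q_eq: "Q f = Q g \<longleftrightarrow> f - g \<in> K" if "f \<in> finsupp" "g \<in> finsupp" for f g
    unfolding Q_def by (rule presents_coset_eq_iff[OF L K that])
  have Q_add: "Q (f + k) = Q f" if "f \<in> finsupp" "k \<in> K" for f k
    using Q_eq[of "f + k" f] that k(1) by simp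
  have Q_ne: "Q f \<noteq> {}" if "f \<in> finsupp" for f
    using Q[OF that] k(2) by force
  have add: "gadd (quotient_galg L (q ` K)) (Q f) (Q g) = Q (f + g)" if fg: "f \<in> finsupp" "g \<in> finsupp" for f g
  proof -
    have "coset L (q ` K) (x \<boxplus>\<^bsub>L\<^esub> y) = Q (f + g)" if xy: "x \<in> Q f" "y \<in> Q g" for x y
    proof -
      obtain k l where kl: "k \<in> K" "l \<in> K" and [simp]: "x = q (f + k)" "y = q (g + l)"
        using xy Q fg by auto
      have "x \<boxplus>\<^bsub>L\<^esub> y = q ((f + g) + (k + l))" using p(3) kl k(1) fg by (simp add: algebra_simps)
      then show ?thesis using Q_add[of "f + g" "k + l"] kl k(3) fg by (simp add: Q_def)
    qed
    then show ?thesis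
      using Q_ne[OF fg(1)] Q_ne[OF fg(2)] by (simp add: quotient_galg_def cong: SUP_cong)
  qed
  have br: "gbr (quotient_galg L (q ` K)) (Q f) (Q g) = Q (fbr f g)" if fg: "f \<in> finsupp" "g \<in> finsupp" for f g
  proof -
    have "coset L (q ` K) (gbr L x y) = Q (fbr f g)" if xy: "x \<in> Q f" "y \<in> Q g" for x y
    proof -
      obtain k l where kl: "k \<in> K" "l \<in> K" and [simp]: "x = q (f + k)" "y = q (g + l)"
        using xy Q fg by auto
      have "gbr L x y = q (fbr f g + (fbr f l + fbr k (g + l)))"
        using p(4) kl k(1) fg by (simp add: algebra_simps fbr_linear)
      moreover have "fbr f l + fbr k (g + l) \<in> K" using kl k fg by auto
      ultimately show ?thesis using Q_add[of "fbr f g"] fg by (simp add: Q_def)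
    qed
    then show ?thesis
      using Q_ne[OF fg(1)] Q_ne[OF fg(2)] by (simp add: quotient_galg_def cong: SUP_cong)
  qed
  have scale: "gscale (quotient_galg L (q ` K)) c (Q f) = Q (fscale c f)" if f: "f \<in> finsupp" for c f
  proof -
    have "coset L (q ` K) (c \<odot>\<^bsub>L\<^esub> x) = Q (fscale c f)" if x: "x \<in> Q f" for x
    proof -
      obtain k where k': "k \<in> K" and [simp]: "x = q (f + k)"
        using x Q f by auto
      have "c \<odot>\<^bsub>L\<^esub> x = q (fscale c f + fscale c k)" using p(5) k' k(1) f by (simp add: fscale_linear)
      then show ?thesis using Q_add[of "fscale c f" "fscale c k"] k' k(4) f by (simp add: Q_def)
    qed
    then show ?thesis
      using Q_ne[OF f] by (simp add: quotient_galg_def cong: SUP_cong)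
  qed
  have "gzero (quotient_galg L (q ` K)) = Q 0" "hcomp (quotient_galg L (q ` K)) r = Q ` homog deg r" for r
    using p(6,7) by (auto simp: quotient_galg_def Q_def image_image)
  then show ?thesis
    unfolding presents_def Q_def[symmetric] using K(1) Q_eq add br scale by simp
qed

section \<open>The lower central series of the free graded Lie algebra\<close>

definition free_proj :: "('g \<Rightarrow> int) \<Rightarrow> ('g brword \<Rightarrow> rat) \<Rightarrow> ('g brword \<Rightarrow> rat) set"
  where "free_proj deg f = coset (free_nonassoc deg) (free_ideal deg) f"

definition lc_ideal :: "('g \<Rightarrow> int) \<Rightarrow> nat \<Rightarrow> ('g brword \<Rightarrow> rat) set"
  where "lc_ideal deg n = {f \<in> finsupp. trunc n f \<in> free_ideal deg}"

lemma presents_free_lie: "presents deg (free_lie deg) (free_proj deg) (free_ideal deg)"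
  using presents_quotient[OF presents_free_nonassoc word_ideal_free_ideal, of deg deg]
    free_ideal_zero[of deg]
  by (simp add: free_lie_def free_proj_def[abs_def])

lemma word_ideal_lc: "word_ideal (lc_ideal deg n)"
proof -
  have "trunc n (fbr f g) \<in> free_ideal deg" if "f \<in> finsupp" "trunc n g \<in> free_ideal deg" for f g
    using free_ideal_trunc[OF free_ideal_left[OF that], of n] by (simp add: trunc_fbr_right')
  moreover have "trunc n (fbr f g) \<in> free_ideal deg" if "g \<in> finsupp" "trunc n f \<in> free_ideal deg" for f g
    using free_ideal_trunc[OF free_ideal_right[OF that(2,1)], of n] by (simp add: trunc_fbr_left)
  ultimately show ?thesis
    by (auto simp: word_ideal_def lc_ideal_def restr_linear free_ideal_zero free_ideal_add free_ideal_scale)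
qed

lemma free_ideal_subset_lc: "free_ideal deg \<subseteq> lc_ideal deg n"
  by (auto simp: lc_ideal_def free_ideal_finsupp free_ideal_trunc)

lemma lc_ideal_mono: "m \<le> n \<Longrightarrow> lc_ideal deg n \<subseteq> lc_ideal deg m"
  unfolding lc_ideal_def
proof clarify
  fix f assume "m \<le> n" "trunc n f \<in> free_ideal deg"
  then show "trunc m f \<in> free_ideal deg"
    using free_ideal_trunc[of "trunc n f" deg m] by (simp add: trunc_trunc)
qed

lemma free_ideal_jacobi_words:
  fixes z :: "'g brword \<Rightarrow> rat"
  assumes "z \<in> finsupp"
  shows "jacobi_rel (parity_sign (brdeg deg l * brdeg deg r)) (delta l) (delta r) z \<in> free_ideal deg"
  using assms
proof (induction rule: finsupp_induct)
  case zero
  then show ?case by (simp add: jacobi_rel_def fbr_linear fscale_linear free_ideal_zero)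
next
  case (add g h)
  have "jacobi_rel s x y (g + h) = jacobi_rel s x y g + jacobi_rel s x y h" for s and x y :: "'g brword \<Rightarrow> rat"
    by (simp add: jacobi_rel_def fbr_linear fscale_linear)
  then show ?case using add free_ideal_add by metis
next
  case (word c w)
  have "jacobi_rel s x y (fscale c z) = fscale c (jacobi_rel s x y z)" for s and x y z :: "'g brword \<Rightarrow> rat"
    by (simp add: jacobi_rel_def fbr_linear fscale_linear mult.commute)
  moreover have "jacobi_rel (parity_sign (brdeg deg l * brdeg deg r)) (delta l) (delta r) (delta w) \<in> free_ideal deg"
    by (rule free_ideal_jacobi) (rule delta_homog)+
  ultimately show ?case by (simp add: free_ideal_scale)
qed

text \<open>
  Bracketing with any element raises the word length, which gives one inclusion. For the other one, a
  word \<open>[l, r]\<close> of length \<open>n\<close> is rewritten with brackets whose left factor is a letter: by the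
  Jacobi identity, bracketing with \<open>[l, r]\<close> reduces to bracketing with \<open>r\<close> and \<open>l\<close> in turn, and one
  concludes by induction on the left factor (\<open>word_br\<close>).
\<close>

lemma lower_central_free_lie: "lower_central (free_lie deg) n = free_proj deg ` lc_ideal deg n"
proof -
  note L = presents_free_lie[of deg]
  note p = presentsD[OF L]
  note tot = presents_gtotal[OF L]
  let ?LC = "lower_central (free_lie deg)" and ?q = "free_proj deg" and ?L = "free_lie deg"
  have gt: "f \<in> finsupp \<Longrightarrow> ?q f \<in> gtotal ?L" for f using tot by simp
  have all: "lc_ideal deg 0 = finsupp" "lc_ideal deg (Suc 0) = finsupp"
    by (auto simp: lc_ideal_def free_ideal_zero)
  have add: "?q (f + g) \<in> ?LC n" if "f \<in> finsupp" "g \<in> finsupp" "?q f \<in> ?LC n" "?q g \<in> ?LC n" for f g n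
  proof (cases n rule: lower_central.cases[of "(?L, n)" for n])
    case (3 L n')
    then show ?thesis using that p(3)[of f g] by (auto simp flip: p(3) intro: gspan.add)
  qed (use that gt in auto)
  have scale: "?q (fscale c f) \<in> ?LC n" if "f \<in> finsupp" "?q f \<in> ?LC n" for f c n
  proof (cases n rule: lower_central.cases[of "(?L, n)" for n])
    case (3 L n')
    then show ?thesis using that p(5)[of f c] by (auto simp flip: p(5) intro: gspan.scale)
  qed (use that gt in auto)
  have zero: "?q 0 \<in> ?LC n" for n
  proof (cases n rule: lower_central.cases[of "(?L, n)" for n])
    case (3 L n')
    then show ?thesis using p(6) by (auto simp flip: p(6) intro: gspan.zero)
  qed (use gt in auto)
  have step: "?q (fbr f g) \<in> ?LC (Suc n)" if "f \<in> finsupp" "g \<in> finsupp" "?q g \<in> ?LC n" "0 < n" for f g n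
  proof -
    obtain m where "n = Suc m" using \<open>0 < n\<close> gr0_implies_Suc by blast
    then show ?thesis using that p(4)[of f g] gt[of f]
      by (auto simp flip: p(4) intro!: gspan.base)
  qed
  have word_br: "?q (fbr (delta w) z) \<in> ?LC (brlen w + n)"
    if "z \<in> finsupp" "?q z \<in> ?LC n" "0 < n" for w z n
    using that
  proof (induction w arbitrary: z n)
    case (Gen v)
    then show ?case using step[of "delta (Gen v)" z n] by simp
  next
    case (Br l r)
    let ?s = "parity_sign (brdeg deg l * brdeg deg r)"
    have "?q (fbr (delta l) (fbr (delta r) z)) \<in> ?LC (brlen l + (brlen r + n))"
      using Br by (intro Br.IH(1)) auto
    moreover have "?q (fbr (delta r) (fbr (delta l) z)) \<in> ?LC (brlen r + (brlen l + n))"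
      using Br by (intro Br.IH(2)) auto
    ultimately have *: "?q (fbr (delta l) (fbr (delta r) z) + fscale (- ?s) (fbr (delta r) (fbr (delta l) z)))
        \<in> ?LC (brlen l + brlen r + n)"
      using Br.prems(1) by (intro add scale) (auto simp: ac_simps)
    have "?q (fbr (delta l) (fbr (delta r) z) + fscale (- ?s) (fbr (delta r) (fbr (delta l) z))) =
        ?q (fbr (delta (Br l r)) z)"
    proof (subst p(2))
      show "fbr (delta l) (fbr (delta r) z) + fscale (- ?s) (fbr (delta r) (fbr (delta l) z)) -
          fbr (delta (Br l r)) z \<in> free_ideal deg"
        using free_ideal_jacobi_words[OF Br.prems(1), of deg l r]
        by (simp add: jacobi_rel_def fscale_linear algebra_simps)
    qed (use Br.prems(1) in auto)
    with * show ?case by simp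
  qed
  have word: "?q (delta w) \<in> ?LC (brlen w)" for w
  proof (induction w)
    case (Gen v) then show ?case using gt by simp
  next
    case (Br l r) then show ?case using word_br[of "delta r" "brlen r" l] by (simp add: brlen_pos)
  qed
  have dec1: "?LC (Suc n) \<subseteq> ?LC n" for n
  proof (induction n)
    case (Suc n)
    show ?case
    proof (cases n)
      case 0
      have "x \<in> gtotal ?L" if "x \<in> ?LC (Suc (Suc 0))" for x
        using that unfolding lower_central.simps
      proof induction
        case zero then show ?case using p(6) gt by auto
      next
        case (base x)
        then obtain f g where fg: "x = gbr ?L (?q f) (?q g)" "f \<in> finsupp" "g \<in> finsupp"
          using tot by auto
        show ?case unfolding fg(1) p(4)[OF fg(2,3)] by (intro gt finsupp_fbr fg)
      next
        case (add x y)
        then obtain f g where fg: "x = ?q f" "y = ?q g" "f \<in> finsupp" "g \<in> finsupp"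
          using tot by auto
        show ?case unfolding fg(1,2) p(3)[OF fg(3,4)] by (intro gt finsupp_linear fg)
      next
        case (scale x c)
        then obtain f where f: "x = ?q f" "f \<in> finsupp" using tot by auto
        show ?case unfolding f(1) p(5)[OF f(2)] by (intro gt finsupp_linear f)
      qed
      then show ?thesis unfolding 0 lower_central.simps(2) by (rule subsetI)
    next
      case (Suc m)
      have mono: "gspan ?L A \<subseteq> gspan ?L B" if "A \<subseteq> B" for A B
      proof
        fix x assume "x \<in> gspan ?L A"
        then show "x \<in> gspan ?L B" by induction (use that in \<open>auto intro: gspan.intros\<close>)
      qed
      have IH: "?LC (Suc (Suc m)) \<subseteq> ?LC (Suc m)" using Suc.IH \<open>n = Suc m\<close> by simp
      have "?LC (Suc (Suc (Suc m))) = gspan ?L {gbr ?L x y | x y. x \<in> gtotal ?L \<and> y \<in> ?LC (Suc (Suc m))}"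
        by (rule lower_central.simps(3))
      also have "\<dots> \<subseteq> gspan ?L {gbr ?L x y | x y. x \<in> gtotal ?L \<and> y \<in> ?LC (Suc m)}"
        by (intro mono Collect_mono impI, elim exE conjE, intro exI conjI, assumption, assumption,
            erule subsetD[OF IH])
      also have "\<dots> = ?LC (Suc (Suc m))"
        by (rule lower_central.simps(3)[symmetric])
      finally show ?thesis using \<open>n = Suc m\<close> by simp
    qed
  qed simp
  have dec: "?LC n \<subseteq> ?LC m" if "m \<le> n" for m n
    using that by (induction rule: dec_induct) (use dec1 in auto)
  show ?thesis
  proof
    show "?q ` lc_ideal deg n \<subseteq> ?LC n"
    proof clarify
      fix f assume f: "f \<in> lc_ideal deg n"
      define g where "g = restr (\<lambda>t. \<not> brlen t < n) f"
      have ff: "f \<in> finsupp" using f by (simp add: lc_ideal_def)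
      have "f - g = trunc n f" by (rule ext) (simp add: g_def restr_def pointwise)
      then have "?q f = ?q g" using f p(2)[of f g] ff by (simp add: g_def lc_ideal_def)
      moreover have "g \<in> finsupp" using ff by (simp add: g_def)
      then have "?q g \<in> ?LC n"
      proof (induction rule: finsupp_induct)
        case (word c w)
        then have "n \<le> brlen w" by (simp add: g_def restr_def split: if_splits)
        then show ?case using dec[of n "brlen w"] \<open>?q (delta w) \<in> ?LC (brlen w)\<close> by (auto intro: scale)
      qed (use zero add in auto)
      ultimately show "?q f \<in> ?LC n" by simp
    qed
    show "?LC n \<subseteq> ?q ` lc_ideal deg n"
    proof (induction n rule: induct_nat_012)
      case 0 show ?case using tot all by simp
    next
      case 1 show ?case using tot all by simp
    next
      case (ge2 n)
      note k = word_idealD[OF word_ideal_lc[of deg "Suc (Suc n)"]]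
      show ?case
        unfolding lower_central.simps
      proof
        fix x assume "x \<in> gspan ?L {gbr ?L x y |x y. x \<in> gtotal ?L \<and> y \<in> ?LC (Suc n)}"
        then show "x \<in> ?q ` lc_ideal deg (Suc (Suc n))"
        proof induction
          case zero then show ?case using p(6) k(2) by auto
        next
          case (base x)
          then obtain f y where f: "x = gbr ?L (?q f) y" "f \<in> finsupp" "y \<in> ?LC (Suc n)"
            using tot by auto
          then obtain g where g: "y = ?q g" "g \<in> lc_ideal deg (Suc n)" using ge2 by auto
          then have gf: "g \<in> finsupp" "trunc (Suc n) g \<in> free_ideal deg" by (simp_all add: lc_ideal_def)
          have "trunc (Suc (Suc n)) (fbr f (trunc (Suc n) g)) \<in> free_ideal deg"
            by (rule free_ideal_trunc[OF free_ideal_left[OF f(2) gf(2)]])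
          then have "fbr f g \<in> lc_ideal deg (Suc (Suc n))"
            using f gf by (simp add: lc_ideal_def trunc_fbr_right)
          then show ?case using f g gf p(4) by auto
        next
          case (add x y)
          then obtain f g where "x = ?q f" "y = ?q g" "f \<in> lc_ideal deg (Suc (Suc n))" "g \<in> lc_ideal deg (Suc (Suc n))"
            by auto
          then show ?case using p(3)[of f g] k(1,3) by auto
        next
          case (scale x c)
          then obtain f where "x = ?q f" "f \<in> lc_ideal deg (Suc (Suc n))" by auto
          then show ?case using p(5)[of f c] k(1,4) by auto
        qed
      qed
    qed
  qed
qed

definition quot_proj :: "('g \<Rightarrow> int) \<Rightarrow> nat \<Rightarrow> ('g brword \<Rightarrow> rat) \<Rightarrow> ('g brword \<Rightarrow> rat) set set"
  where "quot_proj deg n f = coset (free_lie deg) (lower_central (free_lie deg) n) (free_proj deg f)"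

lemma presents_quot:
  "presents deg (quotient_galg (free_lie deg) (lower_central (free_lie deg) n)) (quot_proj deg n) (lc_ideal deg n)"
  unfolding lower_central_free_lie quot_proj_def
  by (rule presents_quotient[OF presents_free_lie word_ideal_lc free_ideal_subset_lc])

section \<open>The completed free graded Lie algebra as a type\<close>

text \<open>
  The degrees are attached to the type of generators, so that the completed free Lie algebra is a type.
  Finiteness of the generators ensures that there are finitely many words of each length; then every
  function on words is a convergent sum.
\<close>

class graded_generators = finite +
  fixes gdeg :: "'a \<Rightarrow> int"

lemma restr_commute: "restr P (restr Q f) = restr Q (restr P f)"
  by (rule ext) (simp add: restr_def)

text \<open>
  The kernel of the map from functions on words to the inverse limit: the closure of the ideal of
  relations for the word length.
\<close>

definition null_fun :: "('g::graded_generators brword \<Rightarrow> rat) set"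
  where "null_fun = {f. \<forall>n. trunc n f \<in> free_ideal gdeg}"

lemma null_fun_closed:
  "0 \<in> null_fun" "f \<in> null_fun \<Longrightarrow> g \<in> null_fun \<Longrightarrow> f + g \<in> null_fun"
  "f \<in> null_fun \<Longrightarrow> fscale c f \<in> null_fun" "f \<in> null_fun \<Longrightarrow> g \<in> null_fun \<Longrightarrow> f - g \<in> null_fun"
  "f \<in> null_fun \<Longrightarrow> trunc m f \<in> null_fun"
proof -
  show "f \<in> null_fun \<Longrightarrow> trunc m f \<in> null_fun"
    unfolding null_fun_def by (auto intro: free_ideal_trunc simp: restr_commute[of "\<lambda>t. brlen t < m"])
qed (auto simp: null_fun_def restr_linear free_ideal_zero free_ideal_add free_ideal_scale free_ideal_diff)

lemma null_fun_uminus: "f \<in> null_fun \<Longrightarrow> - f \<in> null_fun"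
  using null_fun_closed(3)[of f "-1"] by (simp add: fscale_linear)

lemma null_fun_fbr:
  assumes "f \<in> null_fun"
  shows "fbr f g \<in> null_fun" "fbr g f \<in> null_fun"
proof -
  have *: "trunc n f \<in> free_ideal gdeg" for n using assms by (simp add: null_fun_def)
  have "trunc n (fbr f g) \<in> free_ideal gdeg" "trunc n (fbr g f) \<in> free_ideal gdeg" for n
    using free_ideal_trunc[OF free_ideal_right[OF *[of n] finsupp_trunc[of n g]], of n]
      free_ideal_trunc[OF free_ideal_left[OF finsupp_trunc[of n g] *[of n]], of n]
    by (simp_all only: trunc_fbr_left trunc_fbr_right')
  then show "fbr f g \<in> null_fun" "fbr g f \<in> null_fun" by (simp_all add: null_fun_def)
qed

lemma trunc_null_fun_iff: "trunc n f \<in> null_fun \<longleftrightarrow> trunc n f \<in> free_ideal gdeg"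
proof
  assume "trunc n f \<in> null_fun"
  then have "trunc n (trunc n f) \<in> free_ideal gdeg" unfolding null_fun_def by blast
  then show "trunc n f \<in> free_ideal gdeg" by (simp only: trunc_trunc(1)[OF order_refl])
qed (use free_ideal_trunc in \<open>unfold null_fun_def, blast\<close>)

abbreviation degree_part :: "int \<Rightarrow> ('g::graded_generators brword \<Rightarrow> rat) \<Rightarrow> 'g brword \<Rightarrow> rat"
  where "degree_part p \<equiv> restr (\<lambda>t. brdeg gdeg t = p)"

lemma null_fun_degree_part:
  assumes "f \<in> null_fun"
  shows "degree_part p f \<in> null_fun"
proof -
  have "trunc n (degree_part p f) \<in> free_ideal gdeg" for n
    unfolding restr_commute[of "\<lambda>t. brlen t < n"]
    by (rule free_ideal_restr_weight) (use assms in \<open>auto simp: null_fun_def\<close>)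
  then show ?thesis by (simp add: null_fun_def)
qed

quotient_type (overloaded) 'g cl = "'g::graded_generators brword \<Rightarrow> rat" / "\<lambda>f g. f - g \<in> null_fun"
proof (rule equivpI)
  show "reflp (\<lambda>f g :: 'g brword \<Rightarrow> rat. f - g \<in> null_fun)"
    by (rule reflpI) (simp add: null_fun_closed)
  show "symp (\<lambda>f g :: 'g brword \<Rightarrow> rat. f - g \<in> null_fun)"
    by (rule sympI) (metis minus_diff_eq null_fun_uminus)
  show "transp (\<lambda>f g :: 'g brword \<Rightarrow> rat. f - g \<in> null_fun)"
  proof (rule transpI)
    fix f g h :: "'g brword \<Rightarrow> rat"
    assume "f - g \<in> null_fun" "g - h \<in> null_fun"
    from null_fun_closed(2)[OF this] show "f - h \<in> null_fun" by simp
  qed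
qed

instantiation cl :: (graded_generators) ab_group_add
begin

lift_definition zero_cl :: "'a cl" is 0 .
lift_definition plus_cl :: "'a cl \<Rightarrow> 'a cl \<Rightarrow> 'a cl" is "(+)"
  by (simp add: add_diff_add null_fun_closed)
lift_definition minus_cl :: "'a cl \<Rightarrow> 'a cl \<Rightarrow> 'a cl" is "(-)"
  by (metis (no_types, lifting) add_diff_add diff_add_eq diff_diff_eq2 null_fun_closed(4) add.commute diff_diff_eq)
lift_definition uminus_cl :: "'a cl \<Rightarrow> 'a cl" is uminus
  by (metis minus_diff_eq minus_diff_minus null_fun_uminus)

instance
  by standard (transfer; simp add: null_fun_closed algebra_simps)+

end

lift_definition scl :: "rat \<Rightarrow> 'g::graded_generators cl \<Rightarrow> 'g cl" (infixr \<open>*\<^sub>q\<close> 75) is fscale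
  by (simp add: null_fun_closed flip: fscale_linear)

lift_definition br :: "'g::graded_generators cl \<Rightarrow> 'g cl \<Rightarrow> 'g cl" is fbr
proof -
  fix f f' g g' :: "'g brword \<Rightarrow> rat"
  assume a: "f - f' \<in> null_fun" "g - g' \<in> null_fun"
  have "fbr f g - fbr f' g' = fbr (f - f') g + fbr f' (g - g')"
    by (simp add: fbr_linear)
  then show "fbr f g - fbr f' g' \<in> null_fun"
    using a by (simp add: null_fun_closed null_fun_fbr)
qed

lift_definition proj :: "int \<Rightarrow> 'g::graded_generators cl \<Rightarrow> 'g cl" is degree_part
  by (simp add: null_fun_degree_part flip: restr_linear)

lift_definition tr :: "nat \<Rightarrow> 'g::graded_generators cl \<Rightarrow> 'g cl" is trunc
  by (simp add: null_fun_closed flip: restr_linear)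

lift_definition gen :: "'g::graded_generators \<Rightarrow> 'g cl" is "\<lambda>v. delta (Gen v)" .

definition Hom :: "int \<Rightarrow> 'g::graded_generators cl set"
  where "Hom p = {x. proj p x = x}"

definition Fil :: "nat \<Rightarrow> 'g::graded_generators cl set"
  where "Fil n = {x. tr n x = 0}"

text \<open>
  A function on words may involve infinitely many degrees, whereas the inverse limit of graded algebras
  is formed in each degree and is the direct sum of the results.
\<close>

definition Tot :: "'g::graded_generators cl set"
  where "Tot = {x. \<exists>P. finite P \<and> x = (\<Sum>p\<in>P. proj p x)}"

interpretation cl: vector_space scl
  by standard (transfer; simp add: fscale_linear null_fun_closed)+

lemma br_linear:
  "br (x + y) z = br x z + br y z" "br z (x + y) = br z x + br z y"
  "br (x - y) z = br x z - br y z" "br z (x - y) = br z x - br z y"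
  "br (c *\<^sub>q x) z = c *\<^sub>q br x z" "br z (c *\<^sub>q x) = c *\<^sub>q br z x"
  "br 0 z = 0" "br z 0 = 0"
  by (transfer; simp add: fbr_linear null_fun_closed)+

lemma br_uminus: "br (- x) z = - br x z" "br z (- x) = - br z x"
  using br_linear(3)[of 0 x z] br_linear(4)[of z 0 x] by (simp_all add: br_linear)

lemma br_sum: "br (sum f A) z = (\<Sum>i\<in>A. br (f i) z)" "br z (sum f A) = (\<Sum>i\<in>A. br z (f i))"
  by (induction A rule: infinite_finite_induct) (simp_all add: br_linear)

lemma proj_linear:
  "proj p (x + y) = proj p x + proj p y" "proj p (x - y) = proj p x - proj p y"
  "proj p (c *\<^sub>q x) = c *\<^sub>q proj p x" "proj p 0 = 0" "proj p (- x) = - proj p x"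
  by (transfer; simp add: restr_linear null_fun_closed)+

lemma tr_linear:
  "tr n (x + y) = tr n x + tr n y" "tr n (x - y) = tr n x - tr n y"
  "tr n (c *\<^sub>q x) = c *\<^sub>q tr n x" "tr n 0 = 0" "tr n (- x) = - tr n x"
  by (transfer; simp add: restr_linear null_fun_closed)+

lemma proj_sum: "proj p (sum f A) = (\<Sum>i\<in>A. proj p (f i))"
  by (induction A rule: infinite_finite_induct) (simp_all add: proj_linear)

lemma proj_proj: "proj p (proj q x) = (if p = q then proj p x else 0)"
proof transfer
  fix p q and f :: "'a brword \<Rightarrow> rat"
  have "degree_part p (degree_part q f) = (if p = q then degree_part p f else 0)"
    by (rule ext) (simp add: restr_def pointwise)
  then show "degree_part p (degree_part q f) - (if p = q then degree_part p f else 0) \<in> null_fun"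
    by (simp add: null_fun_closed)
qed

lemma tr_tr: "tr m (tr n x) = tr (min m n) x"
proof (cases "m \<le> n")
  case True
  then have "tr m (tr n x) = tr m x" by transfer (simp add: trunc_trunc null_fun_closed)
  then show ?thesis using True by (simp add: min_def)
next
  case False
  then have "tr m (tr n x) = tr n x" by transfer (simp add: trunc_trunc null_fun_closed)
  then show ?thesis using False by (simp add: min_def)
qed

lemma tr_proj: "tr m (proj p x) = proj p (tr m x)"
  by (transfer) (simp add: null_fun_closed restr_commute[of "\<lambda>t. brlen t < _"])

lemma tr_0 [simp]: "tr 0 x = 0" and tr_1 [simp]: "tr (Suc 0) x = 0"
  by (transfer; simp add: null_fun_closed)+

lemma Hom_closed [intro]:
  "0 \<in> Hom p" "x \<in> Hom p \<Longrightarrow> y \<in> Hom p \<Longrightarrow> x + y \<in> Hom p" "x \<in> Hom p \<Longrightarrow> y \<in> Hom p \<Longrightarrow> x - y \<in> Hom p"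
  "x \<in> Hom p \<Longrightarrow> c *\<^sub>q x \<in> Hom p" "x \<in> Hom p \<Longrightarrow> - x \<in> Hom p" "proj p x \<in> Hom p"
  by (auto simp: Hom_def proj_linear proj_proj)

lemma Fil_closed [intro]:
  "0 \<in> Fil n" "x \<in> Fil n \<Longrightarrow> y \<in> Fil n \<Longrightarrow> x + y \<in> Fil n" "x \<in> Fil n \<Longrightarrow> y \<in> Fil n \<Longrightarrow> x - y \<in> Fil n"
  "x \<in> Fil n \<Longrightarrow> c *\<^sub>q x \<in> Fil n" "x \<in> Fil n \<Longrightarrow> - x \<in> Fil n" "x \<in> Fil n \<Longrightarrow> proj p x \<in> Fil n"
  "x - tr n x \<in> Fil n" "x \<in> Fil 0" "x \<in> Fil (Suc 0)"
  by (auto simp: Fil_def tr_linear tr_proj proj_linear tr_tr)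

lemma Hom_sum [intro]: "(\<And>i. i \<in> A \<Longrightarrow> f i \<in> Hom p) \<Longrightarrow> sum f A \<in> Hom p"
  by (induction A rule: infinite_finite_induct) auto

lemma Fil_sum [intro]: "(\<And>i. i \<in> A \<Longrightarrow> f i \<in> Fil n) \<Longrightarrow> sum f A \<in> Fil n"
  by (induction A rule: infinite_finite_induct) auto

lemma Fil_mono: "m \<le> n \<Longrightarrow> x \<in> Fil n \<Longrightarrow> x \<in> Fil m"
  unfolding Fil_def using tr_tr[of m n x] by (simp add: min_def tr_linear)

lemma Hom_gen [simp]: "gen v \<in> Hom (gdeg v)"
  unfolding Hom_def by (simp, transfer) (simp add: restr_delta null_fun_closed)

lemma abs_cl_Fil_iff: "abs_cl f \<in> Fil n \<longleftrightarrow> trunc n f \<in> free_ideal gdeg"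
proof -
  have "abs_cl f \<in> Fil n \<longleftrightarrow> abs_cl (trunc n f) = abs_cl 0"
    by (simp add: Fil_def tr.abs_eq zero_cl_def)
  also have "\<dots> \<longleftrightarrow> trunc n f \<in> null_fun"
    by (subst cl.abs_eq_iff) simp
  also have "\<dots> \<longleftrightarrow> trunc n f \<in> free_ideal gdeg"
    by (rule trunc_null_fun_iff)
  finally show ?thesis .
qed

lemma Fil_zero:
  assumes "\<And>n. x \<in> Fil n"
  shows "x = 0"
proof -
  have "(\<forall>n. tr n x = 0) \<longrightarrow> x = 0"
  proof transfer
    show "(\<forall>n. trunc n f - 0 \<in> null_fun) \<longrightarrow> f - 0 \<in> null_fun" for f :: "'a brword \<Rightarrow> rat"
      by (simp add: trunc_null_fun_iff) (simp add: null_fun_def)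
  qed
  then show ?thesis using assms by (simp add: Fil_def)
qed

lemma br_Fil:
  assumes "x \<in> Fil m" "y \<in> Fil n"
  shows "br x y \<in> Fil (m + n)"
proof -
  have "tr (m + n) (br (x - tr m x) (y - tr n y)) = 0"
  proof transfer
    fix m n and f g :: "'a brword \<Rightarrow> rat"
    have "trunc (m + n) (fbr (f - trunc m f) (g - trunc n g)) = 0"
      by (rule fun_brword_eqI) (auto simp: restr_def pointwise)
    then show "trunc (m + n) (fbr (f - trunc m f) (g - trunc n g)) - 0 \<in> null_fun"
      by (simp add: null_fun_closed)
  qed
  then show ?thesis using assms by (simp add: Fil_def)
qed

lemma br_Fil_Suc: "y \<in> Fil n \<Longrightarrow> br x y \<in> Fil (Suc n)"
  using br_Fil[of x "Suc 0" y n] by auto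

lemma br_Fil_right: "y \<in> Fil n \<Longrightarrow> br x y \<in> Fil n"
  using br_Fil[of x 0 y n] by auto

lemma br_Fil_left: "x \<in> Fil n \<Longrightarrow> br x y \<in> Fil n"
  using br_Fil[of x n y 0] by auto

lemma br_Hom:
  assumes "x \<in> Hom p" "y \<in> Hom q"
  shows "br x y \<in> Hom (p + q)"
proof -
  have "proj (p + q) (br (proj p x) (proj q y)) = br (proj p x) (proj q y)"
  proof transfer
    fix p q and f g :: "'a brword \<Rightarrow> rat"
    have "degree_part (p + q) (fbr (degree_part p f) (degree_part q g)) = fbr (degree_part p f) (degree_part q g)"
      by (rule fun_brword_eqI) (auto simp: restr_def)
    then show "degree_part (p + q) (fbr (degree_part p f) (degree_part q g)) -
        fbr (degree_part p f) (degree_part q g) \<in> null_fun"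
      by (simp add: null_fun_closed)
  qed
  then show ?thesis using assms by (simp add: Hom_def)
qed

lemma trunc_degree_part_homog: "trunc n (degree_part p f) \<in> homog gdeg p"
  using finsupp_trunc[of n "degree_part p f"] by (auto simp: restr_def)

lemma br_antisym:
  assumes "x \<in> Hom p" "y \<in> Hom q"
  shows "br x y = - (parity_sign (p * q) *\<^sub>q br y x)"
proof -
  have "br (proj p x) (proj q y) + parity_sign (p * q) *\<^sub>q br (proj q y) (proj p x) = 0"
  proof (transfer, unfold null_fun_def, intro CollectI allI)
    fix p q n and f g :: "'a brword \<Rightarrow> rat"
    define a b where "a = degree_part p f" and "b = degree_part q g"
    have "trunc n (antisym_rel (parity_sign (p * q)) (trunc n a) (trunc n b)) \<in> free_ideal gdeg"
      unfolding a_def b_def by (intro free_ideal_trunc free_ideal_antisym trunc_degree_part_homog)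
    then show "trunc n (fbr a b + fscale (parity_sign (p * q)) (fbr b a) - 0) \<in> free_ideal gdeg"
      by (simp add: antisym_rel_def restr_linear trunc_fbr_left trunc_fbr_right')
  qed
  then show ?thesis using assms by (simp add: Hom_def eq_neg_iff_add_eq_0)
qed

lemma br_jacobi:
  assumes "x \<in> Hom p" "y \<in> Hom q" "z \<in> Hom r"
  shows "br x (br y z) = br (br x y) z + parity_sign (p * q) *\<^sub>q br y (br x z)"
proof -
  have "br (proj p x) (br (proj q y) (proj r z)) = br (br (proj p x) (proj q y)) (proj r z) +
      parity_sign (p * q) *\<^sub>q br (proj q y) (br (proj p x) (proj r z))"
  proof (transfer, unfold null_fun_def, intro CollectI allI)
    fix p q r n and f g h :: "'a brword \<Rightarrow> rat"
    define a b c where "a = degree_part p f" and "b = degree_part q g" and "c = degree_part r h"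
    have *: "trunc n (jacobi_rel (parity_sign (p * q)) (trunc n a) (trunc n b) (trunc n c)) \<in> free_ideal gdeg"
      unfolding a_def b_def c_def
      by (rule free_ideal_trunc, rule free_ideal_jacobi) (rule trunc_degree_part_homog)+
    have l: "trunc n (fbr (trunc n u) v) = trunc n (fbr u v)" "trunc n (fbr u (trunc n v)) = trunc n (fbr u v)"
      for u v :: "'a brword \<Rightarrow> rat" by (simp_all add: trunc_fbr_left trunc_fbr_right')
    have 1: "trunc n (fbr (trunc n a) (fbr (trunc n b) (trunc n c))) = trunc n (fbr a (fbr b c))"
      for a b c :: "'a brword \<Rightarrow> rat" by (metis l)
    have 2: "trunc n (fbr (fbr (trunc n a) (trunc n b)) (trunc n c)) = trunc n (fbr (fbr a b) c)"
      for a b c :: "'a brword \<Rightarrow> rat" by (metis l)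
    from * show "trunc n (fbr a (fbr b c) - (fbr (fbr a b) c +
        fscale (parity_sign (p * q)) (fbr b (fbr a c)))) \<in> free_ideal gdeg"
      by (simp add: jacobi_rel_def restr_linear 1 2)
  qed
  then show ?thesis using assms by (simp add: Hom_def)
qed

section \<open>Limits in the completion\<close>

text \<open>
  Choose a function on words for each \<open>s n\<close>. The limit takes its values at words of length \<open>k\<close> from the
  function for \<open>s (k + 1)\<close>. It is homogeneity of the relations for the word length that allows one to
  compare the parts of each length separately.
\<close>

lemma limit_exists:
  fixes s :: "nat \<Rightarrow> 'g::graded_generators cl"
  assumes s: "\<And>n. s (Suc n) - s n \<in> Fil n"
  shows "\<exists>l. \<forall>n. l - s n \<in> Fil n"
proof -
  have s': "s m - s n \<in> Fil m" if "m \<le> n" for m n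
    using that
  proof (induction rule: dec_induct)
    case (step k)
    have "s m - s (Suc k) = (s m - s k) - (s (Suc k) - s k)" by simp
    then show ?case using step s[of k] Fil_mono[of m k] by (metis Fil_closed(3))
  qed auto
  obtain f where f: "\<And>n. s n = abs_cl (f n)"
    by (metis Quotient3_abs_rep Quotient3_cl)
  define h where "h = (\<lambda>t. f (Suc (brlen t)) t)"
  have "trunc m (h - f n) \<in> free_ideal gdeg" if "m \<le> n" for m n
    using that
  proof (induction m)
    case (Suc m)
    have "s (Suc m) - s n \<in> Fil (Suc m)" using s' Suc by simp
    then have "trunc (Suc m) (f (Suc m) - f n) \<in> free_ideal gdeg"
      by (simp add: f minus_cl.abs_eq abs_cl_Fil_iff)
    then have "restr (\<lambda>t. int (brlen t) = int m) (trunc (Suc m) (f (Suc m) - f n)) \<in> free_ideal gdeg"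
      by (rule free_ideal_restr_weight[rotated]) simp
    moreover have "trunc (Suc m) (h - f n) = trunc m (h - f n) +
        restr (\<lambda>t. int (brlen t) = int m) (trunc (Suc m) (f (Suc m) - f n))"
      by (rule ext) (auto simp: restr_def pointwise h_def)
    ultimately show ?case using Suc by (simp add: free_ideal_add)
  qed (simp add: free_ideal_zero)
  then have "abs_cl h - s n \<in> Fil n" for n
    by (simp add: f minus_cl.abs_eq abs_cl_Fil_iff)
  then show ?thesis by blast
qed

lemma limit_unique:
  assumes "\<And>n. l - s n \<in> Fil n" "\<And>n. l' - s n \<in> Fil n"
  shows "l = l'"
proof -
  have "l - l' \<in> Fil n" for n
    using Fil_closed(3)[OF assms(1)[of n] assms(2)[of n]] by simp
  then show ?thesis using Fil_zero[of "l - l'"] by simp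
qed

lemma limit_Hom:
  assumes "\<And>n. l - s n \<in> Fil n" "\<And>n. s n \<in> Hom p"
  shows "l \<in> Hom p"
proof -
  have "proj p l - s n \<in> Fil n" for n
    using Fil_closed(6)[OF assms(1)[of n], of p] assms(2)[of n] by (simp add: proj_linear Hom_def)
  from limit_unique[OF this assms(1)] show ?thesis by (simp add: Hom_def)
qed

text \<open>
  The sum of a series whose \<open>n\<close>-th term lies in \<open>Fil n\<close>. Modulo \<open>Fil n\<close> only the terms before
  the \<open>n\<close>-th count, so identities between sums reduce to finite ones (\<open>lsum_eqI\<close>).
\<close>

definition lsum :: "(nat \<Rightarrow> 'g::graded_generators cl) \<Rightarrow> 'g cl"
  where "lsum z = (SOME l. \<forall>n. l - (\<Sum>k<n. z k) \<in> Fil n)"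

lemma lsum_Fil:
  assumes "\<And>n. z n \<in> Fil n"
  shows "lsum z - (\<Sum>k<n. z k) \<in> Fil n"
proof -
  have "\<exists>l. \<forall>n. l - (\<Sum>k<n. z k) \<in> Fil n"
    by (rule limit_exists) (simp add: assms)
  from someI_ex[OF this] show ?thesis by (simp add: lsum_def)
qed

lemma lsum_eqI:
  assumes "\<And>n. z n \<in> Fil n" "\<And>n. l - (\<Sum>k<n. z k) \<in> Fil n"
  shows "lsum z = l"
  by (rule limit_unique[OF lsum_Fil[OF assms(1)] assms(2)])

lemma lsum_map:
  assumes z: "\<And>n. z n \<in> Fil n"
    and add: "\<And>x y. T (x + y) = T x + T y" and T: "\<And>n x. x \<in> Fil n \<Longrightarrow> T x \<in> Fil n"
  shows "T (lsum z) = lsum (\<lambda>n. T (z n))"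
proof -
  have T0: "T 0 = 0" using add[of 0 0] by simp
  have sub: "T (x - y) = T x - T y" for x y using add[of "x - y" y] by simp
  have sum: "T (sum f A) = (\<Sum>i\<in>A. T (f i))" for f and A :: "nat set"
    by (induction A rule: infinite_finite_induct) (simp_all add: T0 add)
  show ?thesis
    by (rule lsum_eqI[symmetric]) (auto intro!: T z lsum_Fil simp flip: sub sum)
qed

lemma lsum_add:
  assumes "\<And>n. z n \<in> Fil n" "\<And>n. w n \<in> Fil n"
  shows "lsum (\<lambda>n. z n + w n) = lsum z + lsum w"
proof (rule lsum_eqI)
  show "lsum z + lsum w - (\<Sum>k<n. z k + w k) \<in> Fil n" for n
    using Fil_closed(2)[OF lsum_Fil[OF assms(1), of n] lsum_Fil[OF assms(2), of n]]
    by (simp add: sum.distrib algebra_simps)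
qed (use assms in auto)

lemma lsum_scl: "(\<And>n. z n \<in> Fil n) \<Longrightarrow> lsum (\<lambda>n. c *\<^sub>q z n) = c *\<^sub>q lsum z"
  by (rule lsum_map[symmetric]) (auto simp: cl.scale_right_distrib)

lemma lsum_Hom:
  assumes "\<And>n. z n \<in> Fil n" "\<And>n. z n \<in> Hom p"
  shows "lsum z \<in> Hom p"
  by (rule limit_Hom[OF lsum_Fil[OF assms(1)]]) (use assms(2) in auto)

lemma lsum_in_Fil:
  assumes "\<And>n. z n \<in> Fil n" "\<And>n. z n \<in> Fil m"
  shows "lsum z \<in> Fil m"
  using Fil_closed(2)[OF lsum_Fil[OF assms(1), of m] Fil_sum[of "{..<m}" z m, OF assms(2)]] by simp

section \<open>Evaluation on words\<close>

lemma cl_abs_cases: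
  obtains f where "x = abs_cl f"
  by (rule that[OF Quotient3_abs_rep[OF Quotient3_cl, symmetric]])

lift_definition word :: "'g::graded_generators brword \<Rightarrow> 'g cl" is delta .

lemma word_simps [simp]: "word (Gen v) = gen v" "word (Br l r) = br (word l) (word r)"
  by (transfer; simp add: null_fun_closed)+

lemma word_Fil: "word t \<in> Fil (brlen t)"
  unfolding Fil_def by (simp, transfer) (simp add: restr_delta null_fun_closed)

lemma word_Hom: "word t \<in> Hom (brdeg gdeg t)"
  unfolding Hom_def by (simp, transfer) (simp add: restr_delta null_fun_closed)

text \<open>
  The continuous linear extension of a map \<open>m\<close> on words. A word of length \<open>n\<close> must be sent to
  \<open>Fil n\<close> for the sum to converge.
\<close>

definition eval ::
    "('g::graded_generators brword \<Rightarrow> 'h::graded_generators cl) \<Rightarrow> ('g brword \<Rightarrow> rat) \<Rightarrow> 'h cl"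
  where "eval m f = lsum (\<lambda>n. \<Sum>t | brlen t = n. f t *\<^sub>q m t)"

lemma finite_brlen_eq: "finite {t :: 'g::finite brword. brlen t = n}"
  by (rule finite_subset[OF _ finite_brlen_less[of "Suc n"]]) auto

lemma sum_brlen_less:
  fixes h :: "'g::finite brword \<Rightarrow> 'b::comm_monoid_add"
  shows "(\<Sum>k<n. \<Sum>t | brlen t = k. h t) = (\<Sum>t | brlen t < n. h t)"
proof (induction n)
  case (Suc n)
  have "{t :: 'g brword. brlen t < Suc n} = {t. brlen t < n} \<union> {t. brlen t = n}" by auto
  then show ?case
    using Suc by (simp add: sum.union_disjoint finite_brlen_less finite_brlen_eq disjoint_iff)
qed simp

context
  fixes m :: "'g::graded_generators brword \<Rightarrow> 'h::graded_generators cl"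
  assumes m: "\<And>t. m t \<in> Fil (brlen t)"
begin

lemma eval_terms_Fil: "(\<Sum>t | brlen t = n. f t *\<^sub>q m t) \<in> Fil n"
  using m by (intro Fil_sum Fil_closed(4)) auto

lemma eval_approx: "eval m f - (\<Sum>t | brlen t < n. f t *\<^sub>q m t) \<in> Fil n"
  using lsum_Fil[of "\<lambda>n. \<Sum>t | brlen t = n. f t *\<^sub>q m t" n, OF eval_terms_Fil]
  by (simp add: eval_def sum_brlen_less)

lemma eval_eqI:
  assumes "\<And>n. l - (\<Sum>t | brlen t < n. f t *\<^sub>q m t) \<in> Fil n"
  shows "eval m f = l"
  by (rule limit_unique[OF eval_approx assms])

lemma eval_add: "eval m (f + g) = eval m f + eval m g"
  unfolding eval_def
  by (subst lsum_add[symmetric])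
    (auto simp: pointwise cl.scale_left_distrib sum.distrib intro: eval_terms_Fil)

lemma eval_fscale: "eval m (fscale c f) = c *\<^sub>q eval m f"
  unfolding eval_def
  by (subst lsum_scl[symmetric])
    (auto simp: fscale_def cl.scale_sum_right intro: eval_terms_Fil)

lemma eval_diff: "eval m (f - g) = eval m f - eval m g"
  using eval_add[of "f - g" g] by simp

lemma eval_0: "eval m 0 = 0"
  using eval_diff[of 0 0] by simp

lemma eval_Fil:
  assumes "trunc n f = 0"
  shows "eval m f \<in> Fil n"
proof -
  have "f t = 0" if "brlen t < n" for t
    using fun_cong[OF assms, of t] that by (simp add: restr_def pointwise)
  then have "(\<Sum>t | brlen t < n. f t *\<^sub>q m t) = 0" by (intro sum.neutral) auto
  then show ?thesis using eval_approx[of f n] by simp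
qed

lemma eval_trunc: "eval m f - eval m (trunc n f) \<in> Fil n"
  unfolding eval_diff[symmetric] by (rule eval_Fil) (simp add: restr_linear trunc_trunc)

lemma eval_delta: "eval m (delta w) = m w"
proof (rule eval_eqI)
  fix n
  have "(\<Sum>t | brlen t < n. delta w t *\<^sub>q m t) = (\<Sum>t | brlen t < n. if t = w then m w else 0)"
    by (rule sum.cong) (auto simp: delta_def)
  also have "\<dots> = (if brlen w < n then m w else 0)"
    by (simp add: sum.delta finite_brlen_less)
  finally show "m w - (\<Sum>t | brlen t < n. delta w t *\<^sub>q m t) \<in> Fil n"
    using Fil_mono[OF _ m, of n w] by auto
qed

lemma eval_Hom:
  assumes "\<And>t. f t \<noteq> 0 \<Longrightarrow> m t \<in> Hom p"
  shows "eval m f \<in> Hom p"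
  unfolding eval_def
proof (rule lsum_Hom[OF eval_terms_Fil], rule Hom_sum)
  show "f t *\<^sub>q m t \<in> Hom p" for t
    using assms[of t] by (cases "f t = 0") auto
qed

lemma eval_null:
  assumes "\<And>f. f \<in> free_ideal gdeg \<Longrightarrow> eval m f = 0" "f \<in> null_fun"
  shows "eval m f = 0"
proof (rule Fil_zero)
  show "eval m f \<in> Fil n" for n
    using eval_trunc[of f n] assms by (simp add: null_fun_def)
qed

end

lemma abs_cl_eq_eval: "abs_cl f = eval word f"
proof (rule eval_eqI[symmetric, OF word_Fil])
  fix n
  have "abs_cl (restr (\<lambda>t. t \<in> A) f) = (\<Sum>t\<in>A. f t *\<^sub>q word t)" if "finite A" for A
    using that
  proof (induction A)
    case empty
    show ?case by (simp add: zero_cl_def)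
  next
    case (insert w A)
    have "restr (\<lambda>t. t \<in> insert w A) f = fscale (f w) (delta w) + restr (\<lambda>t. t \<in> A) f"
      using insert.hyps(2) by (intro ext) (auto simp: restr_def fscale_def delta_def pointwise)
    then show ?case using insert by (simp flip: plus_cl.abs_eq scl.abs_eq add: word.abs_eq)
  qed
  from this[of "{t. brlen t < n}"]
  have "(\<Sum>t | brlen t < n. f t *\<^sub>q word t) = tr n (abs_cl f)"
    by (simp add: finite_brlen_less tr.abs_eq)
  then show "abs_cl f - (\<Sum>t | brlen t < n. f t *\<^sub>q word t) \<in> Fil n" by auto
qed

text \<open>
  Modulo \<open>Fil n\<close> both sides are sums over pairs of words \<open>(l, r)\<close>: on the left those of total length
  less than \<open>n\<close>, on the right those with both lengths less than \<open>n\<close>. The surplus pairs have total length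
  at least \<open>n\<close> and contribute to \<open>Fil n\<close>. The maps \<open>a\<close> and \<open>b\<close> differ from \<open>m\<close> for derivations.
\<close>

lemma eval_fbr:
  assumes m: "\<And>t. m t \<in> Fil (brlen t)" and a: "\<And>t. a t \<in> Fil (brlen t)" and b: "\<And>t. b t \<in> Fil (brlen t)"
    and m_Br: "\<And>l r. m (Br l r) = br (a l) (b r)"
  shows "eval m (fbr f g) = br (eval a f) (eval b g)"
proof (rule eval_eqI[OF m])
  fix n
  define A where "A = (\<Sum>t | brlen t < n. f t *\<^sub>q a t)"
  define B where "B = (\<Sum>t | brlen t < n. g t *\<^sub>q b t)"
  define W where "W = {t :: 'a brword. brlen t < n}"
  define T where "T = (\<lambda>(l, r). (f l * g r) *\<^sub>q br (a l) (b r))"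
  define I where "I = {(l, r) \<in> W \<times> W. brlen l + brlen r < n}"
  have W: "finite W" unfolding W_def by (rule finite_brlen_less)
  have "br (eval a f) (eval b g) - br A B = br (eval a f - A) (eval b g) + br A (eval b g - B)"
    by (simp add: br_linear)
  moreover have "eval a f - A \<in> Fil n" "eval b g - B \<in> Fil n"
    unfolding A_def B_def by (rule eval_approx a b)+
  ultimately have 1: "br (eval a f) (eval b g) - br A B \<in> Fil n"
    using br_Fil_left br_Fil_right Fil_closed(2) by metis
  have "br A B = (\<Sum>l\<in>W. \<Sum>r\<in>W. T (l, r))"
    unfolding A_def B_def W_def[symmetric] br_sum T_def
    by (simp add: br_linear br_sum sum_distrib_left mult.commute) (rule sum.swap)
  also have "\<dots> = sum T (W \<times> W)" by (simp add: sum.cartesian_product T_def)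
  also have "\<dots> = sum T I + sum T (W \<times> W - I)"
    by (subst add.commute, rule sum.subset_diff) (use W in \<open>auto simp: I_def\<close>)
  finally have AB: "br A B = sum T I + sum T (W \<times> W - I)" .
  have "sum T (W \<times> W - I) \<in> Fil n"
  proof (rule Fil_sum)
    fix x assume "x \<in> W \<times> W - I"
    then obtain l r where x: "x = (l, r)" "n \<le> brlen l + brlen r" by (force simp: I_def)
    have "br (a l) (b r) \<in> Fil n" by (rule Fil_mono[OF x(2) br_Fil[OF a b]])
    then show "T x \<in> Fil n" by (auto simp: x T_def)
  qed
  moreover have "(\<Sum>t | brlen t < n. fbr f g t *\<^sub>q m t) = sum T I"
  proof -
    have "(\<Sum>t | brlen t < n. fbr f g t *\<^sub>q m t) = (\<Sum>t \<in> (\<lambda>(l, r). Br l r) ` I. fbr f g t *\<^sub>q m t)"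
    proof (rule sum.mono_neutral_right)
      show "\<forall>t\<in>{t. brlen t < n} - (\<lambda>(l, r). Br l r) ` I. fbr f g t *\<^sub>q m t = 0"
      proof
        fix t assume t: "t \<in> {t. brlen t < n} - (\<lambda>(l, r). Br l r) ` I"
        show "fbr f g t *\<^sub>q m t = 0"
        proof (cases t)
          case (Br l r)
          then have "(l, r) \<in> I" using t by (auto simp: I_def W_def)
          then show ?thesis using t Br by force
        qed simp
      qed
    qed (auto simp: finite_brlen_less I_def)
    also have "\<dots> = sum T I"
      by (subst sum.reindex) (auto simp: inj_on_def T_def m_Br intro!: sum.cong)
    finally show ?thesis .
  qed
  ultimately have "br A B - (\<Sum>t | brlen t < n. fbr f g t *\<^sub>q m t) \<in> Fil n"
    by (simp add: AB)
  from Fil_closed(2)[OF 1 this]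
  show "br (eval a f) (eval b g) - (\<Sum>t | brlen t < n. fbr f g t *\<^sub>q m t) \<in> Fil n" by simp
qed

section \<open>Continuous morphisms and derivations of the completion\<close>

text \<open>
  Continuity is required in the strong form that the filtration is preserved. It holds for every
  morphism and derivation, because these preserve the lower central series.
\<close>

definition cl_linear :: "int \<Rightarrow> ('g::graded_generators cl \<Rightarrow> 'h::graded_generators cl) \<Rightarrow> bool" where
  "cl_linear k T \<longleftrightarrow> (\<forall>x y. T (x + y) = T x + T y) \<and> (\<forall>c x. T (c *\<^sub>q x) = c *\<^sub>q T x) \<and>
     (\<forall>p. \<forall>x\<in>Hom p. T x \<in> Hom (p + k)) \<and> (\<forall>n. \<forall>x\<in>Fil n. T x \<in> Fil n)"

definition cl_morphism :: "('g::graded_generators cl \<Rightarrow> 'h::graded_generators cl) \<Rightarrow> bool" where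
  "cl_morphism T \<longleftrightarrow> cl_linear 0 T \<and> (\<forall>x y. T (br x y) = br (T x) (T y))"

definition cl_derivation :: "int \<Rightarrow> ('g::graded_generators cl \<Rightarrow> 'g cl) \<Rightarrow> bool" where
  "cl_derivation k D \<longleftrightarrow> cl_linear k D \<and>
     (\<forall>p x y. x \<in> Hom p \<longrightarrow> D (br x y) = br (D x) y + parity_sign (k * p) *\<^sub>q br x (D y))"

lemma cl_linearD:
  assumes "cl_linear k T"
  shows "T (x + y) = T x + T y" "T (c *\<^sub>q x) = c *\<^sub>q T x" "x \<in> Hom p \<Longrightarrow> T x \<in> Hom (p + k)"
    "x \<in> Fil n \<Longrightarrow> T x \<in> Fil n" "T 0 = 0" "T (x - y) = T x - T y" "T (- x) = - T x"
    "T (sum f A) = (\<Sum>i\<in>A. T (f i))"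
proof -
  show a: "T (x + y) = T x + T y" "T (c *\<^sub>q x) = c *\<^sub>q T x" "x \<in> Hom p \<Longrightarrow> T x \<in> Hom (p + k)"
    "x \<in> Fil n \<Longrightarrow> T x \<in> Fil n" for x y c p n
    using assms unfolding cl_linear_def by blast+
  show 0: "T 0 = 0" using a(1)[of 0 0] by simp
  show d: "T (x - y) = T x - T y" for x y using a(1)[of "x - y" y] by simp
  show "T (- x) = - T x" using d[of 0 x] 0 by simp
  show "T (sum f A) = (\<Sum>i\<in>A. T (f i))"
    by (induction A rule: infinite_finite_induct) (simp_all add: 0 a)
qed

lemma cl_morphismD:
  assumes "cl_morphism T"
  shows "cl_linear 0 T" "T (br x y) = br (T x) (T y)"
  using assms by (auto simp: cl_morphism_def)

lemma cl_derivationD: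
  assumes "cl_derivation k T"
  shows "cl_linear k T" "x \<in> Hom p \<Longrightarrow> T (br x y) = br (T x) y + parity_sign (k * p) *\<^sub>q br x (T y)"
  using assms by (auto simp: cl_derivation_def)

lemma cl_linear_lsum:
  assumes "cl_linear k T" "\<And>n. z n \<in> Fil n"
  shows "T (lsum z) = lsum (\<lambda>n. T (z n))"
  by (rule lsum_map) (use assms cl_linearD[OF assms(1)] in auto)

lemma cl_eq_on_words:
  assumes T: "cl_linear k T" and T': "cl_linear k' T'" and "\<And>t. T (word t) = T' (word t)"
  shows "T x = T' x"
proof -
  obtain f where x: "x = abs_cl f" by (rule cl_abs_cases)
  have "T (eval word f) = lsum (\<lambda>n. T (\<Sum>t | brlen t = n. f t *\<^sub>q word t))"
    unfolding eval_def by (rule cl_linear_lsum[OF T eval_terms_Fil[OF word_Fil]])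
  also have "\<dots> = lsum (\<lambda>n. T' (\<Sum>t | brlen t = n. f t *\<^sub>q word t))"
    by (simp add: cl_linearD(2,8)[OF T] cl_linearD(2,8)[OF T'] assms(3))
  also have "\<dots> = T' (eval word f)"
    unfolding eval_def by (rule cl_linear_lsum[OF T' eval_terms_Fil[OF word_Fil], symmetric])
  finally show ?thesis by (simp add: x abs_cl_eq_eval)
qed

lemma cl_morphism_eqI:
  assumes T: "cl_morphism T" and T': "cl_morphism T'" and g: "\<And>v. T (gen v) = T' (gen v)"
  shows "T = T'"
proof
  fix x
  have "T (word t) = T' (word t)" for t
    by (induction t) (simp_all add: g cl_morphismD(2)[OF T] cl_morphismD(2)[OF T'])
  then show "T x = T' x" by (rule cl_eq_on_words[OF cl_morphismD(1)[OF T] cl_morphismD(1)[OF T']])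
qed

lemma cl_derivation_eqI:
  assumes T: "cl_derivation k T" and T': "cl_derivation k T'" and g: "\<And>v. T (gen v) = T' (gen v)"
  shows "T = T'"
proof
  fix x
  have "T (word t) = T' (word t)" for t
    by (induction t)
      (simp_all add: g cl_derivationD(2)[OF T word_Hom] cl_derivationD(2)[OF T' word_Hom])
  then show "T x = T' x" by (rule cl_eq_on_words[OF cl_derivationD(1)[OF T] cl_derivationD(1)[OF T']])
qed

lemma parity_sign_if: "parity_sign k = (if even k then 1 else - 1)"
  by (simp add: power_int_minus_left)

lemma parity_sign_add: "parity_sign (a + b) = parity_sign a * parity_sign b"
  by (auto simp: parity_sign_if)

lemma free_ideal_null_fun: "f \<in> free_ideal gdeg \<Longrightarrow> f \<in> null_fun"
  by (simp add: null_fun_def free_ideal_trunc)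

lemma abs_cl_null: "f \<in> null_fun \<Longrightarrow> abs_cl f = 0"
  unfolding zero_cl_def by (subst cl.abs_eq_iff) simp

lemma abs_cl_homog: "f \<in> homog gdeg p \<Longrightarrow> abs_cl f \<in> Hom p"
  unfolding abs_cl_eq_eval by (rule eval_Hom[OF word_Fil]) (use word_Hom in auto)

text \<open>
  The values on generators have the right degrees, so the relations go to instances of antisymmetry and
  of the Jacobi identity in the target.
\<close>

lemma eval_morphism_null:
  assumes Br: "\<And>l r. m (Br l r) = br (m l) (m r)" and Gen: "\<And>v. m (Gen v) \<in> Hom (gdeg v)"
    and f: "f \<in> null_fun"
  shows "eval m f = 0"
proof (rule eval_null)
  show m: "m t \<in> Fil (brlen t)" for t
    by (induction t) (auto simp: Br intro: br_Fil)
  have hom: "m t \<in> Hom (brdeg gdeg t)" for t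
    by (induction t) (auto simp: Br Gen intro: br_Hom)
  have fbr: "eval m (fbr f g) = br (eval m f) (eval m g)" for f g
    by (rule eval_fbr[OF m m m Br])
  have homog: "eval m f \<in> Hom p" if "f \<in> homog gdeg p" for f p
    by (rule eval_Hom[OF m]) (use that hom in auto)
  note lin = eval_add[of m, OF m] eval_diff[of m, OF m] eval_fscale[of m, OF m] eval_0[of m, OF m] fbr
  show "eval m f = 0" if "f \<in> free_ideal gdeg" for f
    using that
  proof (induction rule: free_ideal_induct)
    case (antisym p q x y)
    show ?case
      using br_antisym[OF homog[OF antisym(1)] homog[OF antisym(2)]]
      by (simp add: antisym_rel_def lin)
  next
    case (jacobi p q r x y z)
    show ?case
      using br_jacobi[OF homog[OF jacobi(1)] homog[OF jacobi(2)] homog[OF jacobi(3)]]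
      by (simp add: jacobi_rel_def lin)
  qed (simp_all add: lin br_linear)
qed (rule f)

lemma quotient_linear_map:
  assumes m: "\<And>t. m t \<in> Fil (brlen t)" and deg: "\<And>t. m t \<in> Hom (brdeg gdeg t + k)"
    and null: "\<And>f. f \<in> null_fun \<Longrightarrow> eval m f = 0"
  shows "\<exists>T. cl_linear k T \<and> (\<forall>f. T (abs_cl f) = eval m f)"
proof -
  define T where "T = (\<lambda>x. eval m (rep_cl x))"
  have T: "T (abs_cl f) = eval m f" for f
  proof -
    have "rep_cl (abs_cl f) - f \<in> null_fun"
      using rep_abs_rsp_left[OF Quotient3_cl, of f f] by (simp add: null_fun_closed)
    from null[OF this] show ?thesis by (simp add: T_def eval_diff[OF m])
  qed
  have ex: "\<exists>f. x = abs_cl f" for x :: "'a cl" by (rule cl_abs_cases[of x]) blast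
  have "cl_linear k T"
    unfolding cl_linear_def
  proof (intro conjI allI ballI)
    show "T (x + y) = T x + T y" for x y
      using ex[of x] ex[of y] by (auto simp: T plus_cl.abs_eq eval_add[OF m])
    show "T (c *\<^sub>q x) = c *\<^sub>q T x" for c x
      using ex[of x] by (auto simp: T scl.abs_eq eval_fscale[OF m])
  next
    fix p and x :: "'a cl" assume "x \<in> Hom p"
    obtain f where f: "x = abs_cl f" using ex by blast
    have "x = abs_cl (degree_part p f)"
      using \<open>x \<in> Hom p\<close> by (simp add: Hom_def f proj.abs_eq)
    then show "T x \<in> Hom (p + k)"
      by (simp add: T) (rule eval_Hom[OF m], use deg in \<open>auto simp: restr_def split: if_splits\<close>)
  next
    fix n and x :: "'a cl" assume "x \<in> Fil n"
    obtain f where f: "x = abs_cl f" using ex by blast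
    have "x = abs_cl (f - trunc n f)"
      using \<open>x \<in> Fil n\<close> by (simp add: Fil_def f tr.abs_eq flip: minus_cl.abs_eq)
    then show "T x \<in> Fil n"
      by (simp add: T) (rule eval_Fil[OF m], simp add: restr_linear trunc_trunc)
  qed
  then show ?thesis using T by blast
qed

lemma cl_morphism_exists:
  fixes g :: "'g::graded_generators \<Rightarrow> 'h::graded_generators cl"
  assumes g: "\<And>v. g v \<in> Hom (gdeg v)"
  shows "\<exists>T. cl_morphism T \<and> (\<forall>v. T (gen v) = g v)"
proof -
  define m where "m = rec_brword g (\<lambda>_ _. br)"
  have m_simps: "m (Gen v) = g v" "m (Br l r) = br (m l) (m r)" for v l r
    by (simp_all add: m_def)
  have m: "m t \<in> Fil (brlen t)" for t
    by (induction t) (auto simp: m_simps intro: br_Fil)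
  have hom: "m t \<in> Hom (brdeg gdeg t + 0)" for t
    by (induction t) (auto simp: m_simps g intro: br_Hom)
  obtain T where T: "cl_linear 0 T" "\<And>f. T (abs_cl f) = eval m f"
    using quotient_linear_map[OF m hom eval_morphism_null] m_simps g by metis
  have "T (br x y) = br (T x) (T y)" for x y
  proof -
    obtain f where [simp]: "x = abs_cl f" by (rule cl_abs_cases)
    obtain h where [simp]: "y = abs_cl h" by (rule cl_abs_cases)
    show ?thesis by (simp add: br.abs_eq T(2) eval_fbr[OF m m m m_simps(2)])
  qed
  moreover have "T (gen v) = g v" for v
    by (simp add: gen.abs_eq T(2) eval_delta[OF m] m_simps)
  ultimately show ?thesis using T(1) by (auto simp: cl_morphism_def)
qed

text \<open>
  The Leibniz rule prescribes the value \<open>m\<close> on words. A derivation sends a relation to a sum of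
  relations in which one entry has been differentiated, and these vanish; this is a matter of signs.
  The sign in the Leibniz rule is written with the map \<open>E\<close> that multiplies a word \<open>t\<close> by \<open>s t\<close>; it is
  multiplicative, hence it also kills null functions (\<open>E_null\<close>).
\<close>

lemma cl_derivation_exists:
  fixes g :: "'g::graded_generators \<Rightarrow> 'g cl"
  assumes g: "\<And>v. g v \<in> Hom (gdeg v + k)"
  shows "\<exists>D. cl_derivation k D \<and> (\<forall>v. D (gen v) = g v)"
proof -
  define s where "s t = parity_sign (k * brdeg gdeg t)" for t :: "'g brword"
  define m where "m = rec_brword g (\<lambda>l r x y. br x (word r) + s l *\<^sub>q br (word l) y)"
  have m_simps: "m (Gen v) = g v" "m (Br l r) = br (m l) (word r) + s l *\<^sub>q br (word l) (m r)" for v l r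
    by (simp_all add: m_def)
  have m: "m t \<in> Fil (brlen t)" for t
    by (induction t) (auto simp: m_simps intro!: Fil_closed(2,4) br_Fil word_Fil)
  have hom: "m t \<in> Hom (brdeg gdeg t + k)" for t
  proof (induction t)
    case (Br l r)
    have "br (m l) (word r) \<in> Hom (brdeg gdeg (Br l r) + k)"
      "br (word l) (m r) \<in> Hom (brdeg gdeg (Br l r) + k)"
      using br_Hom[OF Br(1) word_Hom[of r]] br_Hom[OF word_Hom[of l] Br(2)] by (simp_all add: algebra_simps)
    then show ?case by (auto simp: m_simps)
  qed (simp add: m_simps g)
  define E where "E f = abs_cl (\<lambda>t. s t * f t)" for f
  have sw: "s t *\<^sub>q word t \<in> Fil (brlen t)" for t using word_Fil[of t] by auto
  have E: "E f = eval (\<lambda>t. s t *\<^sub>q word t) f" for f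
    by (simp add: E_def abs_cl_eq_eval eval_def mult.commute)
  have E_null: "E f = 0" if "f \<in> null_fun" for f
    unfolding E
    by (rule eval_morphism_null[OF _ _ that])
      (auto simp: s_def br_linear distrib_left parity_sign_add mult.commute)
  have E_homog: "E f = parity_sign (k * p) *\<^sub>q abs_cl f" if "\<And>t. f t \<noteq> 0 \<Longrightarrow> brdeg gdeg t = p" for f p
  proof -
    have "(\<lambda>t. s t * f t) = fscale (parity_sign (k * p)) f"
      by (rule ext) (use that in \<open>auto simp: s_def fscale_def\<close>)
    then show ?thesis by (simp add: E_def scl.abs_eq)
  qed
  have fbr: "eval m (fbr f h) = br (eval m f) (abs_cl h) + br (E f) (eval m h)" for f h
  proof -
    \<comment> \<open>The two summands of the Leibniz rule are products of maps on words, to which \<open>eval_fbr\<close> applies.\<close>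
    define m1 where "m1 = case_brword (\<lambda>_. 0) (\<lambda>l r. br (m l) (word r))"
    define m2 where "m2 = case_brword (\<lambda>_. 0) (\<lambda>l r. br (s l *\<^sub>q word l) (m r))"
    have m1: "m1 t \<in> Fil (brlen t)" "m2 t \<in> Fil (brlen t)" for t
      by (cases t; auto simp: m1_def m2_def intro!: br_Fil m word_Fil sw)+
    have "eval m (fbr f h) = eval m1 (fbr f h) + eval m2 (fbr f h)"
    proof (rule eval_eqI[OF m])
      fix n
      have "fbr f h t *\<^sub>q m t = fbr f h t *\<^sub>q m1 t + fbr f h t *\<^sub>q m2 t" for t
        by (cases t) (simp_all add: m1_def m2_def m_simps br_linear cl.scale_right_distrib)
      then have "(\<Sum>t | brlen t < n. fbr f h t *\<^sub>q m t) =
        (\<Sum>t | brlen t < n. fbr f h t *\<^sub>q m1 t) + (\<Sum>t | brlen t < n. fbr f h t *\<^sub>q m2 t)"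
        by (simp add: sum.distrib)
      then show "eval m1 (fbr f h) + eval m2 (fbr f h) - (\<Sum>t | brlen t < n. fbr f h t *\<^sub>q m t) \<in> Fil n"
        using Fil_closed(2)[OF eval_approx[of m1, OF m1(1), of "fbr f h" n] eval_approx[of m2, OF m1(2), of "fbr f h" n]]
        by (simp add: algebra_simps)
    qed
    also have "eval m1 (fbr f h) = br (eval m f) (abs_cl h)"
      unfolding abs_cl_eq_eval by (rule eval_fbr[OF m1(1) m word_Fil]) (simp add: m1_def)
    also have "eval m2 (fbr f h) = br (E f) (eval m h)"
      unfolding E by (rule eval_fbr[OF m1(2) sw m]) (simp add: m2_def)
    finally show ?thesis .
  qed
  have fbr_homog: "eval m (fbr f h) = br (eval m f) (abs_cl h) + parity_sign (k * p) *\<^sub>q br (abs_cl f) (eval m h)"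
    if "\<And>t. f t \<noteq> 0 \<Longrightarrow> brdeg gdeg t = p" for f h p
    using fbr[of f h] E_homog[of f p] that by (simp add: br_linear)
  have homog: "eval m f \<in> Hom (p + k)" if "f \<in> homog gdeg p" for f p
    by (rule eval_Hom[OF m]) (use that hom in auto)
  note lin = eval_add[of m, OF m] eval_diff[of m, OF m] eval_fscale[of m, OF m] eval_0[of m, OF m]
  have ideal: "eval m f = 0" if "f \<in> free_ideal gdeg" for f
    using that
  proof (induction rule: free_ideal_induct)
    case (antisym p q x y)
    have xy: "\<And>t. x t \<noteq> 0 \<Longrightarrow> brdeg gdeg t = p" "\<And>t. y t \<noteq> 0 \<Longrightarrow> brdeg gdeg t = q"
      using antisym by auto
    have 1: "br (eval m x) (abs_cl y) = - (parity_sign ((p + k) * q) *\<^sub>q br (abs_cl y) (eval m x))"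
      by (rule br_antisym[OF homog[OF antisym(1)] abs_cl_homog[OF antisym(2)]])
    have 2: "br (abs_cl x) (eval m y) = - (parity_sign (p * (q + k)) *\<^sub>q br (eval m y) (abs_cl x))"
      by (rule br_antisym[OF abs_cl_homog[OF antisym(1)] homog[OF antisym(2)]])
    have 3: "eval m (fbr x y) = br (eval m x) (abs_cl y) + parity_sign (k * p) *\<^sub>q br (abs_cl x) (eval m y)"
      by (rule fbr_homog, erule xy)
    have 4: "eval m (fbr y x) = br (eval m y) (abs_cl x) + parity_sign (k * q) *\<^sub>q br (abs_cl y) (eval m x)"
      by (rule fbr_homog, erule xy)
    show ?case
      unfolding antisym_rel_def lin 3 4 1 2
      by (cases "even p"; cases "even q"; cases "even k") (simp_all add: parity_sign_if)
  next
    case (jacobi p q r x y z)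
    have xyz: "\<And>t. x t \<noteq> 0 \<Longrightarrow> brdeg gdeg t = p" "\<And>t. y t \<noteq> 0 \<Longrightarrow> brdeg gdeg t = q"
      using jacobi by auto
    have xy: "\<And>t. fbr x y t \<noteq> 0 \<Longrightarrow> brdeg gdeg t = p + q"
    proof -
      fix t show "fbr x y t \<noteq> 0 \<Longrightarrow> brdeg gdeg t = p + q"
        using xyz by (cases t) auto
    qed
    note X = homog[OF jacobi(1)] homog[OF jacobi(2)] homog[OF jacobi(3)]
    note x = abs_cl_homog[OF jacobi(1)] abs_cl_homog[OF jacobi(2)] abs_cl_homog[OF jacobi(3)]
    note J = br_jacobi[OF X(1) x(2,3)] br_jacobi[OF x(1) X(2) x(3)] br_jacobi[OF x(1,2) X(3)]
    have L: "eval m (fbr x h) = br (eval m x) (abs_cl h) + parity_sign (k * p) *\<^sub>q br (abs_cl x) (eval m h)"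
      "eval m (fbr y h) = br (eval m y) (abs_cl h) + parity_sign (k * q) *\<^sub>q br (abs_cl y) (eval m h)"
      "eval m (fbr (fbr x y) h) =
        br (eval m (fbr x y)) (abs_cl h) + parity_sign (k * (p + q)) *\<^sub>q br (abs_cl (fbr x y)) (eval m h)" for h
      by - (rule fbr_homog, erule xyz xy)+
    show ?case
      unfolding jacobi_rel_def lin L
        br.abs_eq[symmetric] br_linear J
      by (cases "even p"; cases "even q"; cases "even k")
        (simp_all add: parity_sign_if algebra_simps)
  next
    case (left f g)
    then show ?case by (simp add: fbr abs_cl_null free_ideal_null_fun br_linear)
  next
    case (right f g)
    then show ?case by (simp add: fbr E_null free_ideal_null_fun br_linear)
  qed (simp_all add: lin)
  obtain D where D: "cl_linear k D" "\<And>f. D (abs_cl f) = eval m f"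
    using quotient_linear_map[OF m hom eval_null[OF m ideal]] by metis
  have "D (br x y) = br (D x) y + parity_sign (k * p) *\<^sub>q br x (D y)" if "x \<in> Hom p" for x y p
  proof -
    obtain f0 where f0: "x = abs_cl f0" by (rule cl_abs_cases)
    obtain h where [simp]: "y = abs_cl h" by (rule cl_abs_cases)
    define f where "f = degree_part p f0"
    have [simp]: "x = abs_cl f"
      using that unfolding f0 f_def by (simp add: Hom_def proj.abs_eq)
    have "eval m (fbr f h) = br (eval m f) (abs_cl h) + parity_sign (k * p) *\<^sub>q br (abs_cl f) (eval m h)"
      by (rule fbr_homog) (simp add: f_def restr_def split: if_splits)
    then show ?thesis by (simp add: br.abs_eq D(2))
  qed
  moreover have "D (gen v) = g v" for v
    by (simp add: gen.abs_eq D(2) eval_delta[OF m] m_simps)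
  ultimately show ?thesis using D(1) by (auto simp: cl_derivation_def)
qed

section \<open>The type and the record of the completion\<close>

lift_definition emb :: "'g::graded_generators cl \<Rightarrow> 'g cfl"
  is "\<lambda>f n. quot_proj gdeg n (trunc n f)"
proof
  fix f g :: "'g brword \<Rightarrow> rat" and n
  assume "f - g \<in> null_fun"
  then have "trunc n (trunc n f - trunc n g) \<in> free_ideal gdeg"
    by (simp add: null_fun_def free_ideal_trunc flip: restr_linear)
  then show "quot_proj gdeg n (trunc n f) = quot_proj gdeg n (trunc n g)"
    by (subst presentsD(2)[OF presents_quot]) (simp_all add: lc_ideal_def)
qed

lemma quot_proj_trunc:
  "f \<in> finsupp \<Longrightarrow> quot_proj deg n (trunc n f) = quot_proj deg n f" for f :: "'g::finite brword \<Rightarrow> rat"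
  by (subst presentsD(2)[OF presents_quot])
    (simp_all add: lc_ideal_def restr_linear trunc_trunc free_ideal_zero)

lemma emb_eq_quot_proj_iff:
  assumes "f \<in> finsupp"
  shows "emb x n = quot_proj gdeg n f \<longleftrightarrow> x - abs_cl f \<in> Fil n"
proof -
  obtain h where h: "x = abs_cl h" by (rule cl_abs_cases)
  have "emb x n = quot_proj gdeg n f \<longleftrightarrow> trunc n h - f \<in> lc_ideal gdeg n"
    unfolding h emb.abs_eq by (rule presentsD(2)[OF presents_quot finsupp_trunc assms])
  also have "\<dots> \<longleftrightarrow> x - abs_cl f \<in> Fil n"
    using assms by (simp add: h minus_cl.abs_eq abs_cl_Fil_iff lc_ideal_def restr_linear trunc_trunc)
  finally show ?thesis .
qed

lemma emb_Fil_iff: "emb x n = emb y n \<longleftrightarrow> x - y \<in> Fil n"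
proof -
  obtain h where h: "y = abs_cl h" by (rule cl_abs_cases)
  have "abs_cl (trunc n h) = tr n y" by (simp add: h tr.abs_eq)
  then have "emb x n = emb y n \<longleftrightarrow> x - tr n y \<in> Fil n"
    using emb_eq_quot_proj_iff[of "trunc n h" x n] by (simp add: h emb.abs_eq)
  also have "\<dots> \<longleftrightarrow> x - y \<in> Fil n"
    by (simp add: Fil_def tr_linear tr_tr)
  finally show ?thesis .
qed

lemma emb_eq_iff [simp]: "emb x = emb y \<longleftrightarrow> x = y"
proof
  assume "emb x = emb y"
  then have "x - y \<in> Fil n" for n by (simp flip: emb_Fil_iff)
  from Fil_zero[OF this] show "x = y" by simp
qed simp

lemma inj_emb: "inj emb"
  by (rule injI) simp

text \<open>
  The structure of the record is carried by \<open>emb\<close>. This is a predicate on all extensions of the record,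
  because it is used for Lie algebras with and without a filtration and a differential.
\<close>

definition models :: "('g::graded_generators cfl, 'm) galg_scheme \<Rightarrow> bool" where
  "models L \<longleftrightarrow> gzero L = emb 0 \<and> (\<forall>x y. gadd L (emb x) (emb y) = emb (x + y)) \<and>
     (\<forall>c x. gscale L c (emb x) = emb (c *\<^sub>q x)) \<and> (\<forall>x y. gbr L (emb x) (emb y) = emb (br x y)) \<and>
     (\<forall>p. hcomp L p = emb ` Hom p)"

lemma modelsD:
  assumes "models L"
  shows "gzero L = emb 0" "gadd L (emb x) (emb y) = emb (x + y)" "gscale L c (emb x) = emb (c *\<^sub>q x)"
    "gbr L (emb x) (emb y) = emb (br x y)" "hcomp L p = emb ` Hom p"
    "emb x \<boxminus>\<^bsub>L\<^esub> emb y = emb (x - y)"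
proof -
  show "gzero L = emb 0" "gadd L (emb x) (emb y) = emb (x + y)" "gscale L c (emb x) = emb (c *\<^sub>q x)"
    "gbr L (emb x) (emb y) = emb (br x y)" "hcomp L p = emb ` Hom p" for x y c p
    using assms unfolding models_def by blast+
  then show "emb x \<boxminus>\<^bsub>L\<^esub> emb y = emb (x - y)"
    by (simp add: gsub_def)
qed

lemma emb_zero: "emb 0 n = quot_proj gdeg n 0"
  by (subst emb_eq_quot_proj_iff) (auto simp: zero_cl_def[symmetric])

lemma lim_transition:
  assumes f: "f \<in> finsupp"
  shows "(\<Union>x\<in>quot_proj deg (Suc n) f. coset (free_lie deg) (lower_central (free_lie deg) n) x) = quot_proj deg n f"
proof -
  let ?K = "lc_ideal deg (Suc n)"
  have K: "?K \<subseteq> finsupp" by (auto simp: lc_ideal_def)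
  have "quot_proj deg (Suc n) f = (\<lambda>k. free_proj deg (f + k)) ` ?K"
    using presents_coset[OF presents_free_lie K f]
    by (simp add: quot_proj_def lower_central_free_lie Setcompr_eq_image)
  moreover have "coset (free_lie deg) (lower_central (free_lie deg) n) (free_proj deg (f + k)) = quot_proj deg n f"
    if k: "k \<in> ?K" for k
  proof -
    have "quot_proj deg n (f + k) = quot_proj deg n f"
      by (subst presentsD(2)[OF presents_quot])
        (use f k K lc_ideal_mono[of n "Suc n" deg] in auto)
    then show ?thesis by (simp add: quot_proj_def)
  qed
  moreover have "?K \<noteq> {}" using word_idealD(2)[OF word_ideal_lc] by blast
  ultimately show ?thesis by (simp cong: SUP_cong)
qed

abbreviation clim :: "('g::graded_generators \<Rightarrow> int) \<Rightarrow> 'g cfl galg"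
  where "clim deg \<equiv> lim_galg (free_lie deg) (lower_central (free_lie deg))"

lemma hcomp_clim_iff:
  "s \<in> hcomp (clim deg) p \<longleftrightarrow>
    (\<forall>n. s n \<in> hcomp (quotient_galg (free_lie deg) (lower_central (free_lie deg) n)) p) \<and>
    (\<forall>n. s n = (\<Union>y\<in>s (Suc n). coset (free_lie deg) (lower_central (free_lie deg) n) y))"
  by (simp add: lim_galg_def)

text \<open>
  The operations are componentwise, so only the homogeneous components need an argument. A compatible
  sequence of classes of functions \<open>f n\<close> is a Cauchy sequence in the type, and its limit maps to it.
\<close>

lemma models_lim: "models (clim (gdeg :: 'g::graded_generators \<Rightarrow> int))"
proof -
  let ?Q = "\<lambda>n. quotient_galg (free_lie gdeg) (lower_central (free_lie (gdeg :: 'g \<Rightarrow> int)) n)"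
  note Q = presents_quot[of "gdeg :: 'g \<Rightarrow> int"]
  have "gadd (clim gdeg) (emb x) (emb y) = emb (x + y)" for x y :: "'g cl"
  proof (rule ext)
    fix n
    obtain f g where [simp]: "x = abs_cl f" "y = abs_cl g" by (meson cl_abs_cases)
    show "gadd (clim gdeg) (emb x) (emb y) n = emb (x + y) n"
      by (simp add: lim_galg_def emb.abs_eq plus_cl.abs_eq presentsD(3)[OF Q] restr_linear)
  qed
  moreover have "gscale (clim gdeg) c (emb x) = emb (c *\<^sub>q x)" for c and x :: "'g cl"
  proof (rule ext)
    fix n
    obtain f where [simp]: "x = abs_cl f" by (rule cl_abs_cases)
    show "gscale (clim gdeg) c (emb x) n = emb (c *\<^sub>q x) n"
      by (simp add: lim_galg_def emb.abs_eq scl.abs_eq presentsD(5)[OF Q] restr_linear)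
  qed
  moreover have "gbr (clim gdeg) (emb x) (emb y) = emb (br x y)" for x y :: "'g cl"
  proof (rule ext)
    fix n
    obtain f g where [simp]: "x = abs_cl f" "y = abs_cl g" by (meson cl_abs_cases)
    have "quot_proj gdeg n (fbr (trunc n f) (trunc n g)) = quot_proj gdeg n (trunc n (fbr (trunc n f) (trunc n g)))"
      by (simp add: quot_proj_trunc)
    then show "gbr (clim gdeg) (emb x) (emb y) n = emb (br x y) n"
      by (simp add: lim_galg_def emb.abs_eq br.abs_eq presentsD(4)[OF Q] trunc_fbr_left trunc_fbr_right')
  qed
  moreover have "gzero (clim gdeg) = (emb 0 :: 'g cfl)"
    by (rule ext) (simp add: lim_galg_def emb_zero presentsD(6)[OF Q])
  moreover have "hcomp (clim gdeg) p = emb ` (Hom p :: 'g cl set)" for p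
  proof
    show "emb ` Hom p \<subseteq> hcomp (clim (gdeg :: 'g \<Rightarrow> int)) p"
    proof clarify
      fix x :: "'g cl" assume x: "x \<in> Hom p"
      obtain f0 where f0: "x = abs_cl f0" by (rule cl_abs_cases)
      define f where "f = degree_part p f0"
      have f: "x = abs_cl f" using x unfolding f_def f0 by (simp add: Hom_def proj.abs_eq)
      have "emb x n \<in> hcomp (?Q n) p" for n
        unfolding presentsD(7)[OF Q] f emb.abs_eq using trunc_degree_part_homog[of n p f0] by (simp add: f_def)
      moreover have "emb x n = (\<Union>y\<in>emb x (Suc n). coset (free_lie gdeg) (lower_central (free_lie gdeg) n) y)" for n
      proof -
        have "emb x n = quot_proj gdeg n (trunc n (trunc (Suc n) f))"
          by (simp add: f emb.abs_eq trunc_trunc)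
        then show ?thesis by (simp add: f emb.abs_eq lim_transition quot_proj_trunc)
      qed
      ultimately show "emb x \<in> hcomp (clim gdeg) p" unfolding hcomp_clim_iff by blast
    qed
    show "hcomp (clim (gdeg :: 'g \<Rightarrow> int)) p \<subseteq> emb ` Hom p"
    proof
      fix s assume "s \<in> hcomp (clim (gdeg :: 'g \<Rightarrow> int)) p"
      note s' = hcomp_clim_iff[THEN iffD1, OF this]
      note s = s'[THEN conjunct1, THEN spec] s'[THEN conjunct2, THEN spec]
      have "\<exists>f. f \<in> homog gdeg p \<and> s n = quot_proj gdeg n f" for n
        using s(1)[of n] unfolding presentsD(7)[OF Q] by (elim imageE, intro exI conjI)
      then have "\<exists>f. \<forall>n. f n \<in> homog gdeg p \<and> s n = quot_proj gdeg n (f n)" by (intro choice allI)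
      then obtain f where f': "\<forall>n. f n \<in> homog gdeg p \<and> s n = quot_proj gdeg n (f n)" by (elim exE)
      note f = f'[THEN spec, THEN conjunct1] f'[THEN spec, THEN conjunct2]
      have fin: "f n \<in> finsupp" for n using f(1)[of n] by simp
      have "abs_cl (f (Suc n)) - abs_cl (f n) \<in> Fil n" for n
      proof -
        have "quot_proj gdeg n (f n) = quot_proj gdeg n (f (Suc n))"
          using s(2)[of n] unfolding f(2) lim_transition[OF fin] .
        then have "f n - f (Suc n) \<in> lc_ideal gdeg n"
          by (subst (asm) presentsD(2)[OF Q fin fin])
        then have "abs_cl (f n) - abs_cl (f (Suc n)) \<in> Fil n"
          by (simp add: minus_cl.abs_eq abs_cl_Fil_iff lc_ideal_def)
        from Fil_closed(5)[OF this] show ?thesis by simp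
      qed
      from limit_exists[OF this] obtain l where l: "\<And>n. l - abs_cl (f n) \<in> Fil n" by blast
      have "l \<in> Hom p" by (rule limit_Hom[OF l]) (rule abs_cl_homog[OF f(1)])
      moreover have "emb l = s"
        by (rule ext) (use emb_eq_quot_proj_iff[OF fin, of l] l f(2) in simp)
      ultimately show "s \<in> emb ` Hom p" by blast
    qed
  qed
  ultimately show ?thesis by (simp add: models_def)
qed

lemma Tot_superset:
  assumes x: "x = (\<Sum>p\<in>P. proj p x)" and P: "finite P" "finite P'" "P \<subseteq> P'"
  shows "x = (\<Sum>p\<in>P'. proj p x)"
proof -
  have "proj q x = 0" if "q \<notin> P" for q
  proof -
    have "proj q x = (\<Sum>p\<in>P. proj q (proj p x))" by (subst x) (rule proj_sum)
    also have "\<dots> = 0" using that by (intro sum.neutral) (auto simp: proj_proj)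
    finally show ?thesis .
  qed
  then have "(\<Sum>p\<in>P'. proj p x) = (\<Sum>p\<in>P. proj p x)"
    using P by (intro sum.mono_neutral_right) auto
  then show ?thesis using x by simp
qed

lemma Tot_closed [intro]:
  "x \<in> Tot \<Longrightarrow> y \<in> Tot \<Longrightarrow> x + y \<in> Tot" "x \<in> Tot \<Longrightarrow> c *\<^sub>q x \<in> Tot" "0 \<in> Tot" "x \<in> Hom p \<Longrightarrow> x \<in> Tot"
proof -
  show "x \<in> Tot \<Longrightarrow> y \<in> Tot \<Longrightarrow> x + y \<in> Tot"
  proof -
    assume "x \<in> Tot" "y \<in> Tot"
    then obtain P P' where P: "finite P" "x = (\<Sum>p\<in>P. proj p x)" and P': "finite P'" "y = (\<Sum>p\<in>P'. proj p y)"
      unfolding Tot_def by blast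
    have fin: "finite (P \<union> P')" using P(1) P'(1) by simp
    note eqs = Tot_superset[OF P(2,1) fin Un_upper1] Tot_superset[OF P'(2,1) fin Un_upper2]
    have "x + y = (\<Sum>p\<in>P \<union> P'. proj p x) + (\<Sum>p\<in>P \<union> P'. proj p y)"
      by (rule arg_cong2[OF eqs])
    also have "\<dots> = (\<Sum>p\<in>P \<union> P'. proj p (x + y))"
      by (simp add: proj_linear sum.distrib)
    finally show "x + y \<in> Tot" using P(1) P'(1) unfolding Tot_def by blast
  qed
  show "x \<in> Tot \<Longrightarrow> c *\<^sub>q x \<in> Tot"
  proof -
    assume "x \<in> Tot"
    then obtain P where P: "finite P" "x = (\<Sum>p\<in>P. proj p x)" unfolding Tot_def by blast
    have "c *\<^sub>q x = c *\<^sub>q (\<Sum>p\<in>P. proj p x)" by (rule arg_cong[OF P(2)])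
    also have "\<dots> = (\<Sum>p\<in>P. proj p (c *\<^sub>q x))" by (simp add: cl.scale_sum_right proj_linear)
    finally show "c *\<^sub>q x \<in> Tot" using P(1) unfolding Tot_def by blast
  qed
  show "0 \<in> Tot" unfolding Tot_def by (simp add: proj_linear) blast
  show "x \<in> Tot" if x: "x \<in> Hom p"
    unfolding Tot_def
  proof (intro CollectI exI conjI)
    show "x = (\<Sum>p\<in>{p}. proj p x)" using x by (simp add: Hom_def)
  qed simp
qed

lemma Tot_diff [intro]: "x \<in> Tot \<Longrightarrow> y \<in> Tot \<Longrightarrow> x - y \<in> Tot"
  using Tot_closed(1)[of x "(-1) *\<^sub>q y"] Tot_closed(2)[of y "-1"] by simp

lemma Tot_sum [intro]: "(\<And>i. i \<in> A \<Longrightarrow> f i \<in> Tot) \<Longrightarrow> sum f A \<in> Tot"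
  by (induction A rule: infinite_finite_induct) auto

lemma Tot_induct [consumes 1, case_names hom add]:
  assumes x: "x \<in> Tot" and hom: "\<And>p x. x \<in> Hom p \<Longrightarrow> Q x"
    and add: "\<And>x y. x \<in> Tot \<Longrightarrow> y \<in> Tot \<Longrightarrow> Q x \<Longrightarrow> Q y \<Longrightarrow> Q (x + y)"
  shows "Q x"
proof -
  obtain P where P: "finite P" "x = (\<Sum>p\<in>P. proj p x)" using x unfolding Tot_def by blast
  have "Q (\<Sum>p\<in>P. proj p x)" using P(1)
  proof (induction P)
    case empty
    show ?case using hom[of 0 0] by auto
  next
    case (insert q P)
    have "proj q x \<in> Hom q" ..
    then show ?case using insert hom by (auto intro!: add Tot_sum)
  qed
  then show ?thesis using P(2) by simp
qed

lemma br_Tot [intro]: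
  assumes "x \<in> Tot" "y \<in> Tot"
  shows "br x y \<in> Tot"
  using assms(1)
proof (induction rule: Tot_induct)
  case (hom p x)
  note x = hom
  show ?case using assms(2)
    by (induction rule: Tot_induct) (use x in \<open>auto simp: br_linear intro: br_Hom\<close>)
qed (auto simp: br_linear)

lemma models_gtotal:
  assumes L: "models L"
  shows "gtotal L = emb ` Tot"
proof
  note m = modelsD[OF L]
  show "gtotal L \<subseteq> emb ` Tot"
  proof
    fix s assume "s \<in> gtotal L"
    then show "s \<in> emb ` Tot"
      unfolding gtotal_def
    proof induction
      case zero then show ?case unfolding m(1) by auto
    next
      case (base x) then show ?case unfolding m(5) by auto
    next
      case (add x y) then show ?case by (auto simp: m(2))
    next
      case (scale x c) then show ?case by (auto simp: m(3))
    qed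
  qed
  have "emb x \<in> gtotal L" if "x \<in> Tot" for x
    using that
  proof (induction rule: Tot_induct)
    case (hom p x)
    then show ?case unfolding gtotal_def by (intro gspan.base) (auto simp: m(5))
  next
    case (add x y)
    then show ?case unfolding gtotal_def m(2)[symmetric] by (intro gspan.add)
  qed
  then show "emb ` Tot \<subseteq> gtotal L" by auto
qed

lemma models_gsum_list:
  assumes L: "models L"
  shows "gsum_list L (map (\<lambda>i. emb (z i)) ps) = emb (\<Sum>i\<leftarrow>ps. z i)"
  by (induction ps) (simp_all add: gsum_list_def modelsD[OF L])

lemma models_graded_vector_space:
  assumes L: "models L"
  shows "graded_vector_space L"
proof -
  note m = modelsD[OF L]
  note tot = models_gtotal[OF L]
  have span: "gspan L (emb ` Hom p) \<subseteq> emb ` Hom p" for p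
  proof
    fix s assume "s \<in> gspan L (emb ` Hom p)"
    then show "s \<in> emb ` Hom p"
      by induction (auto simp: m)
  qed
  have direct: "\<forall>p\<in>set ps. x p = gzero L"
    if "distinct ps" "\<forall>p\<in>set ps. x p \<in> hcomp L p" "gsum_list L (map x ps) = gzero L" for ps x
  proof -
    have "\<exists>z. \<forall>p\<in>set ps. z p \<in> Hom p \<and> x p = emb (z p)"
      using that(2) unfolding m(5) by (intro bchoice) blast
    then obtain z where z: "\<And>p. p \<in> set ps \<Longrightarrow> z p \<in> Hom p" "\<And>p. p \<in> set ps \<Longrightarrow> x p = emb (z p)"
      by blast
    have eq: "map x ps = map (\<lambda>p. emb (z p)) ps" using z(2) by simp
    have "emb (\<Sum>i\<leftarrow>ps. z i) = emb 0"
      using that(3) unfolding eq models_gsum_list[OF L] m(1) .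
    then have 0: "(\<Sum>p\<in>set ps. z p) = 0"
      using that(1) by (simp add: sum_list_distinct_conv_sum_set)
    have "z q = 0" if q: "q \<in> set ps" for q
    proof -
      have "proj q (z p) = (if p = q then z q else 0)" if "p \<in> set ps" for p
        using z(1)[OF that] z(1)[OF q] proj_proj[of q p "z p"] by (auto simp: Hom_def)
      then have "proj q (\<Sum>p\<in>set ps. z p) = z q"
        using q by (simp add: proj_sum cong: sum.cong)
      then show ?thesis by (simp add: 0 proj_linear)
    qed
    then show ?thesis using z(2) m(1) by simp
  qed
  show ?thesis
    unfolding graded_vector_space_def tot m(5) ball_simps(9)
    by (intro conjI allI ballI impI span)
      ((elim conjE, rule direct[unfolded m(5), THEN bspec]; assumption) |
        simp add: m algebra_simps cl.scale_left_distrib cl.scale_right_distrib)+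
qed

lemma models_graded_lie_algebra:
  assumes L: "models L"
  shows "graded_lie_algebra L"
proof -
  note m = modelsD[OF L]
  have anti: "br x y = (- parity_sign (p * q)) *\<^sub>q br y x" if "x \<in> Hom p" "y \<in> Hom q" for x y :: "'a cl" and p q
    using br_antisym[OF that] by simp
  show ?thesis
    unfolding graded_lie_algebra_def models_gtotal[OF L] m(5) ball_simps(9) m(2-4)
      inj_image_mem_iff[OF inj_emb] emb_eq_iff br_linear
    by (intro conjI allI ballI models_graded_vector_space[OF L] refl)
      (erule (1) br_Hom | erule (1) anti | erule (2) br_jacobi)+
qed

definition models_filt :: "('g::graded_generators cfl, 'm) fgalg_scheme \<Rightarrow> bool"
  where "models_filt L \<longleftrightarrow> models L \<and> (\<forall>n. filt L n = emb ` (Fil n \<inter> Tot))"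

lemma models_filtD:
  assumes "models_filt L"
  shows "models L" "filt L n = emb ` (Fil n \<inter> Tot)"
  using assms by (auto simp: models_filt_def)

lemma models_filt_cfree_lie: "models_filt (cfree_lie (gdeg :: 'g::graded_generators \<Rightarrow> int))"
proof -
  let ?C = "clim (gdeg :: 'g \<Rightarrow> int)"
  have "models (cfree_lie (gdeg :: 'g \<Rightarrow> int))"
    using models_lim[where 'g = 'g] by (simp add: models_def cfree_lie_def Let_def galg.defs fgalg.defs)
  moreover have "filt (cfree_lie (gdeg :: 'g \<Rightarrow> int)) n = emb ` (Fil n \<inter> Tot)" for n
  proof -
    have "filt (cfree_lie (gdeg :: 'g \<Rightarrow> int)) n = {s \<in> emb ` Tot. s n = gzero ?C n}"
      unfolding models_gtotal[OF models_lim, symmetric]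
      by (simp add: cfree_lie_def Let_def galg.defs fgalg.defs lim_galg_def)
    also have "\<dots> = emb ` {x \<in> Tot. emb x n = emb 0 n}"
      unfolding modelsD(1)[OF models_lim] by blast
    also have "{x \<in> Tot. emb x n = emb 0 n} = Fil n \<inter> (Tot :: 'g cl set)"
      by (simp add: emb_Fil_iff Collect_conj_eq Int_commute)
    finally show ?thesis .
  qed
  ultimately show ?thesis by (simp add: models_filt_def)
qed

lemma models_filt_cfree_dgl: "models_filt (cfree_dgl (gdeg :: 'g::graded_generators \<Rightarrow> int) d)"
  using models_filt_cfree_lie[where 'g = 'g]
  by (simp add: models_filt_def models_def cfree_dgl_def fgalg.defs dgl.defs)

lemma diff_cfree_dgl [simp]: "diff (cfree_dgl deg d) = d"
  by (simp add: cfree_dgl_def fgalg.defs dgl.defs)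

lemma cgen_eq_emb: "cgen gdeg v = emb (gen v)"
proof
  fix n
  have "cgen gdeg v n = quot_proj gdeg n (delta (Gen v))"
    by (simp add: cgen_def quot_proj_def free_gen_def free_proj_def delta_def)
  also have "\<dots> = emb (gen v) n"
    by (rule sym, rule iffD2[OF emb_eq_quot_proj_iff]) (auto simp: gen.abs_eq)
  finally show "cgen gdeg v n = emb (gen v) n" .
qed

section \<open>Completeness\<close>

text \<open>
  A compatible sequence of cosets has representatives that form a Cauchy sequence in the type; bijectivity
  is the existence and uniqueness of its limit.
\<close>

lemma models_complete:
  assumes L: "models_filt L"
  shows "bij_betw (\<lambda>s n. coset L (filt L n) s) (hcomp L p) (hcomp (lim_galg L (filt L)) p)"
proof -
  note m = modelsD[OF models_filtD(1)[OF L]]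
  note f = models_filtD(2)[OF L]
  have coset: "coset L (filt L n) (emb x) = emb ` {x + r | r. r \<in> Fil n \<inter> Tot}" for n x
    by (simp add: coset_def f Setcompr_eq_image image_image m(2)) blast
  have coset_eq: "coset L (filt L n) (emb x) = coset L (filt L n) (emb y) \<longleftrightarrow> x - y \<in> Fil n"
    if "x \<in> Tot" "y \<in> Tot" for n x y
  proof
    assume *: "coset L (filt L n) (emb x) = coset L (filt L n) (emb y)"
    have "emb x \<in> coset L (filt L n) (emb x)" unfolding coset by force
    then obtain r where "r \<in> Fil n" "x = y + r" unfolding * unfolding coset by auto
    then show "x - y \<in> Fil n" by simp
  next
    assume *: "x - y \<in> Fil n"
    have sub: "{x + r | r. r \<in> Fil n \<inter> Tot} \<subseteq> {y + r | r. r \<in> Fil n \<inter> Tot}"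
      if "x - y \<in> Fil n \<inter> Tot" for x y :: "'a cl"
    proof clarify
      fix r :: "'a cl" assume "r \<in> Fil n" "r \<in> Tot"
      then show "\<exists>r'. x + r = y + r' \<and> r' \<in> Fil n \<inter> Tot"
        using that by (intro exI[of _ "(x - y) + r"]) auto
    qed
    have "x - y \<in> Fil n \<inter> Tot" "y - x \<in> Fil n \<inter> Tot"
      using * Fil_closed(5)[OF *] that by auto
    then have "{x + r | r. r \<in> Fil n \<inter> Tot} = {y + r | r. r \<in> Fil n \<inter> Tot}"
      by (intro equalityI sub)
    then show "coset L (filt L n) (emb x) = coset L (filt L n) (emb y)" unfolding coset by simp
  qed
  have Hom_Tot: "x \<in> Tot" if "x \<in> Hom p" for x using that by auto
  have trans: "(\<Union>s\<in>coset L (filt L (Suc n)) (emb x). coset L (filt L n) s) = coset L (filt L n) (emb x)"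
    if "x \<in> Tot" for n x
  proof -
    have "coset L (filt L n) (emb (x + r)) = coset L (filt L n) (emb x)" if "r \<in> Fil (Suc n) \<inter> Tot" for r
      by (subst coset_eq) (use that \<open>x \<in> Tot\<close> Fil_mono[of n "Suc n" r] in auto)
    moreover have "0 \<in> Fil (Suc n) \<inter> Tot" by auto
    ultimately show ?thesis unfolding coset[of "Suc n"] by blast
  qed
  have lim: "s \<in> hcomp (lim_galg L (filt L)) p \<longleftrightarrow>
      (\<forall>n. s n \<in> coset L (filt L n) ` hcomp L p) \<and> (\<forall>n. s n = (\<Union>x\<in>s (Suc n). coset L (filt L n) x))" for s
    by (simp add: lim_galg_def quotient_galg_def)
  show ?thesis
  proof (rule bij_betw_imageI)
    show "inj_on (\<lambda>s n. coset L (filt L n) s) (hcomp L p)"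
    proof (rule inj_onI)
      fix s t assume "s \<in> hcomp L p" "t \<in> hcomp L p"
        and eq: "(\<lambda>n. coset L (filt L n) s) = (\<lambda>n. coset L (filt L n) t)"
      then obtain x y where xy: "s = emb x" "t = emb y" "x \<in> Hom p" "y \<in> Hom p" unfolding m(5) by auto
      have "x - y \<in> Fil n" for n
        using fun_cong[OF eq, of n] coset_eq[OF Hom_Tot Hom_Tot, OF xy(3,4)] xy(1,2) by simp
      from Fil_zero[OF this] show "s = t" using xy by simp
    qed
    show "(\<lambda>s n. coset L (filt L n) s) ` hcomp L p = hcomp (lim_galg L (filt L)) p"
    proof
      show "(\<lambda>s n. coset L (filt L n) s) ` hcomp L p \<subseteq> hcomp (lim_galg L (filt L)) p"
        unfolding m(5) using trans[OF Hom_Tot] by (auto simp: lim m(5))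
      show "hcomp (lim_galg L (filt L)) p \<subseteq> (\<lambda>s n. coset L (filt L n) s) ` hcomp L p"
      proof
        fix s assume "s \<in> hcomp (lim_galg L (filt L)) p"
        then have s: "\<And>n. s n \<in> coset L (filt L n) ` hcomp L p"
          "\<And>n. s n = (\<Union>x\<in>s (Suc n). coset L (filt L n) x)"
          unfolding lim by blast+
        have "\<exists>x. x \<in> Hom p \<and> s n = coset L (filt L n) (emb x)" for n
          using s(1)[of n] unfolding m(5) by blast
        then obtain x where x: "\<And>n. x n \<in> Hom p" "\<And>n. s n = coset L (filt L n) (emb (x n))" by metis
        have "x (Suc n) - x n \<in> Fil n" for n
        proof -
          have "coset L (filt L n) (emb (x n)) = coset L (filt L n) (emb (x (Suc n)))"
            using s(2)[of n] unfolding x(2) trans[OF Hom_Tot[OF x(1)]] .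
          then have "x n - x (Suc n) \<in> Fil n" using coset_eq[OF Hom_Tot Hom_Tot, OF x(1) x(1)] by simp
          from Fil_closed(5)[OF this] show ?thesis by simp
        qed
        from limit_exists[OF this] obtain l where l: "\<And>n. l - x n \<in> Fil n" by blast
        have "l \<in> Hom p" by (rule limit_Hom[OF l x(1)])
        moreover have "s = (\<lambda>n. coset L (filt L n) (emb l))"
        proof
          fix n
          have "coset L (filt L n) (emb l) = coset L (filt L n) (emb (x n))"
            using l[of n] coset_eq[OF Hom_Tot Hom_Tot, OF \<open>l \<in> Hom p\<close> x(1)] by blast
          then show "s n = coset L (filt L n) (emb l)" by (simp add: x(2))
        qed
        ultimately show "s \<in> (\<lambda>s n. coset L (filt L n) s) ` hcomp L p" unfolding m(5) by blast
      qed
    qed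
  qed
qed

section \<open>Maps between records\<close>

lemma cl_linear_Tot:
  assumes T: "cl_linear k T" and x: "x \<in> Tot"
  shows "T x \<in> Tot"
  using x by (induction rule: Tot_induct) (auto simp: cl_linearD(1)[OF T] dest: cl_linearD(3)[OF T])

lemma graded_linear_of_cl:
  assumes L: "models L" and M: "models M" and T: "cl_linear k T" and f: "\<And>x. x \<in> Tot \<Longrightarrow> f (emb x) = emb (T x)"
  shows "graded_linear L M k f"
  unfolding graded_linear_def models_gtotal[OF L] modelsD(5)[OF L] modelsD(5)[OF M]
  by (auto simp: modelsD(2,3)[OF L] modelsD(2,3)[OF M] f Tot_closed cl_linearD(1,2)[OF T] cl_linearD(3)[OF T])

lemma continuous_of_cl:
  assumes L: "models_filt L" and M: "models_filt M" and T: "cl_linear k T"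
    and f: "\<And>x. x \<in> Tot \<Longrightarrow> f (emb x) = emb (T x)"
  shows "continuous_linear L M f"
  unfolding continuous_linear_def models_filtD(2)[OF L] models_filtD(2)[OF M]
proof (intro allI exI)
  show "f ` (emb ` (Fil n \<inter> Tot) \<inter> hcomp L p) \<subseteq> emb ` (Fil n \<inter> Tot)" for n p
    by (auto simp: f cl_linearD(4)[OF T] cl_linear_Tot[OF T])
qed

lemma lie_morphism_of_cl:
  assumes L: "models L" and M: "models M" and T: "cl_morphism T" and f: "\<And>x. x \<in> Tot \<Longrightarrow> f (emb x) = emb (T x)"
  shows "lie_morphism L M f"
  unfolding lie_morphism_def
  using graded_linear_of_cl[OF L M cl_morphismD(1)[OF T] f]
  by (auto simp: models_gtotal[OF L] modelsD(4)[OF L] modelsD(4)[OF M] f br_Tot cl_morphismD(2)[OF T])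

lemma derivation_of_cl:
  assumes L: "models L" and T: "cl_derivation k T" and f: "\<And>x. x \<in> Tot \<Longrightarrow> f (emb x) = emb (T x)"
  shows "derivation L k f"
  unfolding derivation_def
  using graded_linear_of_cl[OF L L cl_derivationD(1)[OF T] f]
  by (auto simp: models_gtotal[OF L] modelsD(2,3,4,5)[OF L] f br_Tot Tot_closed(4) cl_derivationD(2)[OF T])

lemma word_Tot: "word t \<in> Tot"
  using word_Hom by (rule Tot_closed(4))

text \<open>
  A homogeneous element is a finite combination of words of its degree up to a remainder of the same
  degree in a small filtration step. Continuity of \<open>f\<close> is only assumed in each degree, so the degree of
  the remainder matters.
\<close>

lemma graded_linear_eq_on_words:
  fixes L :: "('g::graded_generators cfl, 'm) fgalg_scheme" and M :: "('h::graded_generators cfl, 'n) fgalg_scheme"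
  assumes L: "models_filt L" and M: "models_filt M" and T: "cl_linear k T"
    and f: "graded_linear L M k f" "continuous_linear L M f"
    and eq: "\<And>t. f (emb (word t)) = emb (T (word t))" and x: "x \<in> Tot"
  shows "f (emb x) = emb (T x)"
proof -
  note mL = modelsD[OF models_filtD(1)[OF L]] and mM = modelsD[OF models_filtD(1)[OF M]]
  note t = cl_linearD[OF T]
  have f_add: "f (emb (y + z)) = gadd M (f (emb y)) (f (emb z))" if "y \<in> Tot" "z \<in> Tot" for y z
    using f(1) that unfolding graded_linear_def models_gtotal[OF models_filtD(1)[OF L]] by (simp flip: mL(2))
  have scale: "f (emb (c *\<^sub>q y)) = gscale M c (f (emb y))" if "y \<in> Tot" for c y
    using f(1) that unfolding graded_linear_def models_gtotal[OF models_filtD(1)[OF L]] by (simp flip: mL(3))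
  have f_Hom: "\<exists>z. z \<in> Hom (p + k) \<and> f (emb y) = emb z" if "y \<in> Hom p" for y p
    using f(1) that unfolding graded_linear_def mL(5) mM(5) by blast
  have zero: "f (emb 0) = emb 0"
    using f_Hom[OF Hom_closed(1)[of 0]] scale[OF Tot_closed(3), of 0] by (auto simp: mM(3))
  have sum: "f (emb (\<Sum>t\<in>A. c t *\<^sub>q word t)) = emb (T (\<Sum>t\<in>A. c t *\<^sub>q word t))" if "finite A" for c A
    using that
  proof (induction A)
    case (insert t A)
    have "c t *\<^sub>q word t \<in> Tot" "(\<Sum>t\<in>A. c t *\<^sub>q word t) \<in> Tot" by (auto intro: word_Tot)
    then show ?case using insert by (simp add: f_add scale word_Tot eq t(1,2) mM(2,3))
  qed (simp add: zero t)
  show ?thesis using x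
  proof (induction rule: Tot_induct)
    case (hom p x)
    then obtain y where y: "f (emb x) = emb y" using f_Hom by metis
    have "y - T x \<in> Fil n" for n
    proof -
      obtain m where m: "f ` (filt L m \<inter> hcomp L p) \<subseteq> filt M n"
        using f(2) unfolding continuous_linear_def by blast
      define N where "N = max m n"
      obtain h where h: "x = abs_cl h" by (rule cl_abs_cases)
      define h' where "h' = degree_part p h"
      have x': "x = abs_cl h'" using hom unfolding h h'_def by (simp add: Hom_def proj.abs_eq)
      define z where "z = (\<Sum>t | brlen t < N. h' t *\<^sub>q word t)"
      define r where "r = x - z"
      have r: "r \<in> Fil N" unfolding r_def z_def x' abs_cl_eq_eval by (rule eval_approx[OF word_Fil])
      have z: "z \<in> Hom p" unfolding z_def
      proof (rule Hom_sum)
        show "h' t *\<^sub>q word t \<in> Hom p" for t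
          using word_Hom[of t] by (cases "brdeg gdeg t = p") (auto simp: h'_def restr_def)
      qed
      have rH: "r \<in> Hom p" unfolding r_def using z hom by auto
      have fz: "f (emb z) = emb (T z)" unfolding z_def by (rule sum[OF finite_brlen_less])
      have "f (emb r) \<in> filt M n"
        using m r rH Fil_mono[of m N r] unfolding models_filtD(2)[OF L] mL(5) N_def by auto
      then obtain r' where r': "f (emb r) = emb r'" "r' \<in> Fil n" unfolding models_filtD(2)[OF M] by auto
      have "f (emb x) = f (emb (z + r))" by (simp add: r_def)
      also have "\<dots> = emb (T z + r')"
        using z rH by (subst f_add) (auto simp: fz r' mM(2))
      finally have "y = T z + r'" using y by simp
      moreover have "T x = T z + T r" by (simp add: r_def t)
      moreover have "T r \<in> Fil n" using t(4)[OF r] Fil_mono[of n N] by (simp add: N_def)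
      ultimately show ?thesis using r'(2) by auto
    qed
    from Fil_zero[OF this] show ?case using y by simp
  next
    case (add x y)
    then show ?case by (simp add: f_add mM(2) t(1))
  qed
qed

section \<open>Double sums and power series in an adjoint action\<close>

text \<open>
  Modulo \<open>Fil n\<close> the left side is the sum over the square \<open>i, j < n\<close> and the right side is the sum over
  the triangle \<open>i + j < n\<close>; the terms in between lie in \<open>Fil n\<close>.
\<close>

lemma lsum_double:
  assumes w: "\<And>i j. w i j \<in> Fil (i + j)"
  shows "lsum (\<lambda>i. lsum (w i)) = lsum (\<lambda>n. \<Sum>i\<le>n. w i (n - i))"
proof (rule lsum_eqI[symmetric])
  show "(\<Sum>i\<le>n. w i (n - i)) \<in> Fil n" for n
    using w[of i "n - i" for i] by (intro Fil_sum) (metis atMost_iff le_add_diff_inverse)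
  fix n
  have wj: "w i j \<in> Fil j" and wi: "w i j \<in> Fil i" for i j
    using w[of i j] Fil_mono[of j "i + j"] Fil_mono[of i "i + j"] by auto
  have inner: "lsum (w i) \<in> Fil i" for i by (rule lsum_in_Fil[OF wj wi])
  have 1: "lsum (\<lambda>i. lsum (w i)) - (\<Sum>i<n. lsum (w i)) \<in> Fil n" by (rule lsum_Fil[OF inner])
  have 2: "(\<Sum>i<n. lsum (w i) - (\<Sum>j<n. w i j)) \<in> Fil n"
    by (intro Fil_sum lsum_Fil wj)
  define T where "T = {(i, j). i + j < n}"
  define Q where "Q = {..<n} \<times> {..<n}"
  have TQ: "T \<subseteq> Q" "finite Q" by (auto simp: T_def Q_def)
  have "(\<Sum>i<n. \<Sum>j<n. w i j) = (\<Sum>(i, j)\<in>Q. w i j)" by (simp add: sum.cartesian_product Q_def)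
  also have "\<dots> = (\<Sum>(i, j)\<in>Q - T. w i j) + (\<Sum>(i, j)\<in>T. w i j)"
    by (rule sum.subset_diff[OF TQ])
  also have "(\<Sum>(i, j)\<in>T. w i j) = (\<Sum>k<n. \<Sum>i\<le>k. w i (k - i))"
    unfolding T_def by (rule sum.triangle_reindex)
  finally have 3: "(\<Sum>i<n. \<Sum>j<n. w i j) - (\<Sum>k<n. \<Sum>i\<le>k. w i (k - i)) = (\<Sum>(i, j)\<in>Q - T. w i j)"
    by simp
  have "(\<Sum>(i, j)\<in>Q - T. w i j) \<in> Fil n"
  proof (rule Fil_sum)
    fix z assume "z \<in> Q - T"
    then obtain i j where z: "z = (i, j)" "n \<le> i + j" by (cases z) (auto simp: T_def)
    show "(case z of (i, j) \<Rightarrow> w i j) \<in> Fil n" using Fil_mono[OF z(2) w] by (simp add: z(1))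
  qed
  from Fil_closed(2)[OF Fil_closed(2)[OF 1 2] this]
  show "lsum (\<lambda>i. lsum (w i)) - (\<Sum>k<n. \<Sum>i\<le>k. w i (k - i)) \<in> Fil n"
    unfolding 3[symmetric] by (simp add: sum_subtractf)
qed

lemma br_lsum:
  assumes x: "\<And>n. x n \<in> Fil n" and y: "\<And>n. y n \<in> Fil n"
  shows "br (lsum x) (lsum y) = lsum (\<lambda>n. \<Sum>i\<le>n. br (x i) (y (n - i)))"
proof -
  have "br (lsum x) (lsum y) = lsum (\<lambda>i. br (x i) (lsum y))"
    by (rule lsum_map[of x "\<lambda>z. br z (lsum y)", OF x]) (auto simp: br_linear br_Fil_left)
  also have "\<dots> = lsum (\<lambda>i. lsum (\<lambda>j. br (x i) (y j)))"
    by (subst lsum_map[of y, OF y]) (auto simp: br_linear br_Fil_right)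
  also have "\<dots> = lsum (\<lambda>n. \<Sum>i\<le>n. br (x i) (y (n - i)))"
    by (rule lsum_double) (rule br_Fil[OF x y])
  finally show ?thesis .
qed

lemma lsum_shift:
  assumes z: "\<And>n. z n \<in> Fil n"
  shows "lsum z = z 0 + lsum (\<lambda>n. z (Suc n))"
proof (rule lsum_eqI[OF z])
  fix n
  have z': "z (Suc k) \<in> Fil k" for k using z[of "Suc k"] Fil_mono[of k "Suc k"] by auto
  have eq: "z 0 + lsum (\<lambda>n. z (Suc n)) - (\<Sum>k<n. z k) =
      (lsum (\<lambda>n. z (Suc n)) - (\<Sum>k<n. z (Suc k))) + z n"
    using sum.lessThan_Suc_shift[of z n] by (simp add: algebra_simps)
  show "z 0 + lsum (\<lambda>n. z (Suc n)) - (\<Sum>k<n. z k) \<in> Fil n"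
    unfolding eq by (rule Fil_closed(2)[OF lsum_Fil[OF z'] z])
qed

text \<open>
  The action of a formal power series in \<open>ad\<^sub>x\<close>. It converges for every \<open>x\<close>, because bracketing with
  \<open>x\<close> raises the filtration, and it is multiplicative in the series (\<open>ad_series_mult\<close>). Identities between
  series thus become identities in the Lie algebra.
\<close>

definition ad_series :: "rat fps \<Rightarrow> 'g::graded_generators cl \<Rightarrow> 'g cl \<Rightarrow> 'g cl"
  where "ad_series c x z = lsum (\<lambda>n. fps_nth c n *\<^sub>q (br x ^^ n) z)"

lemma ad_pow_linear:
  "(br x ^^ n) (y + z) = (br x ^^ n) y + (br x ^^ n) z" "(br x ^^ n) (c *\<^sub>q z) = c *\<^sub>q (br x ^^ n) z"
  by (induction n) (simp_all add: br_linear)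

lemma ad_pow_Fil: "z \<in> Fil m \<Longrightarrow> (br x ^^ n) z \<in> Fil (n + m)"
  by (induction n) (auto intro: br_Fil_Suc)

lemma ad_pow_Fil': "(br x ^^ n) z \<in> Fil n"
  using ad_pow_Fil[of z 0 n x] by auto

lemma ad_pow_Fil_mono: "z \<in> Fil m \<Longrightarrow> (br x ^^ n) z \<in> Fil m"
  using ad_pow_Fil[of z m n x] Fil_mono[of m "n + m"] by auto

lemma ad_pow_Hom: "x \<in> Hom 0 \<Longrightarrow> z \<in> Hom p \<Longrightarrow> (br x ^^ n) z \<in> Hom p"
  by (induction n) (use br_Hom[of x 0 _ p] in auto)

lemma ad_series_terms: "fps_nth c n *\<^sub>q (br x ^^ n) z \<in> Fil n"
  by (intro Fil_closed(4) ad_pow_Fil')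

lemma ad_series_Hom: "x \<in> Hom 0 \<Longrightarrow> z \<in> Hom p \<Longrightarrow> ad_series c x z \<in> Hom p"
  unfolding ad_series_def by (intro lsum_Hom ad_series_terms Hom_closed(4) ad_pow_Hom)

lemma ad_series_linear: "ad_series c x (y + z) = ad_series c x y + ad_series c x z" "ad_series c x (r *\<^sub>q z) = r *\<^sub>q ad_series c x z"
  unfolding ad_series_def
  by (subst lsum_add[symmetric] lsum_scl[symmetric];
      simp add: ad_series_terms ad_pow_linear cl.scale_right_distrib mult.commute)+

lemma ad_series_diff: "ad_series c x (y - z) = ad_series c x y - ad_series c x z"
  using ad_series_linear(1)[of c x "y - z" z] by simp

lemma ad_series_series_add: "ad_series (c + d) x z = ad_series c x z + ad_series d x z"
  unfolding ad_series_def by (subst lsum_add[symmetric]) (simp_all add: ad_series_terms cl.scale_left_distrib)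

lemma ad_series_series_diff: "ad_series (c - d) x z = ad_series c x z - ad_series d x z"
  using ad_series_series_add[of "c - d" d x z] by simp

lemma ad_series_1 [simp]: "ad_series 1 x z = z"
  unfolding ad_series_def
proof (rule lsum_eqI[OF ad_series_terms])
  fix n
  have "(\<Sum>k<n. fps_nth 1 k *\<^sub>q (br x ^^ k) z) = (\<Sum>k<n. if k = 0 then z else 0)"
    by (rule sum.cong) auto
  then show "z - (\<Sum>k<n. fps_nth 1 k *\<^sub>q (br x ^^ k) z) \<in> Fil n" by (auto simp: sum.delta)
qed

lemma ad_series_X: "ad_series fps_X x z = br x z"
  unfolding ad_series_def
proof (rule lsum_eqI[OF ad_series_terms])
  fix n
  have "(\<Sum>k<n. fps_nth fps_X k *\<^sub>q (br x ^^ k) z) = (\<Sum>k<n. if k = 1 then br x z else 0)"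
    by (rule sum.cong) auto
  moreover have "br x z \<in> Fil n" if "n \<le> 1"
    using that Fil_mono[OF _ br_Fil_Suc[of z 0 x], of n] by auto
  ultimately show "br x z - (\<Sum>k<n. fps_nth fps_X k *\<^sub>q (br x ^^ k) z) \<in> Fil n"
    by (auto simp: sum.delta not_less)
qed

lemma ad_series_mult: "ad_series (c * d) x z = ad_series c x (ad_series d x z)"
proof -
  have "ad_series c x (ad_series d x z) = lsum (\<lambda>i. lsum (\<lambda>j. fps_nth c i *\<^sub>q (br x ^^ i) (fps_nth d j *\<^sub>q (br x ^^ j) z)))"
    unfolding ad_series_def
    by (subst lsum_map[of _ "\<lambda>y. fps_nth c _ *\<^sub>q (br x ^^ _) y"])
      (auto simp: ad_series_terms ad_pow_linear cl.scale_right_distrib intro: ad_pow_Fil_mono)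
  also have "\<dots> = lsum (\<lambda>n. \<Sum>i\<le>n. fps_nth c i *\<^sub>q (br x ^^ i) (fps_nth d (n - i) *\<^sub>q (br x ^^ (n - i)) z))"
    by (rule lsum_double) (intro Fil_closed(4) ad_pow_Fil ad_pow_Fil')
  also have "\<dots> = ad_series (c * d) x z"
    unfolding ad_series_def
  proof (rule arg_cong[where f = lsum], rule ext)
    fix n
    have "fps_nth c i *\<^sub>q (br x ^^ i) (fps_nth d (n - i) *\<^sub>q (br x ^^ (n - i)) z) =
        (fps_nth c i * fps_nth d (n - i)) *\<^sub>q (br x ^^ n) z" if "i \<le> n" for i
      using that by (simp add: ad_pow_linear flip: funpow_add[unfolded o_def, THEN fun_cong] comp_apply[of "br x ^^ i"])
    then show "(\<Sum>i\<le>n. fps_nth c i *\<^sub>q (br x ^^ i) (fps_nth d (n - i) *\<^sub>q (br x ^^ (n - i)) z)) =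
        fps_nth (c * d) n *\<^sub>q (br x ^^ n) z"
      by (simp add: fps_mult_nth cl.scale_sum_left atLeast0AtMost)
  qed
  finally show ?thesis ..
qed

lemma ad_series_morphism:
  assumes T: "cl_morphism T"
  shows "T (ad_series c x z) = ad_series c (T x) (T z)"
proof -
  have "T ((br x ^^ n) z) = (br (T x) ^^ n) (T z)" for n
    by (induction n) (simp_all add: cl_morphismD(2)[OF T])
  then show ?thesis
    unfolding ad_series_def
    by (subst cl_linear_lsum[OF cl_morphismD(1)[OF T] ad_series_terms]) (simp add: cl_linearD(2)[OF cl_morphismD(1)[OF T]])
qed

section \<open>The Lawrence-Sullivan formula as an inversion of power series\<close>

definition bernoulli_series :: "rat fps"
  where "bernoulli_series = fps_X / (fps_exp 1 - 1)"

text \<open>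
The series of \<open>(1 - e\<^sup>-\<^sup>X) / X\<close>.
\<close>

definition phi_series :: "rat fps"
  where "phi_series = Abs_fps (\<lambda>n. (- 1) ^ n / fact (Suc n))"

text \<open>
  The two mutually inverse changes of coordinates: \<open>endpoint\<close> expresses the end point \<open>b = e\<^sup>\<theta> a\<close> of
  the interval by \<open>u\<close>, and \<open>LS_formula\<close> expresses \<open>u = d x\<close> by \<open>b\<close>.
\<close>

definition LS_formula :: "'g::graded_generators cl \<Rightarrow> 'g cl \<Rightarrow> 'g cl \<Rightarrow> 'g cl"
  where "LS_formula x b a = br x b + ad_series bernoulli_series x (b - a)"

definition endpoint :: "'g::graded_generators cl \<Rightarrow> 'g cl \<Rightarrow> 'g cl \<Rightarrow> 'g cl"
  where "endpoint x a u = ad_series (fps_exp (- 1)) x a + ad_series phi_series x u"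

lemma bernoulli_series_mult: "bernoulli_series * (fps_exp 1 - 1) = fps_X"
proof -
  have nz: "fps_nth (fps_exp 1 - 1 :: rat fps) 1 \<noteq> 0" by simp
  then have "subdegree (fps_exp 1 - 1 :: rat fps) \<le> subdegree (fps_X :: rat fps)"
    by (auto intro: subdegree_leI)
  moreover have "(fps_exp 1 - 1 :: rat fps) \<noteq> 0" using nz by (metis fps_zero_nth)
  ultimately have "(fps_exp 1 - 1 :: rat fps) dvd fps_X"
    by (simp add: fps_dvd_iff)
  then show ?thesis by (simp add: bernoulli_series_def)
qed

lemma phi_series_mult: "phi_series * fps_X = 1 - fps_exp (- 1)"
proof (rule fps_ext)
  show "fps_nth (phi_series * fps_X) n = fps_nth (1 - fps_exp (- 1)) n" for n
    by (cases n) (simp_all add: phi_series_def del: fact_Suc)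
qed

lemma exp_cancel: "fps_exp 1 * fps_exp (- 1) = (1 :: rat fps)"
  by (simp flip: fps_exp_add_mult)

lemma fps_X_plus_bernoulli: "fps_X + bernoulli_series = bernoulli_series * fps_exp 1"
  using bernoulli_series_mult by (simp add: algebra_simps)

lemma series_inverse: "bernoulli_series * fps_exp 1 * phi_series = 1"
proof -
  have "(bernoulli_series * fps_exp 1 * phi_series) * fps_X =
      bernoulli_series * (fps_exp 1 - fps_exp 1 * fps_exp (- 1))"
    unfolding mult.assoc phi_series_mult by (simp add: algebra_simps)
  also have "\<dots> = 1 * fps_X" by (simp add: exp_cancel bernoulli_series_mult)
  finally show ?thesis using mult_right_cancel[of "fps_X :: rat fps"] by simp
qed

lemma LS_formula_eq: "LS_formula x b a = ad_series (bernoulli_series * fps_exp 1) x b - ad_series bernoulli_series x a"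
  unfolding LS_formula_def fps_X_plus_bernoulli[symmetric] by (simp add: ad_series_diff ad_series_series_add ad_series_X)

lemma LS_formula_endpoint: "LS_formula x (endpoint x a u) a = u"
proof -
  have "ad_series (bernoulli_series * fps_exp 1) x (endpoint x a u) =
      ad_series (bernoulli_series * (fps_exp 1 * fps_exp (- 1))) x a + ad_series (bernoulli_series * fps_exp 1 * phi_series) x u"
    unfolding endpoint_def ad_series_linear ad_series_mult[symmetric] by (simp add: mult.assoc)
  then show ?thesis by (simp add: LS_formula_eq exp_cancel series_inverse)
qed

lemma endpoint_LS_formula: "endpoint x a (LS_formula x b a) = b"
proof -
  have 1: "phi_series * (bernoulli_series * fps_exp 1) = 1"
    using series_inverse by (simp add: ac_simps)
  have "phi_series * bernoulli_series = phi_series * (bernoulli_series * fps_exp 1) * fps_exp (- 1)"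
    by (simp add: mult.assoc exp_cancel)
  then have 2: "phi_series * bernoulli_series = fps_exp (- 1)" by (simp only: 1 mult_1)
  show ?thesis
    unfolding endpoint_def LS_formula_eq ad_series_diff ad_series_mult[symmetric] 1 2 by simp
qed

lemma LS_formula_morphism:
  assumes T: "cl_morphism T"
  shows "T (LS_formula x b a) = LS_formula (T x) (T b) (T a)"
  by (simp add: LS_formula_def ad_series_morphism[OF T] cl_morphismD(2)[OF T] cl_linearD(1,6)[OF cl_morphismD(1)[OF T]])

lemma endpoint_morphism:
  assumes T: "cl_morphism T"
  shows "T (endpoint x a u) = endpoint (T x) (T a) (T u)"
  by (simp add: endpoint_def ad_series_morphism[OF T] cl_linearD(1)[OF cl_morphismD(1)[OF T]])

lemma LS_formula_Hom: "x \<in> Hom 0 \<Longrightarrow> a \<in> Hom p \<Longrightarrow> b \<in> Hom p \<Longrightarrow> LS_formula x b a \<in> Hom p"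
  unfolding LS_formula_def using br_Hom[of x 0 b p] by (auto intro: ad_series_Hom)

lemma endpoint_Hom: "x \<in> Hom 0 \<Longrightarrow> a \<in> Hom p \<Longrightarrow> u \<in> Hom p \<Longrightarrow> endpoint x a u \<in> Hom p"
  unfolding endpoint_def by (auto intro: ad_series_Hom)

section \<open>Composites of derivations\<close>

lemma cl_linear_compose:
  assumes "cl_linear k S" "cl_linear l T"
  shows "cl_linear (k + l) (\<lambda>x. S (T x))"
proof -
  have "S (T x) \<in> Hom (p + (k + l))" if "x \<in> Hom p" for x p
    using cl_linearD(3)[OF assms(1) cl_linearD(3)[OF assms(2) that]] by (simp add: algebra_simps)
  then show ?thesis
    unfolding cl_linear_def using cl_linearD[OF assms(1)] cl_linearD[OF assms(2)] by auto
qed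

lemma cl_linear_add:
  assumes S: "cl_linear k S" and T: "cl_linear k T"
  shows "cl_linear k (\<lambda>x. S x + T x)"
  unfolding cl_linear_def
  using cl_linearD(3,4)[OF S] cl_linearD(3,4)[OF T]
  by (auto simp: cl_linearD(1,2)[OF S] cl_linearD(1,2)[OF T] cl.scale_right_distrib)

lemma cl_derivation_zero: "cl_derivation k (\<lambda>x. 0)"
  by (auto simp: cl_derivation_def cl_linear_def br_linear)

text \<open>
  For odd \<open>D\<close> the cross terms \<open>[D x, D y]\<close> occur with opposite signs and cancel. Together with uniqueness
  of derivations, this reduces \<open>D\<^sup>2 = 0\<close> to the generators. The same cancellation makes an
  anticommutator of odd derivations a derivation.
\<close>

lemma cl_derivation_square:
  assumes D: "cl_derivation (- 1) D"
  shows "cl_derivation (- 2) (\<lambda>x. D (D x))"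
proof -
  note l = cl_derivationD(1)[OF D]
  have "D (D (br x y)) = br (D (D x)) y + parity_sign (- 2 * p) *\<^sub>q br x (D (D y))" if x: "x \<in> Hom p" for x y p
    using cl_derivationD(2)[OF D x] cl_derivationD(2)[OF D cl_linearD(3)[OF l x]]
    by (cases "even p") (simp_all add: cl_linearD(1,2,6,7)[OF l] parity_sign_if)
  then show ?thesis
    using cl_linear_compose[OF l l] by (simp add: cl_derivation_def)
qed

lemma cl_derivation_anticommutator:
  assumes D: "cl_derivation (- 1) D" and I: "cl_derivation 1 I"
  shows "cl_derivation 0 (\<lambda>x. I (D x) + D (I x))"
proof -
  note d = cl_derivationD(1)[OF D] and i = cl_derivationD(1)[OF I]
  have "I (D (br x y)) + D (I (br x y)) = br (I (D x) + D (I x)) y + br x (I (D y) + D (I y))"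
    if x: "x \<in> Hom p" for x y p
    using cl_derivationD(2)[OF D x] cl_derivationD(2)[OF I cl_linearD(3)[OF d x]]
      cl_derivationD(2)[OF I x] cl_derivationD(2)[OF D cl_linearD(3)[OF i x]]
    by (cases "even p")
      (simp_all add: cl_linearD(1,2,6,7)[OF d] cl_linearD(1,2,6,7)[OF i] parity_sign_if br_linear)
  then show ?thesis
    using cl_linear_add[of 0, OF cl_linear_compose[OF i d, simplified] cl_linear_compose[OF d i, simplified]]
    by (simp add: cl_derivation_def)
qed

lemma cl_morphism_compose:
  assumes "cl_morphism S" "cl_morphism T"
  shows "cl_morphism (\<lambda>x. S (T x))"
  using cl_linear_compose[OF assms[THEN cl_morphismD(1)]] assms
  by (simp add: cl_morphism_def)

lemma cl_morphism_id: "cl_morphism (\<lambda>x. x)"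
  by (simp add: cl_morphism_def cl_linear_def)

lemma cl_derivation_conjugate:
  assumes S: "cl_morphism S" and T: "cl_morphism T" and D: "cl_derivation k D" and inv: "\<And>x. S (T x) = x"
  shows "cl_derivation k (\<lambda>x. S (D (T x)))"
proof -
  have "cl_linear k (\<lambda>x. S (D (T x)))"
    using cl_linear_compose[OF cl_morphismD(1)[OF S] cl_linear_compose[OF cl_derivationD(1)[OF D] cl_morphismD(1)[OF T]]]
    by simp
  moreover have "S (D (T (br x y))) = br (S (D (T x))) y + parity_sign (k * p) *\<^sub>q br x (S (D (T y)))"
    if "x \<in> Hom p" for x y p
  proof -
    have "T x \<in> Hom p" using cl_linearD(3)[OF cl_morphismD(1)[OF T] that] by simp
    from cl_derivationD(2)[OF D this] show ?thesis
      by (simp add: cl_morphismD(2)[OF S] cl_morphismD(2)[OF T] inv cl_linearD(1,2)[OF cl_morphismD(1)[OF S]])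
  qed
  ultimately show ?thesis by (simp add: cl_derivation_def)
qed

abbreviation mc :: "'g::graded_generators cl \<Rightarrow> 'g cl"
  where "mc a \<equiv> (- 1 / 2) *\<^sub>q br a a"

text \<open>
  The Jacobi identity for three equal entries of odd degree says that three times the triple bracket is zero.
\<close>

lemma br_self_self:
  assumes a: "a \<in> Hom (- 1)"
  shows "br a (br a a) = 0" "br (br a a) a = 0"
proof -
  have aa: "br a a \<in> Hom (- 2)" using br_Hom[OF a a] by simp
  have 1: "br (br a a) a = - br a (br a a)"
    using br_antisym[OF aa a] by (simp add: parity_sign_if)
  have "br a (br a a) = br (br a a) a - br a (br a a)"
    using br_jacobi[OF a a a] by (simp add: parity_sign_if)
  then have "br a (br a a) = - (br a (br a a) + br a (br a a))"
    unfolding 1 by simp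
  then have "br a (br a a) + (br a (br a a) + br a (br a a)) = 0"
    by (rule iffD1[OF eq_neg_iff_add_eq_0])
  then have "(1 + (1 + 1)) *\<^sub>q br a (br a a) = 0"
    by (simp only: cl.scale_left_distrib cl.scale_one)
  then show "br a (br a a) = 0" by simp
  then show "br (br a a) a = 0" using 1 by simp
qed

lemma mc_square_zero:
  assumes D: "cl_derivation (- 1) D" and a: "a \<in> Hom (- 1)" and Da: "D a = mc a"
  shows "D (D a) = 0"
  using cl_derivationD(2)[OF D a, of a]
  by (simp add: Da cl_linearD(2,7)[OF cl_derivationD(1)[OF D]] br_linear br_uminus br_self_self[OF a])

section \<open>The exponential of a derivation\<close>

definition cexp :: "('g::graded_generators cl \<Rightarrow> 'g cl) \<Rightarrow> 'g cl \<Rightarrow> 'g cl"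
  where "cexp T x = lsum (\<lambda>n. (1 / fact n) *\<^sub>q (T ^^ n) x)"

text \<open>
  As \<open>D\<close> commutes with \<open>T\<close>, it suffices that the exponential of a derivation of degree \<open>0\<close> is
  multiplicative on \<open>[a, a]\<close>. With the divided powers \<open>e n = T\<^sup>n a / n!\<close>, the Leibniz rule says that
  \<open>T\<^sup>n [a, a] / n!\<close> is the sum of the \<open>[e i, e (n - i)]\<close>, and the Cauchy product \<open>br_lsum\<close> collects these.
\<close>

lemma cexp_mc:
  assumes D: "cl_derivation (- 1) D" and T: "cl_derivation 0 T" and comm: "\<And>x. D (T x) = T (D x)"
    and a: "a \<in> Hom (- 1)" and Da: "D a = mc a" and fil: "\<And>n. (T ^^ n) a \<in> Fil n"
  shows "D (cexp T a) = mc (cexp T a)"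
proof -
  note d = cl_linearD[OF cl_derivationD(1)[OF D]] and t = cl_linearD[OF cl_derivationD(1)[OF T]]
  define e where "e n = (1 / fact n) *\<^sub>q (T ^^ n) a" for n
  have e: "e n \<in> Fil n" for n unfolding e_def using fil by auto
  have Tn: "(T ^^ n) a \<in> Hom (- 1)" for n
    by (induction n) (use a t(3) in force)+
  have e_Hom: "e n \<in> Hom (- 1)" for n unfolding e_def using Tn by auto
  have Te: "T (e n) = of_nat (Suc n) *\<^sub>q e (Suc n)" for n
    by (simp add: e_def t(2) del: of_nat_Suc)
  have leibniz: "(1 / fact n) *\<^sub>q (T ^^ n) (br a a) = (\<Sum>i\<le>n. br (e i) (e (n - i)))" for n
  proof (induction n)
    case 0
    show ?case by (simp add: e_def)
  next
    case (Suc n)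
    have "of_nat (Suc n) *\<^sub>q ((1 / fact (Suc n)) *\<^sub>q (T ^^ Suc n) (br a a)) =
        T ((1 / fact n) *\<^sub>q (T ^^ n) (br a a))"
      by (simp add: t(2) del: of_nat_Suc)
    also have "\<dots> = (\<Sum>i\<le>n. T (br (e i) (e (n - i))))" by (simp only: Suc t(8))
    also have "\<dots> = (\<Sum>i\<le>n. of_nat (Suc i) *\<^sub>q br (e (Suc i)) (e (n - i))) +
        (\<Sum>i\<le>n. of_nat (Suc (n - i)) *\<^sub>q br (e i) (e (Suc (n - i))))"
      by (simp add: cl_derivationD(2)[OF T e_Hom] Te br_linear sum.distrib del: of_nat_Suc)
    also have "(\<Sum>i\<le>n. of_nat (Suc i) *\<^sub>q br (e (Suc i)) (e (n - i))) =
        (\<Sum>i\<le>Suc n. of_nat i *\<^sub>q br (e i) (e (Suc n - i)))"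
      unfolding sum.atMost_Suc_shift by simp
    also have "(\<Sum>i\<le>n. of_nat (Suc (n - i)) *\<^sub>q br (e i) (e (Suc (n - i)))) =
        (\<Sum>i\<le>n. of_nat (Suc n - i) *\<^sub>q br (e i) (e (Suc n - i)))"
      by (rule sum.cong) (simp_all only: atMost_iff Suc_diff_le)
    also have "\<dots> = (\<Sum>i\<le>Suc n. of_nat (Suc n - i) *\<^sub>q br (e i) (e (Suc n - i)))"
      by simp
    also have "(\<Sum>i\<le>Suc n. of_nat i *\<^sub>q br (e i) (e (Suc n - i))) +
        (\<Sum>i\<le>Suc n. of_nat (Suc n - i) *\<^sub>q br (e i) (e (Suc n - i))) =
        (\<Sum>i\<le>Suc n. of_nat (Suc n) *\<^sub>q br (e i) (e (Suc n - i)))"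
      unfolding sum.distrib[symmetric]
      by (rule sum.cong) (auto simp del: of_nat_Suc simp flip: cl.scale_left_distrib of_nat_add)
    finally have "of_nat (Suc n) *\<^sub>q ((1 / fact (Suc n)) *\<^sub>q (T ^^ Suc n) (br a a)) =
        of_nat (Suc n) *\<^sub>q (\<Sum>i\<le>Suc n. br (e i) (e (Suc n - i)))"
      by (simp only: cl.scale_sum_right)
    then show ?case by (simp only: cl.scale_cancel_left of_nat_eq_0_iff) simp
  qed
  have DT: "D ((T ^^ n) x) = (T ^^ n) (D x)" for n x
    by (induction n) (simp_all add: comm)
  have Tscale: "(T ^^ n) (c *\<^sub>q x) = c *\<^sub>q (T ^^ n) x" for n c x
    by (induction n) (simp_all add: t(2))
  have De: "D (e n) = (- 1 / 2) *\<^sub>q (\<Sum>i\<le>n. br (e i) (e (n - i)))" for n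
  proof -
    have "D (e n) = (1 / fact n) *\<^sub>q (T ^^ n) (mc a)" by (simp only: e_def d(2) DT Da)
    also have "\<dots> = (- 1 / 2) *\<^sub>q ((1 / fact n) *\<^sub>q (T ^^ n) (br a a))"
      by (simp only: Tscale cl.scale_scale mult.commute)
    finally show ?thesis by (simp only: leibniz)
  qed
  have fil2: "(\<Sum>i\<le>n. br (e i) (e (n - i))) \<in> Fil n" for n
    using br_Fil[OF e e] by (intro Fil_sum) (metis atMost_iff le_add_diff_inverse)
  have "D (lsum e) = lsum (\<lambda>n. D (e n))"
    by (rule cl_linear_lsum[OF cl_derivationD(1)[OF D] e])
  also have "\<dots> = (- 1 / 2) *\<^sub>q lsum (\<lambda>n. \<Sum>i\<le>n. br (e i) (e (n - i)))"
    unfolding De by (rule lsum_scl[OF fil2])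
  also have "lsum (\<lambda>n. \<Sum>i\<le>n. br (e i) (e (n - i))) = br (lsum e) (lsum e)"
    by (rule br_lsum[OF e e, symmetric])
  finally show ?thesis by (simp add: cexp_def e_def[abs_def])
qed

text \<open>
  Since \<open>T x = 0\<close>, \<open>T\<close> commutes with \<open>ad\<^sub>x\<close>. Since \<open>T u = 0\<close>, it acts on \<open>u - [x, a]\<close> as
  \<open>- ad\<^sub>x\<close>.
\<close>

lemma derivation_funpow:
  assumes T: "cl_derivation 0 T" and x: "x \<in> Hom 0" "T x = 0" and u: "T u = 0" and a: "T a = u - br x a"
  shows "(T ^^ Suc n) a = (- 1) ^ n *\<^sub>q (br x ^^ n) (u - br x a)"
proof -
  note t = cl_linearD[OF cl_derivationD(1)[OF T]]
  have Tbr: "T (br x y) = br x (T y)" for y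
    using cl_derivationD(2)[OF T x(1), of y] by (simp add: x(2) br_linear)
  have 1: "T (u - br x a) = - br x (u - br x a)"
    by (simp add: t Tbr u a br_linear)
  have 2: "T ((br x ^^ n) y) = (br x ^^ n) (T y)" for n y
    by (induction n) (simp_all add: Tbr)
  show ?thesis
  proof (induction n)
    case (Suc n)
    have "(T ^^ Suc (Suc n)) a = T ((- 1) ^ n *\<^sub>q (br x ^^ n) (u - br x a))"
      using Suc by simp
    also have "\<dots> = (- 1) ^ n *\<^sub>q (br x ^^ n) (- 1 *\<^sub>q br x (u - br x a))"
      by (simp add: t(2) 2 1)
    also have "\<dots> = (- 1) ^ Suc n *\<^sub>q (br x ^^ Suc n) (u - br x a)"
      unfolding ad_pow_linear funpow_Suc_right by simp
    finally show ?case .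
  qed (simp add: a)
qed

lemma cexp_eq_endpoint:
  assumes T: "cl_derivation 0 T" and x: "x \<in> Hom 0" "T x = 0" and u: "T u = 0" and a: "T a = u - br x a"
  shows "(T ^^ n) a \<in> Fil n" "cexp T a = endpoint x a u"
proof -
  note pow = derivation_funpow[OF assms]
  let ?w = "u - br x a"
  show fil: "(T ^^ n) a \<in> Fil n" for n
  proof (cases n)
    case (Suc m)
    have "?w \<in> Fil 1" by auto
    then have "(br x ^^ m) ?w \<in> Fil (m + 1)" by (rule ad_pow_Fil)
    then show ?thesis unfolding Suc pow by auto
  qed auto
  have "cexp T a = a + lsum (\<lambda>n. (1 / fact (Suc n)) *\<^sub>q (T ^^ Suc n) a)"
    unfolding cexp_def by (subst lsum_shift) (use fil in auto)
  also have "lsum (\<lambda>n. (1 / fact (Suc n)) *\<^sub>q (T ^^ Suc n) a) = ad_series phi_series x ?w"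
    unfolding pow ad_series_def by (simp add: phi_series_def)
  also have "\<dots> = ad_series phi_series x u - ad_series (phi_series * fps_X) x a"
    by (simp add: ad_series_diff ad_series_mult ad_series_X)
  also have "a + \<dots> = endpoint x a u"
    unfolding phi_series_mult endpoint_def by (simp add: ad_series_series_diff)
  finally show "cexp T a = endpoint x a u" .
qed

section \<open>Identification of the extensions from generators\<close>

lemma cfree_word_values:
  fixes f :: "'g::graded_generators cfl \<Rightarrow> 'h::graded_generators cfl" and M :: "('h cfl, 'n) fgalg_scheme"
  assumes M: "models M" and T: "cl_morphism T"
    and f: "lie_morphism (cfree_lie gdeg) M f" and gen: "\<And>v. f (emb (gen v)) = emb (T (gen v))"
  shows "f (emb (word t)) = emb (T (word t))"
proof (induction t)
  case (Br l r)
  have "f (gbr (cfree_lie gdeg) (emb (word l)) (emb (word r))) = gbr M (f (emb (word l))) (f (emb (word r)))"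
    using f word_Tot unfolding lie_morphism_def models_gtotal[OF models_filtD(1)[OF models_filt_cfree_lie]] by blast
  then show ?case
    using Br by (simp add: modelsD(4)[OF M] modelsD(4)[OF models_filtD(1)[OF models_filt_cfree_lie]] cl_morphismD(2)[OF T])
qed (simp add: gen)

text \<open>
  The choice in the definition has a solution, namely \<open>T\<close> transported by \<open>emb\<close>; any solution agrees with
  \<open>T\<close> on words and hence everywhere.
\<close>

lemma extend_morphism_eq:
  fixes g :: "'g::graded_generators \<Rightarrow> 'h::graded_generators cfl" and M :: "('h cfl, 'n) fgalg_scheme"
  assumes M: "models_filt M" and T: "cl_morphism T" and g: "\<And>v. g v = emb (T (gen v))" and x: "x \<in> Tot"
  shows "extend_morphism gdeg M g (emb x) = emb (T x)"
proof -
  note C = models_filt_cfree_lie[where 'g = 'g]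
  note M' = models_filtD(1)[OF M] and C' = models_filtD(1)[OF C]
  let ?P = "\<lambda>f. lie_morphism (cfree_lie gdeg) M f \<and> continuous_linear (cfree_lie gdeg) M f \<and>
        (\<forall>v. f (cgen gdeg v) = g v)"
  have "?P (\<lambda>s. emb (T (inv emb s)))"
    using lie_morphism_of_cl[OF C' M' T, of "\<lambda>s. emb (T (inv emb s))"]
      continuous_of_cl[OF C M cl_morphismD(1)[OF T], of "\<lambda>s. emb (T (inv emb s))"]
    by (simp add: inv_f_f[OF inj_emb] cgen_eq_emb g)
  then have "?P (extend_morphism gdeg M g)"
    unfolding extend_morphism_def by (rule someI[where P = ?P])
  then have f: "lie_morphism (cfree_lie gdeg) M (extend_morphism gdeg M g)"
    "continuous_linear (cfree_lie gdeg) M (extend_morphism gdeg M g)"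
    "extend_morphism gdeg M g (emb (gen v)) = emb (T (gen v))" for v
    by (simp_all add: g flip: cgen_eq_emb)
  show ?thesis
    by (rule graded_linear_eq_on_words[OF C M cl_morphismD(1)[OF T] _ f(2) cfree_word_values[OF M' T f(1,3)] x])
      (use f(1) in \<open>simp add: lie_morphism_def\<close>)
qed

lemma extend_derivation_eq:
  fixes g :: "'g::graded_generators \<Rightarrow> 'g cfl"
  assumes T: "cl_derivation k T" and g: "\<And>v. g v = emb (T (gen v))" and x: "x \<in> Tot"
  shows "extend_derivation gdeg k g (emb x) = emb (T x)"
proof -
  note C = models_filt_cfree_lie[where 'g = 'g]
  note C' = models_filtD(1)[OF C]
  note m = modelsD[OF C']
  let ?C = "cfree_lie (gdeg :: 'g \<Rightarrow> int)"
  let ?P = "\<lambda>f. derivation ?C k f \<and> continuous_linear ?C ?C f \<and> (\<forall>v. f (cgen gdeg v) = g v)"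
  have "?P (\<lambda>s. emb (T (inv emb s)))"
    using derivation_of_cl[OF C' T, of "\<lambda>s. emb (T (inv emb s))"]
      continuous_of_cl[OF C C cl_derivationD(1)[OF T], of "\<lambda>s. emb (T (inv emb s))"]
    by (simp add: inv_f_f[OF inj_emb] cgen_eq_emb g)
  then have "?P (extend_derivation gdeg k g)"
    unfolding extend_derivation_def by (rule someI[where P = ?P])
  then have f: "derivation ?C k (extend_derivation gdeg k g)"
    "continuous_linear ?C ?C (extend_derivation gdeg k g)"
    "extend_derivation gdeg k g (emb (gen v)) = emb (T (gen v))" for v
    by (simp_all add: g flip: cgen_eq_emb)
  have words: "extend_derivation gdeg k g (emb (word t)) = emb (T (word t))" for t
  proof (induction t)
    case (Br l r)
    have "emb (word l) \<in> hcomp ?C (brdeg gdeg l)" unfolding m(5) using word_Hom by blast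
    then have "extend_derivation gdeg k g (gbr ?C (emb (word l)) (emb (word r))) =
        gadd ?C (gbr ?C (extend_derivation gdeg k g (emb (word l))) (emb (word r)))
          (gscale ?C (parity_sign (k * brdeg gdeg l)) (gbr ?C (emb (word l)) (extend_derivation gdeg k g (emb (word r)))))"
      using f(1) word_Tot[of r] unfolding derivation_def models_gtotal[OF C'] by blast
    then show ?case
      using Br by (simp add: m cl_derivationD(2)[OF T word_Hom])
  qed (simp add: f(3))
  show ?thesis
    by (rule graded_linear_eq_on_words[OF C C cl_derivationD(1)[OF T] _ f(2) words x])
      (use f(1) in \<open>simp add: derivation_def\<close>)
qed

lemma fsuminf_emb:
  assumes L: "models_filt L" and z: "\<And>n. z n \<in> Fil n" "\<And>n. z n \<in> Hom p" and f: "\<And>n. f n = emb (z n)"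
  shows "fsuminf L f = emb (lsum z)"
proof -
  note m = modelsD[OF models_filtD(1)[OF L]]
  have lH: "lsum z \<in> Hom p" by (rule lsum_Hom[OF z])
  have s: "gsum_list L (map f [0..<k]) = emb (\<Sum>i<k. z i)" for k
    unfolding f models_gsum_list[OF models_filtD(1)[OF L]]
    by (simp add: interv_sum_list_conv_sum_set_nat atLeast0LessThan)
  have sT: "(\<Sum>i<k. z i) \<in> Tot" for k using z(2) by blast
  have iff: "gsum_list L (map f [0..<k]) \<boxminus>\<^bsub>L\<^esub> emb l \<in> filt L n \<longleftrightarrow> (\<Sum>i<k. z i) - l \<in> Fil n"
    if "l \<in> Tot" for k n l
    unfolding s m(6) models_filtD(2)[OF L] inj_image_mem_iff[OF inj_emb] using sT[of k] that by auto
  show ?thesis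
    unfolding fsuminf_def flim_def models_gtotal[OF models_filtD(1)[OF L]]
  proof (rule the_equality)
    have lT: "lsum z \<in> Tot" using lH by blast
    have "(\<Sum>i<k. z i) - lsum z \<in> Fil n" if "n \<le> k" for n k
      using Fil_mono[OF that Fil_closed(5)[OF lsum_Fil[OF z(1), of k]]] by simp
    then show "emb (lsum z) \<in> emb ` Tot \<and>
        (\<forall>n. \<exists>N. \<forall>k\<ge>N. gsum_list L (map f [0..<k]) \<boxminus>\<^bsub>L\<^esub> emb (lsum z) \<in> filt L n)"
      unfolding iff[OF lT] using lT by blast
  next
    fix t assume t: "t \<in> emb ` Tot \<and> (\<forall>n. \<exists>N. \<forall>k\<ge>N. gsum_list L (map f [0..<k]) \<boxminus>\<^bsub>L\<^esub> t \<in> filt L n)"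
    then obtain l where l: "t = emb l" "l \<in> Tot" by blast
    have "lsum z - l \<in> Fil n" for n
    proof -
      obtain N where "\<forall>k\<ge>N. (\<Sum>i<k. z i) - l \<in> Fil n"
        using t unfolding l(1) iff[OF l(2)] by blast
      then have "(\<Sum>i<max N n. z i) - l \<in> Fil n" by simp
      moreover have "lsum z - (\<Sum>i<max N n. z i) \<in> Fil n"
        using Fil_mono[OF _ lsum_Fil[OF z(1), of "max N n"], of n] by simp
      ultimately show ?thesis using Fil_closed(2) by fastforce
    qed
    from Fil_zero[OF this] show "t = emb (lsum z)" by (simp add: l(1))
  qed
qed

section \<open>Complete differential graded Lie algebras from derivations of square zero\<close>

text \<open>
  All axioms have been transferred separately; what remains is that the filtration is spanned by its
  homogeneous elements, since the projections to the degrees preserve it.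
\<close>

lemma cdgl_of_cl:
  fixes L :: "('g::graded_generators cfl, 'm) dgl_scheme"
  assumes L: "models_filt L" and D: "cl_derivation (- 1) D" and DD: "\<And>x. D (D x) = 0"
    and diff: "\<And>x. x \<in> Tot \<Longrightarrow> diff L (emb x) = emb (D x)"
  shows "cdgl L"
proof -
  note L' = models_filtD(1)[OF L]
  note m = modelsD[OF L'] and tot = models_gtotal[OF L'] and f = models_filtD(2)[OF L]
  note d = cl_derivationD(1)[OF D]
  have "filt L n = gspan L (\<Union>p. filt L n \<inter> hcomp L p)" for n
  proof
    show "filt L n \<subseteq> gspan L (\<Union>p. filt L n \<inter> hcomp L p)"
    proof
      fix s assume "s \<in> filt L n"
      then obtain x where x: "s = emb x" "x \<in> Fil n" "x \<in> Tot" unfolding f by blast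
      then obtain P where P: "finite P" "x = (\<Sum>p\<in>P. proj p x)" unfolding Tot_def by blast
      have "emb (\<Sum>p\<in>P. proj p x) \<in> gspan L (\<Union>p. filt L n \<inter> hcomp L p)"
        using P(1)
      proof (induction P)
        case empty
        show ?case using gspan.zero[of L] by (simp add: m(1))
      next
        case (insert q P)
        have "proj q x \<in> Fil n" "proj q x \<in> Hom q" using x(2) by auto
        then have "emb (proj q x) \<in> gspan L (\<Union>p. filt L n \<inter> hcomp L p)"
          by (intro gspan.base) (auto simp: f m(5))
        from gspan.add[OF this insert.IH] show ?case using insert.hyps by (simp add: m(2))
      qed
      then show "s \<in> gspan L (\<Union>p. filt L n \<inter> hcomp L p)" using P(2) x(1) by simp
    qed
    show "gspan L (\<Union>p. filt L n \<inter> hcomp L p) \<subseteq> filt L n"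
    proof
      fix s assume "s \<in> gspan L (\<Union>p. filt L n \<inter> hcomp L p)"
      then show "s \<in> filt L n"
        unfolding f by induction (auto simp: m(1-3))
    qed
  qed
  moreover have "filt L 0 = gtotal L" "filt L 1 = gtotal L"
    unfolding f tot by auto
  moreover have "filt L (Suc n) \<subseteq> filt L n" for n
    unfolding f using Fil_mono[of n "Suc n"] by auto
  moreover have "gbr L x y \<in> filt L (k + n)" if "x \<in> filt L k" "y \<in> filt L n" for k n x y
    using that unfolding f by (auto simp: m(4) br_Fil br_Tot)
  moreover have "diff L ` filt L n \<subseteq> filt L n" for n
    unfolding f by (auto simp: diff cl_linearD(4)[OF d] cl_linear_Tot[OF d])
  moreover have "diff L (diff L x) = gzero L" if "x \<in> gtotal L" for x
    using that unfolding tot by (auto simp: diff cl_linear_Tot[OF d] DD m(1))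
  ultimately show ?thesis
    unfolding cdgl_def
    using models_graded_lie_algebra[OF L'] derivation_of_cl[OF L' D diff] models_complete[OF L]
    by blast
qed

lemma cdgl_morphism_of_cl:
  assumes L: "models_filt L" and M: "models_filt M" and T: "cl_morphism T"
    and f: "\<And>x. x \<in> Tot \<Longrightarrow> f (emb x) = emb (T x)"
    and D: "cl_linear k D" and dL: "\<And>x. x \<in> Tot \<Longrightarrow> diff L (emb x) = emb (D x)"
    and dM: "\<And>x. x \<in> Tot \<Longrightarrow> diff M (emb x) = emb (E x)" and comm: "\<And>x. T (D x) = E (T x)"
  shows "cdgl_morphism L M f"
  unfolding cdgl_morphism_def
  using lie_morphism_of_cl[OF models_filtD(1)[OF L] models_filtD(1)[OF M] T f]
    continuous_of_cl[OF L M cl_morphismD(1)[OF T] f]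
  by (auto simp: models_gtotal[OF models_filtD(1)[OF L]] f dL dM comm cl_linear_Tot[OF D]
      cl_linear_Tot[OF cl_morphismD(1)[OF T]])

section \<open>The cylinder of the point\<close>

instantiation unit :: graded_generators
begin
definition gdeg_unit: "gdeg = point_deg"
instance ..
end

instantiation interval_gen :: graded_generators
begin
definition gdeg_interval_gen: "gdeg = interval_deg"
instance
proof
  have "x \<in> {IA, IB, IX}" for x by (cases x) auto
  then have "(UNIV :: interval_gen set) = {IA, IB, IX}" by blast
  then show "finite (UNIV :: interval_gen set)" by (rule finite_subset[OF equalityD1]) simp
qed
end

instantiation vus_gen :: (graded_generators) graded_generators
begin
definition gdeg_vus_gen: "gdeg = vus_deg gdeg"
instance
proof
  have "x \<in> range InV \<union> range InU \<union> range InSU" for x :: "'a vus_gen" by (cases x) auto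
  then have "(UNIV :: 'a vus_gen set) = range InV \<union> range InU \<union> range InSU" by blast
  moreover have "finite (range InV \<union> range InU \<union> range InSU :: 'a vus_gen set)" by simp
  ultimately show "finite (UNIV :: 'a vus_gen set)" by simp
qed
end

instantiation cyl_gen :: (graded_generators) graded_generators
begin
definition gdeg_cyl_gen: "gdeg = cyl_deg gdeg"
instance
proof
  have "x \<in> range Bot \<union> range Top \<union> range Bar" for x :: "'a cyl_gen" by (cases x) auto
  then have "(UNIV :: 'a cyl_gen set) = range Bot \<union> range Top \<union> range Bar" by blast
  moreover have "finite (range Bot \<union> range Top \<union> range Bar :: 'a cyl_gen set)" by simp
  ultimately show "finite (UNIV :: 'a cyl_gen set)" by simp
qed
end

lemma point_deg_eq: "point_deg = gdeg" and interval_deg_eq: "interval_deg = gdeg"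
  and vus_deg_eq: "vus_deg (gdeg :: 'g::graded_generators \<Rightarrow> int) = gdeg"
  and cyl_deg_eq: "cyl_deg (gdeg :: 'g::graded_generators \<Rightarrow> int) = gdeg"
  by (simp_all add: gdeg_unit gdeg_interval_gen gdeg_vus_gen gdeg_cyl_gen)

lemma generator_degrees:
  "gen () \<in> Hom (- 1)" "gen IA \<in> Hom (- 1)" "gen IB \<in> Hom (- 1)" "gen IX \<in> Hom 0"
  "gen (InV ()) \<in> Hom (- 1)" "gen (InU ()) \<in> Hom (- 1)" "gen (InSU ()) \<in> Hom 0"
  "gen (Bot ()) \<in> Hom (- 1)" "gen (Top ()) \<in> Hom (- 1)" "gen (Bar ()) \<in> Hom 0"
  using Hom_gen[of "()"] Hom_gen[of IA] Hom_gen[of IB] Hom_gen[of IX]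
    Hom_gen[of "InV ()"] Hom_gen[of "InU ()"] Hom_gen[of "InSU ()"]
    Hom_gen[of "Bot ()"] Hom_gen[of "Top ()"] Hom_gen[of "Bar ()"]
  by (simp_all add: gdeg_unit gdeg_interval_gen gdeg_vus_gen gdeg_cyl_gen point_deg_def)

lemma mc_Hom: "a \<in> Hom (- 1) \<Longrightarrow> mc a \<in> Hom (- 2)"
  using br_Hom[of a "- 1" a "- 1"] by auto

lemma point_differential:
  obtains d where "cl_derivation (- 1) d" "d (gen ()) = mc (gen ())"
  using cl_derivation_exists[of "\<lambda>_. mc (gen ())" "- 1"] mc_Hom[OF generator_degrees(1)]
  by (auto simp: gdeg_unit point_deg_def)

lemma vus_derivations:
  obtains d i :: "unit vus_gen cl \<Rightarrow> unit vus_gen cl"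
  where "cl_derivation (- 1) d" "d (gen (InV ())) = mc (gen (InV ()))" "d (gen (InU ())) = 0"
    "d (gen (InSU ())) = gen (InU ())"
    "cl_derivation 1 i" "i (gen (InV ())) = gen (InSU ())" "i (gen (InU ())) = 0" "i (gen (InSU ())) = 0"
proof -
  define g :: "unit vus_gen \<Rightarrow> unit vus_gen cl"
    where "g = case_vus_gen (\<lambda>_. mc (gen (InV ()))) (\<lambda>_. 0) (\<lambda>_. gen (InU ()))"
  define h :: "unit vus_gen \<Rightarrow> unit vus_gen cl"
    where "h = case_vus_gen (\<lambda>_. gen (InSU ())) (\<lambda>_. 0) (\<lambda>_. 0)"
  have deg: "gdeg (InV ()) = - 1" "gdeg (InU ()) = - 1" "gdeg (InSU ()) = 0"
    by (simp_all add: gdeg_vus_gen gdeg_unit point_deg_def)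
  have "g v \<in> Hom (gdeg v + - 1)" "h v \<in> Hom (gdeg v + 1)" for v
    using generator_degrees(6,7) mc_Hom[OF generator_degrees(5)]
    by (cases v; simp add: g_def h_def deg Hom_closed(1))+
  then obtain d i where "cl_derivation (- 1) d" "\<And>v. d (gen v) = g v" "cl_derivation 1 i" "\<And>v. i (gen v) = h v"
    using cl_derivation_exists[of g "- 1"] cl_derivation_exists[of h 1] by metis
  then show thesis by (intro that[of d i]) (simp_all add: g_def h_def)
qed

lemma mc_diff_emb:
  assumes "models L"
  shows "mc_diff L (emb a) = emb (mc a)"
  using assms by (simp add: mc_diff_def modelsD)

lemma LS_point_diff:
  assumes "cl_derivation (- 1) d" "d (gen ()) = mc (gen ())" "x \<in> Tot"
  shows "diff LS_point (emb x) = emb (d x)"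
  unfolding LS_point_def diff_cfree_dgl point_deg_eq
  using assms
  by (intro extend_derivation_eq)
    (simp_all add: cgen_eq_emb mc_diff_emb[OF models_filtD(1)[OF models_filt_cfree_lie]])

lemma models_filt_cylinder_point: "models_filt (cylinder point_deg LS_point)"
  unfolding cylinder_def point_deg_eq cyl_deg_eq by (rule models_filt_cfree_dgl)

text \<open>
  Here \<open>\<chi>\<close> is the inverse of \<open>\<psi>\<close>. It is defined on the generator \<open>u\<close> by the Lawrence-Sullivan formula,
  which is exactly what solving \<open>b = e\<^sup>\<theta> a\<close> for \<open>u\<close> requires. The differential is \<open>D = \<chi> \<circ> d \<circ> \<psi>\<close>.
\<close>

lemma cylinder_point_differential:
  obtains D :: "unit cyl_gen cl \<Rightarrow> unit cyl_gen cl"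
  where "cl_derivation (- 1) D" "\<And>y. D (D y) = 0"
    "D (gen (Bot ())) = mc (gen (Bot ()))" "D (gen (Top ())) = mc (gen (Top ()))"
    "D (gen (Bar ())) = LS_formula (gen (Bar ())) (gen (Top ())) (gen (Bot ()))"
    "\<And>y. y \<in> Tot \<Longrightarrow> diff (cylinder point_deg LS_point) (emb y) = emb (D y)"
proof -
  note mv = modelsD[OF models_filtD(1)[OF models_filt_cfree_lie[where 'g = "unit vus_gen"]]]
  define a u x where "a = gen (InV ())" and "u = gen (InU ())" and "x = gen (InSU ())"
  have deg: "a \<in> Hom (- 1)" "u \<in> Hom (- 1)" "x \<in> Hom 0"
    using generator_degrees by (simp_all add: a_def u_def x_def)
  obtain dp where dp: "cl_derivation (- 1) dp" "dp (gen ()) = mc (gen ())" by (rule point_differential)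
  note dp_diff = LS_point_diff[OF dp]
  obtain d i where d: "cl_derivation (- 1) d" "d a = mc a" "d u = 0" "d x = u"
    and i: "cl_derivation 1 i" "i a = x" "i u = 0" "i x = 0"
    unfolding a_def u_def x_def by (rule vus_derivations)
  note dl = cl_linearD[OF cl_derivationD(1)[OF d(1)]] and il = cl_linearD[OF cl_derivationD(1)[OF i(1)]]
  \<comment> \<open>\<open>d\<^sup>2\<close> is a derivation, so only \<open>d (d a) = 0\<close> has content.\<close>
  have dd: "d (d y) = 0" for y
  proof -
    have "d (d (gen v)) = 0" for v
    proof (cases v)
      case (InV w)
      then show ?thesis using mc_square_zero[OF d(1) deg(1) d(2)] by (simp add: a_def)
    qed (use d dl(5) in \<open>simp_all add: u_def x_def\<close>)
    then have "(\<lambda>y. d (d y)) = (\<lambda>y. 0)"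
      by (intro cl_derivation_eqI[OF cl_derivation_square[OF d(1)] cl_derivation_zero]) simp
    then show ?thesis by (rule fun_cong)
  qed
  define \<theta> where "\<theta> y = i (d y) + d (i y)" for y
  have \<theta>: "cl_derivation 0 \<theta>"
    unfolding \<theta>_def[abs_def] by (rule cl_derivation_anticommutator[OF d(1) i(1)])
  have comm: "d (\<theta> y) = \<theta> (d y)" for y by (simp add: \<theta>_def dl dd il)
  have \<theta>_gens: "\<theta> x = 0" "\<theta> u = 0" "\<theta> a = u - br x a"
  proof -
    show "\<theta> x = 0" "\<theta> u = 0" by (simp_all add: \<theta>_def d i dl(5) il(5))
    \<comment> \<open>\<open>i\<close> and \<open>a\<close> are odd, so both terms of \<open>i [a, a]\<close> equal \<open>[x, a]\<close>.\<close>
    have "br a x = - br x a" using br_antisym[OF deg(1,3)] by simp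
    then have "i (br a a) = br x a + br x a"
      using cl_derivationD(2)[OF i(1) deg(1), of a] by (simp add: i(2) parity_sign_if)
    then show "\<theta> a = u - br x a"
      by (simp add: \<theta>_def d i il(2,7) flip: cl.scale_left_distrib add: cl.scale_right_distrib)
  qed
  note cexp = cexp_eq_endpoint[OF \<theta> deg(3) \<theta>_gens]
  define b where "b = endpoint x a u"
  have b: "cexp \<theta> a = b" "b \<in> Hom (- 1)"
    using cexp(2) endpoint_Hom[OF deg(3,1,2)] by (simp_all add: b_def)
  have db: "d b = mc b"
    using cexp_mc[OF d(1) \<theta> comm deg(1) d(2) cexp(1)] by (simp add: b(1))
  define a' b' x' where "a' = gen (Bot ())" and "b' = gen (Top ())" and "x' = gen (Bar ())"
  have deg': "a' \<in> Hom (- 1)" "b' \<in> Hom (- 1)" "x' \<in> Hom 0"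
    using generator_degrees by (simp_all add: a'_def b'_def x'_def)
  define u' where "u' = LS_formula x' b' a'"
  have u': "u' \<in> Hom (- 1)" unfolding u'_def by (rule LS_formula_Hom[OF deg'(3,1,2)])
  have gd: "gdeg (Bot ()) = - 1" "gdeg (Top ()) = - 1" "gdeg (Bar ()) = 0"
    "gdeg (InV ()) = - 1" "gdeg (InU ()) = - 1" "gdeg (InSU ()) = 0"
    by (simp_all add: gdeg_cyl_gen gdeg_vus_gen gdeg_unit point_deg_def)
  have "case_cyl_gen (\<lambda>_. a) (\<lambda>_. b) (\<lambda>_. x) v \<in> Hom (gdeg v)" for v :: "unit cyl_gen"
    using deg b(2) by (cases v) (simp_all add: gd)
  from cl_morphism_exists[of "case_cyl_gen (\<lambda>_. a) (\<lambda>_. b) (\<lambda>_. x)", OF this]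
  obtain \<psi> where \<psi>: "cl_morphism \<psi>" "\<psi> a' = a" "\<psi> b' = b" "\<psi> x' = x"
    by (auto simp: a'_def b'_def x'_def)
  have "case_vus_gen (\<lambda>_. a') (\<lambda>_. u') (\<lambda>_. x') v \<in> Hom (gdeg v)" for v :: "unit vus_gen"
    using deg' u' by (cases v) (simp_all add: gd)
  from cl_morphism_exists[of "case_vus_gen (\<lambda>_. a') (\<lambda>_. u') (\<lambda>_. x')", OF this]
  obtain \<chi> where \<chi>: "cl_morphism \<chi>" "\<chi> a = a'" "\<chi> u = u'" "\<chi> x = x'"
    by (auto simp: a_def u_def x_def)
  have \<chi>\<psi>: "\<chi> (\<psi> y) = y" for y
  proof -
    have "\<chi> (\<psi> (gen v)) = gen v" for v
    proof (cases v)
      case (Top w)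
      have "\<chi> b = endpoint x' a' u'" by (simp add: b_def endpoint_morphism[OF \<chi>(1)] \<chi>)
      then show ?thesis using Top \<psi>(3) by (simp add: u'_def endpoint_LS_formula b'_def)
    qed (use \<psi> \<chi> in \<open>simp_all add: a'_def x'_def\<close>)
    then have "(\<lambda>y. \<chi> (\<psi> y)) = (\<lambda>y. y)"
      by (intro cl_morphism_eqI[OF cl_morphism_compose[OF \<chi>(1) \<psi>(1)] cl_morphism_id])
    then show ?thesis by (rule fun_cong)
  qed
  have \<psi>\<chi>: "\<psi> (\<chi> y) = y" for y
  proof -
    have "\<psi> (\<chi> (gen v)) = gen v" for v
    proof (cases v)
      case (InU w)
      have "\<psi> u' = LS_formula x b a" by (simp add: u'_def LS_formula_morphism[OF \<psi>(1)] \<psi>)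
      then show ?thesis using InU \<chi>(3) by (simp add: b_def LS_formula_endpoint u_def)
    qed (use \<psi> \<chi> in \<open>simp_all add: a_def x_def\<close>)
    then have "(\<lambda>y. \<psi> (\<chi> y)) = (\<lambda>y. y)"
      by (intro cl_morphism_eqI[OF cl_morphism_compose[OF \<psi>(1) \<chi>(1)] cl_morphism_id])
    then show ?thesis by (rule fun_cong)
  qed
  define D where "D y = \<chi> (d (\<psi> y))" for y
  have D: "cl_derivation (- 1) D"
    unfolding D_def[abs_def] by (rule cl_derivation_conjugate[OF \<chi>(1) \<psi>(1) d(1) \<chi>\<psi>])
  have \<chi>l: "\<chi> (mc y) = mc (\<chi> y)" for y
    by (simp only: cl_linearD(2)[OF cl_morphismD(1)[OF \<chi>(1)]] cl_morphismD(2)[OF \<chi>(1)])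
  have DD: "D (D y) = 0" for y
    by (simp add: D_def \<psi>\<chi> dd cl_linearD(5)[OF cl_morphismD(1)[OF \<chi>(1)]])
  have D_gens: "D a' = mc a'" "D b' = mc b'" "D x' = u'"
    unfolding D_def \<psi> d db \<chi>l \<chi> using \<chi>\<psi>[of b'] \<psi>(3) by simp_all
  \<comment> \<open>From here on, the choices made on records are identified with \<open>d\<close>, \<open>i\<close>, \<open>\<theta>\<close> and \<open>\<psi>\<close>.\<close>
  have vus_diff: "vus_diff point_deg (diff LS_point) (emb y) = emb (d y)" if "y \<in> Tot" for y
  proof -
    obtain \<iota> where \<iota>: "cl_morphism \<iota>" "\<iota> (gen ()) = a"
      using cl_morphism_exists[of "\<lambda>_ :: unit. a"] deg(1) by (auto simp: gdeg_unit point_deg_def)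
    have incl: "vus_incl gdeg (emb z) = emb (\<iota> z)" if "z \<in> Tot" for z
      unfolding vus_incl_def vus_deg_eq
      by (rule extend_morphism_eq[OF models_filt_cfree_lie \<iota>(1) _ that])
        (simp add: cgen_eq_emb \<iota>(2) a_def)
    have gen_Tot: "gen () \<in> Tot" using generator_degrees(1) by blast
    have dpT: "dp (gen ()) \<in> Tot" by (rule cl_linear_Tot[OF cl_derivationD(1)[OF dp(1)] gen_Tot])
    have \<iota>d: "\<iota> (dp (gen ())) = mc a"
      by (simp only: dp(2) cl_linearD(2)[OF cl_morphismD(1)[OF \<iota>(1)]] cl_morphismD(2)[OF \<iota>(1)] \<iota>(2))
    show ?thesis
      unfolding vus_diff_def point_deg_eq vus_deg_eq
    proof (rule extend_derivation_eq[OF d(1) _ that])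
      fix v :: "unit vus_gen"
      show "(case v of InV v \<Rightarrow> vus_incl gdeg (diff LS_point (cgen gdeg v))
          | InU v \<Rightarrow> gzero (cfree_lie gdeg) | InSU v \<Rightarrow> cgen gdeg (InU v)) = emb (d (gen v))"
        using d by (cases v)
          (simp_all add: cgen_eq_emb dp_diff[OF gen_Tot] incl[OF dpT] \<iota>d mv(1) a_def u_def x_def)
    qed
  qed
  have vus_i: "vus_i point_deg (emb y) = emb (i y)" if "y \<in> Tot" for y
    unfolding vus_i_def point_deg_eq vus_deg_eq
  proof (rule extend_derivation_eq[OF i(1) _ that])
    fix v :: "unit vus_gen"
    show "(case v of InV v \<Rightarrow> cgen gdeg (InSU v) | InU v \<Rightarrow> gzero (cfree_lie gdeg)
        | InSU v \<Rightarrow> gzero (cfree_lie gdeg)) = emb (i (gen v))"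
      using i by (cases v) (simp_all add: cgen_eq_emb mv(1) a_def u_def x_def)
  qed
  have dT: "d y \<in> Tot" and iT: "i y \<in> Tot" if "y \<in> Tot" for y
    using that by (auto intro: cl_linear_Tot[OF cl_derivationD(1)[OF d(1)]] cl_linear_Tot[OF cl_derivationD(1)[OF i(1)]])
  have theta: "vus_theta point_deg (diff LS_point) (emb y) = emb (\<theta> y)" if "y \<in> Tot" for y
    unfolding vus_theta_def vus_diff[OF that] vus_i[OF that] vus_i[OF dT[OF that]] vus_diff[OF iT[OF that]]
    by (simp add: point_deg_eq vus_deg_eq mv(2) \<theta>_def)
  have \<theta>n: "(\<theta> ^^ n) a \<in> Hom (- 1)" for n
  proof (induction n)
    case (Suc n)
    then show ?case using cl_linearD(3)[OF cl_derivationD(1)[OF \<theta>], of "(\<theta> ^^ n) a" "- 1"] by simp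
  qed (simp add: deg)
  have theta_pow: "(vus_theta point_deg (diff LS_point) ^^ n) (emb a) = emb ((\<theta> ^^ n) a)" for n
    by (induction n) (simp_all add: theta[OF Tot_closed(4)[OF \<theta>n]])
  have gexp: "gexp (cfree_lie gdeg) (vus_theta point_deg (diff LS_point)) (emb a) = emb b"
    unfolding gexp_def b(1)[symmetric] cexp_def
    by (rule fsuminf_emb[OF models_filt_cfree_lie, where p = "- 1"])
      (use cexp(1) \<theta>n in \<open>auto simp: theta_pow mv(3)\<close>)
  have psi: "cyl_psi point_deg (diff LS_point) (emb y) = emb (\<psi> y)" if "y \<in> Tot" for y
    unfolding cyl_psi_def point_deg_eq vus_deg_eq cyl_deg_eq
  proof (rule extend_morphism_eq[OF models_filt_cfree_lie \<psi>(1) _ that])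
    fix v :: "unit cyl_gen"
    show "(case v of Bot v \<Rightarrow> cgen gdeg (InV v)
        | Top v \<Rightarrow> gexp (cfree_lie gdeg) (vus_theta gdeg (diff LS_point)) (cgen gdeg (InV v))
        | Bar v \<Rightarrow> cgen gdeg (InSU v)) = emb (\<psi> (gen v))"
      using \<psi> gexp by (cases v) (simp_all add: cgen_eq_emb point_deg_eq a_def x_def a'_def b'_def x'_def)
  qed
  let ?cyl = "cylinder point_deg LS_point"
  have cyl_diff: "diff ?cyl (emb y) = emb (D y)" if y: "y \<in> Tot" for y
  proof -
    have \<psi>T: "\<psi> y \<in> Tot" and DT: "D y \<in> Tot"
      using cl_linear_Tot[OF cl_morphismD(1)[OF \<psi>(1)] y] cl_linear_Tot[OF cl_derivationD(1)[OF D] y] by auto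
    have tot: "gtotal (cfree_lie (cyl_deg point_deg)) = emb ` (Tot :: unit cyl_gen cl set)"
      unfolding point_deg_eq cyl_deg_eq by (rule models_gtotal[OF models_filtD(1)[OF models_filt_cfree_lie]])
    have "inj_on (cyl_psi point_deg (diff LS_point)) (emb ` Tot)"
    proof (rule inj_onI)
      fix s t assume "s \<in> emb ` Tot" "t \<in> emb ` Tot"
        and eq: "cyl_psi point_deg (diff LS_point) s = cyl_psi point_deg (diff LS_point) t"
      then obtain z w where zw: "s = emb z" "t = emb w" "z \<in> Tot" "w \<in> Tot" by blast
      have "\<psi> z = \<psi> w" using eq unfolding zw(1,2) psi[OF zw(3)] psi[OF zw(4)] by simp
      then have "\<chi> (\<psi> z) = \<chi> (\<psi> w)" by simp
      then show "s = t" using zw by (simp add: \<chi>\<psi>)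
    qed
    then have "inv_into (emb ` Tot) (cyl_psi point_deg (diff LS_point)) (emb (d (\<psi> y))) = emb (D y)"
      by (rule inv_into_f_eq) (use DT in \<open>simp_all add: psi D_def \<psi>\<chi>\<close>)
    then show ?thesis
      by (simp add: cylinder_def tot psi[OF y] vus_diff[OF \<psi>T])
  qed
  show thesis
    by (rule that[OF D DD D_gens[unfolded a'_def b'_def x'_def u'_def] cyl_diff])
qed

section \<open>The isomorphism\<close>

theorem theorem0p4:
  shows "cdgl_isomorphic LS_interval (cylinder point_deg LS_point)"
proof -
  let ?cyl = "cylinder point_deg LS_point" and ?Ci = "cfree_lie (gdeg :: interval_gen \<Rightarrow> int)"
  note cyl = models_filt_cylinder_point
  note mi = modelsD[OF models_filtD(1)[OF models_filt_cfree_lie[where 'g = interval_gen]]]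
  define a' b' x' where "a' = gen (Bot ())" and "b' = gen (Top ())" and "x' = gen (Bar ())"
  obtain D where D: "cl_derivation (- 1) D" and DD: "\<And>y. D (D y) = 0"
    and D_gens: "D a' = mc a'" "D b' = mc b'" "D x' = LS_formula x' b' a'"
    and cyl_diff: "\<And>y. y \<in> Tot \<Longrightarrow> diff ?cyl (emb y) = emb (D y)"
    unfolding a'_def b'_def x'_def by (rule cylinder_point_differential) blast
  have deg': "a' \<in> Hom (- 1)" "b' \<in> Hom (- 1)" "x' \<in> Hom 0"
    using generator_degrees by (simp_all add: a'_def b'_def x'_def)
  have gd: "gdeg (Bot ()) = - 1" "gdeg (Top ()) = - 1" "gdeg (Bar ()) = 0"
    "gdeg IA = - 1" "gdeg IB = - 1" "gdeg IX = 0"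
    by (simp_all add: gdeg_cyl_gen gdeg_interval_gen gdeg_unit point_deg_def)
  \<comment> \<open>Both differentials have the same values on generators, so the renaming of generators transports
    one to the other; the interval gets its differential \<open>E\<close> from \<open>D\<close>.\<close>
  have "case_interval_gen a' b' x' v \<in> Hom (gdeg v)" for v
    using deg' by (cases v) (simp_all add: gd)
  from cl_morphism_exists[of "case_interval_gen a' b' x'", OF this]
  obtain R where R: "cl_morphism R" "R (gen IA) = a'" "R (gen IB) = b'" "R (gen IX) = x'"
    by (auto dest: spec[of _ IA] spec[of _ IB] spec[of _ IX])
  have "case_cyl_gen (\<lambda>_. gen IA) (\<lambda>_. gen IB) (\<lambda>_. gen IX) v \<in> Hom (gdeg v)" for v :: "unit cyl_gen"
    using generator_degrees by (cases v) (simp_all add: gd)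
  from cl_morphism_exists[of "case_cyl_gen (\<lambda>_. gen IA) (\<lambda>_. gen IB) (\<lambda>_. gen IX)", OF this]
  obtain S where S: "cl_morphism S" "S a' = gen IA" "S b' = gen IB" "S x' = gen IX"
    by (auto simp: a'_def b'_def x'_def)
  have SR: "S (R y) = y" for y
  proof -
    have "S (R (gen v)) = gen v" for v by (cases v) (simp_all add: R S)
    then have "(\<lambda>y. S (R y)) = (\<lambda>y. y)"
      by (intro cl_morphism_eqI[OF cl_morphism_compose[OF S(1) R(1)] cl_morphism_id])
    then show ?thesis by (rule fun_cong)
  qed
  have RS: "R (S y) = y" for y
  proof -
    have "R (S (gen v)) = gen v" for v
      using R S by (cases v) (simp_all add: a'_def b'_def x'_def)
    then have "(\<lambda>y. R (S y)) = (\<lambda>y. y)"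
      by (intro cl_morphism_eqI[OF cl_morphism_compose[OF R(1) S(1)] cl_morphism_id])
    then show ?thesis by (rule fun_cong)
  qed
  define E where "E y = S (D (R y))" for y
  have E: "cl_derivation (- 1) E"
    unfolding E_def[abs_def] by (rule cl_derivation_conjugate[OF S(1) R(1) D SR])
  have EE: "E (E y) = 0" for y
    by (simp add: E_def RS DD cl_linearD(5)[OF cl_morphismD(1)[OF S(1)]])
  have Sl: "S (mc y) = mc (S y)" for y
    by (simp only: cl_linearD(2)[OF cl_morphismD(1)[OF S(1)]] cl_morphismD(2)[OF S(1)])
  have E_gens: "E (gen IA) = mc (gen IA)" "E (gen IB) = mc (gen IB)"
    "E (gen IX) = LS_formula (gen IX) (gen IB) (gen IA)"
    unfolding E_def R D_gens Sl S LS_formula_morphism[OF S(1)] by simp_all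
  have int: "models_filt LS_interval" unfolding LS_interval_def interval_deg_eq by (rule models_filt_cfree_dgl)
  have int_diff: "diff LS_interval (emb y) = emb (E y)" if "y \<in> Tot" for y
    unfolding LS_interval_def diff_cfree_dgl interval_deg_eq
  proof (rule extend_derivation_eq[OF E _ that])
    fix v
    have pow: "(gbr ?Ci (emb y) ^^ n) (emb z) = emb ((br y ^^ n) z)" for y z n
      by (induction n) (simp_all add: mi(4))
    have "fsuminf ?Ci (\<lambda>n. (bernoulli n / fact n) \<odot>\<^bsub>?Ci\<^esub> (gbr ?Ci (emb (gen IX)) ^^ n) (emb (gen IB) \<boxminus>\<^bsub>?Ci\<^esub> emb (gen IA)))
        = emb (ad_series bernoulli_series (gen IX) (gen IB - gen IA))"
      unfolding ad_series_def
    proof (rule fsuminf_emb[OF models_filt_cfree_lie ad_series_terms, where p = "- 1"])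
      show "fps_nth bernoulli_series n *\<^sub>q (br (gen IX) ^^ n) (gen IB - gen IA) \<in> Hom (- 1)" for n
        using generator_degrees by (intro Hom_closed(3,4) ad_pow_Hom)
    qed (simp add: mi(3,6) pow bernoulli_def bernoulli_series_def)
    then show "interval_diff v = emb (E (gen v))"
      unfolding interval_diff_def interval_deg_eq Let_def cgen_eq_emb
      by (cases v) (simp_all add: E_gens mc_diff_emb[OF models_filtD(1)[OF models_filt_cfree_lie]] mi(2,4) LS_formula_def)
  qed
  have iso: "cdgl_morphism LS_interval ?cyl (\<lambda>s. emb (R (inv emb s)))"
    by (rule cdgl_morphism_of_cl[OF int cyl R(1) _ cl_derivationD(1)[OF E] int_diff cyl_diff])
      (simp_all add: inv_f_f[OF inj_emb] E_def RS)
  have iso': "cdgl_morphism ?cyl LS_interval (\<lambda>s. emb (S (inv emb s)))"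
    by (rule cdgl_morphism_of_cl[OF cyl int S(1) _ cl_derivationD(1)[OF D] cyl_diff int_diff])
      (simp_all add: inv_f_f[OF inj_emb] E_def RS)
  show ?thesis
    unfolding cdgl_isomorphic_def
  proof (intro conjI exI)
    show "cdgl LS_interval" by (rule cdgl_of_cl[OF int E EE int_diff])
    show "cdgl ?cyl" by (rule cdgl_of_cl[OF cyl D DD cyl_diff])
    show "cdgl_morphism LS_interval ?cyl (\<lambda>s. emb (R (inv emb s)))" by (rule iso)
    show "cdgl_morphism ?cyl LS_interval (\<lambda>s. emb (S (inv emb s)))" by (rule iso')
  qed (auto simp: models_gtotal[OF models_filtD(1)[OF int]] models_gtotal[OF models_filtD(1)[OF cyl]]
      inv_f_f[OF inj_emb] SR RS)
qed

end
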